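(* Let $d\ge 1$ and let $S$ and $T$ be quasihyperbolic automorphisms of the torus $\mathbb{T}^d=\mathbb{R}^d/\mathbb{Z}^d$. Let $\mathfrak{s}_-$ (resp. $\mathfrak{t}_-$) be the subspace of $\mathbb{R}^d$ contracted by $S$ (resp. by $T$), and let $\mathfrak{s}_0'$ (resp. $\mathfrak{t}_0'$) be the sum of the eigenspaces of $S$ (resp. of $T$) for eigenvalues of modulus $1$. Assume that $\mathbb{R}^d$ is spanned by $\mathfrak{s}_-\oplus\mathfrak{s}_0'$ and $\mathfrak{t}_-\oplus\mathfrak{t}_0'$. Then $$\dim\big(Eq(S)\cap ND(T)\big)=d,$$ where $\dim$ denotes Hausdorff dimension.
   Context: An endomorphism $S$ of $\mathbb{T}^d$ is identified with a nonsingular $d\times d$ integer matrix, acting on both $\mathbb{R}^d$ and $\mathbb{T}^d$; it is an automorphism if its determinant is $\pm1$. It is quasihyperbolic if no eigenvalue of the matrix is a root of unity (equivalently, $S$ is ergodic for Haar measure). The subspace $\mathfrak{s}_-\subset\mathbb{R}^d$ contracted by $S$ is the real subspace corresponding to the generalized eigenspaces of $S$ for eigenvalues of modulus less than $1$, i.e. $\mathbb{R}^d\cap\bigoplus_{|\lambda|<1}\ker_{\mathbb{C}^d}(S-\lambda)^d$. The space $\mathfrak{s}_0'$ is the real subspace corresponding to the genuine (not generalized) eigenspaces for eigenvalues of modulus $1$, i.e. $\mathfrak{s}_0'=\mathbb{R}^d\cap\bigoplus_{|\lambda|=1}\ker_{\mathbb{C}^d}(S-\lambda)$. The spaces $\mathfrak{t}_-,\mathfrak{t}_0'$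 are defined in the same way for $T$. "Spanned by" means that the (not necessarily direct) sum of the two subspaces is $\mathbb{R}^d$. Let $m$ be the Haar probability measure on $\mathbb{T}^d$. Then $$Eq(S)=\Big\{x\in\mathbb{T}^d:\ \tfrac1N\sum_{n=0}^{N-1}f(S^nx)\to\int f\,dm\ (N\to\infty)\ \text{for all } f\in C(\mathbb{T}^d)\Big\},$$ $D(T)=\{x\in\mathbb{T}^d:\ \overline{\{T^nx: n\ge 0\}}=\mathbb{T}^d\}$ and $ND(T)=\mathbb{T}^d\setminus D(T)$. *)

theory Defs
  imports "HOL-Analysis.Analysis"
begin

section \<open>The torus $R^d / Z^d$\<close>

definition int_lattice :: "(real ^ 'd) set" where
  "int_lattice = {k. \<forall>i. k $ i \<in> \<int>}"

lemma int_lattice_0: "0 \<in> int_lattice"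
  and int_lattice_add: "x \<in> int_lattice \<Longrightarrow> y \<in> int_lattice \<Longrightarrow> x + y \<in> int_lattice"
  and int_lattice_diff: "x \<in> int_lattice \<Longrightarrow> y \<in> int_lattice \<Longrightarrow> x - y \<in> int_lattice"
  and int_lattice_minus: "x \<in> int_lattice \<Longrightarrow> - x \<in> int_lattice"
  by (auto simp: int_lattice_def)

quotient_type (overloaded) 'd torus = "real ^ 'd" / "\<lambda>x y :: real ^ 'd. x - y \<in> int_lattice"
  morphisms rep_torus torus_proj
proof (rule equivpI)
  show "reflp (\<lambda>x y :: real ^ 'd. x - y \<in> int_lattice)"
    by (simp add: reflp_def int_lattice_0)
  show "symp (\<lambda>x y :: real ^ 'd. x - y \<in> int_lattice)"
    by (rule sympI) (metis int_lattice_minus minus_diff_eq)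
  show "transp (\<lambda>x y :: real ^ 'd. x - y \<in> int_lattice)"
  proof (rule transpI)
    fix x y z :: "real ^ 'd"
    assume "x - y \<in> int_lattice" "y - z \<in> int_lattice"
    from int_lattice_add[OF this] show "x - z \<in> int_lattice" by simp
  qed
qed

lemma closed_int_lattice: "closed (int_lattice :: (real ^ 'd) set)"
proof -
  have eq: "int_lattice = (\<Inter>i. (\<lambda>x :: real ^ 'd. x $ i) -` \<int>)"
    by (auto simp: int_lattice_def)
  show ?thesis
    unfolding eq by (intro closed_INT ballI closed_vimage closed_Ints continuous_intros)
qed

lemma infdist_int_lattice_shift_le:
  assumes "k \<in> int_lattice"
  shows "infdist (x + k) int_lattice \<le> infdist x int_lattice"
proof -
  obtain l where l: "l \<in> int_lattice" "infdist x int_lattice = dist x l"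
    using infdist_attains_inf[OF closed_int_lattice] int_lattice_0 by blast
  have "infdist (x + k) int_lattice \<le> dist (x + k) (l + k)"
    by (intro infdist_le int_lattice_add l assms)
  with l show ?thesis by simp
qed

lemma infdist_int_lattice_shift:
  assumes "x - y \<in> int_lattice"
  shows "infdist x int_lattice = infdist y int_lattice"
  using infdist_int_lattice_shift_le[OF assms, of y]
    infdist_int_lattice_shift_le[OF int_lattice_minus[OF assms], of x]
  by simp

lemma infdist_int_lattice_minus:
  "infdist (- x) int_lattice \<le> infdist x int_lattice"
proof -
  obtain l where l: "l \<in> int_lattice" "infdist x int_lattice = dist x l"
    using infdist_attains_inf[OF closed_int_lattice] int_lattice_0 by blast
  have "infdist (- x) int_lattice \<le> dist (- x) (- l)"
    by (intro infdist_le int_lattice_minus l)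
  with l show ?thesis by (simp add: dist_minus)
qed

lemma infdist_int_lattice_triangle:
  "infdist (x - z) int_lattice \<le> infdist (x - y) int_lattice + infdist (y - z) int_lattice"
proof -
  obtain l where l: "l \<in> int_lattice" "infdist (y - z) int_lattice = dist (y - z) l"
    using infdist_attains_inf[OF closed_int_lattice] int_lattice_0 by blast
  have "infdist (x - z) int_lattice = infdist (x - z - l) int_lattice"
    by (rule infdist_int_lattice_shift) (simp add: l)
  also have "\<dots> \<le> infdist (x - y) int_lattice + dist (x - z - l) (x - y)"
    by (rule infdist_triangle)
  also have "dist (x - z - l) (x - y) = dist (y - z) l"
    by (simp add: dist_norm algebra_simps)
  finally show ?thesis using l by simp
qed

text \<open>The flat quotient metric: the distance between two classes is the least Euclidean
  distance between representatives.\<close>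

instantiation torus :: (finite) metric_space
begin

lift_definition dist_torus :: "'a torus \<Rightarrow> 'a torus \<Rightarrow> real"
  is "\<lambda>x y. infdist (x - y) int_lattice"
proof -
  fix x x' y y' :: "real ^ 'a"
  assume "x - x' \<in> int_lattice" "y - y' \<in> int_lattice"
  from int_lattice_diff[OF this] have "(x - y) - (x' - y') \<in> int_lattice"
    by (simp add: algebra_simps)
  then show "infdist (x - y) int_lattice = infdist (x' - y') int_lattice"
    by (rule infdist_int_lattice_shift)
qed

definition uniformity_torus :: "('a torus \<times> 'a torus) filter" where
  "uniformity_torus = (INF e\<in>{0 <..}. principal {(x, y). dist x y < e})"

definition open_torus :: "'a torus set \<Rightarrow> bool" where
  "open_torus U \<longleftrightarrow> (\<forall>x\<in>U. eventually (\<lambda>(x', y). x' = x \<longrightarrow> y \<in> U) uniformity)"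

instance
proof
  fix x y z :: "'a torus"
  show "dist x y = 0 \<longleftrightarrow> x = y"
  proof transfer
    fix x y :: "real ^ 'a"
    show "infdist (x - y) int_lattice = 0 \<longleftrightarrow> x - y \<in> int_lattice"
      using in_closed_iff_infdist_zero[OF closed_int_lattice, of "x - y"] int_lattice_0 by blast
  qed
  show "dist x y \<le> dist x z + dist y z"
  proof transfer
    fix x y z :: "real ^ 'a"
    show "infdist (x - y) int_lattice \<le> infdist (x - z) int_lattice + infdist (y - z) int_lattice"
      using infdist_int_lattice_triangle[of x y z] infdist_int_lattice_minus[of "y - z"] by simp
  qed
qed (simp_all add: uniformity_torus_def open_torus_def)

end

lemma dist_torus_proj_le: "dist (torus_proj x) (torus_proj y) \<le> dist x y"
proof -
  have "infdist (x - y) int_lattice \<le> dist (x - y) 0"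
    by (rule infdist_le) (rule int_lattice_0)
  then show ?thesis by (simp add: dist_torus.abs_eq dist_norm)
qed

lemma continuous_on_torus_proj: "continuous_on A torus_proj"
  unfolding continuous_on_iff by (meson dist_torus_proj_le le_less_trans)

lemma torus_proj_measurable [measurable]: "torus_proj \<in> borel_measurable borel"
  by (rule borel_measurable_continuous_onI) (rule continuous_on_torus_proj)

text \<open>Haar probability measure: Lebesgue measure on the unit cube, a fundamental domain up to
  a null set, pushed forward to the torus.\<close>

definition haar_torus :: "'d::finite torus measure" where
  "haar_torus = distr (restrict_space lborel (cbox 0 1)) borel torus_proj"

lemma
  shows space_haar_torus: "space haar_torus = UNIV"
    and sets_haar_torus: "sets haar_torus = sets borel"
  by (simp_all add: haar_torus_def)

lemma emeasure_haar_torus_UNIV: "emeasure (haar_torus :: 'd::finite torus measure) UNIV = 1"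
proof -
  have "torus_proj \<in> restrict_space lborel (cbox 0 (1 :: real ^ 'd)) \<rightarrow>\<^sub>M borel"
    by (intro measurable_restrict_space1) simp
  moreover have "emeasure lborel (cbox 0 (1 :: real ^ 'd)) = 1"
  proof -
    have "(1 :: real ^ 'd) \<bullet> b = 1" if "b \<in> Basis" for b
      using that by (auto simp: Basis_vec_def inner_axis)
    then show ?thesis by (simp add: emeasure_lborel_cbox_eq)
  qed
  ultimately show ?thesis
    by (simp add: haar_torus_def emeasure_distr emeasure_restrict_space space_restrict_space)
qed


section \<open>Integer matrices acting on the torus\<close>

lift_definition torus_map :: "int ^ 'd ^ 'd \<Rightarrow> 'd::finite torus \<Rightarrow> 'd torus"
  is "\<lambda>A x. map_matrix real_of_int A *v x"
proof -
  fix A :: "int ^ 'd ^ 'd" and x y :: "real ^ 'd"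
  assume "x - y \<in> int_lattice"
  then have "map_matrix real_of_int A *v (x - y) \<in> int_lattice"
    by (auto simp: int_lattice_def matrix_vector_mult_def intro!: Ints_sum Ints_mult)
  then show "map_matrix real_of_int A *v x - map_matrix real_of_int A *v y \<in> int_lattice"
    by (simp add: matrix_vector_mult_diff_distrib)
qed

definition toral_automorphism :: "int ^ 'd ^ 'd \<Rightarrow> bool" where
  "toral_automorphism A \<longleftrightarrow> det A = 1 \<or> det A = - 1"

definition complex_mat :: "int ^ 'd ^ 'd \<Rightarrow> complex ^ 'd ^ 'd" where
  "complex_mat A = map_matrix of_int A"

definition complex_vec :: "real ^ 'd \<Rightarrow> complex ^ 'd" where
  "complex_vec x = (\<chi> i. complex_of_real (x $ i))"

definition eigenvalue :: "complex ^ 'd ^ 'd \<Rightarrow> complex \<Rightarrow> bool" where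
  "eigenvalue A l \<longleftrightarrow> (\<exists>v. v \<noteq> 0 \<and> A *v v = l *s v)"

definition eigenspace :: "complex ^ 'd ^ 'd \<Rightarrow> complex \<Rightarrow> (complex ^ 'd) set" where
  "eigenspace A l = {v. (A - mat l) *v v = 0}"

definition gen_eigenspace :: "complex ^ 'd ^ 'd \<Rightarrow> complex \<Rightarrow> (complex ^ 'd) set" where
  "gen_eigenspace A l = {v. (((*v) (A - mat l)) ^^ CARD('d)) v = 0}"

definition quasihyperbolic :: "int ^ 'd ^ 'd \<Rightarrow> bool" where
  "quasihyperbolic A \<longleftrightarrow>
    \<not> (\<exists>l. eigenvalue (complex_mat A) l \<and> (\<exists>n>0. l ^ n = 1))"

text \<open>Eigenspaces for distinct eigenvalues are independent, so their direct sum is the complex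
  span of their union; \<open>vec.span\<close> is the span over the field of entries, whereas \<open>span\<close> would be
  the real span.\<close>

definition contracted_space :: "int ^ 'd ^ 'd \<Rightarrow> (real ^ 'd) set" where
  "contracted_space A =
    {x. complex_vec x \<in> vec.span (\<Union>l\<in>{l. cmod l < 1}. gen_eigenspace (complex_mat A) l)}"

definition unimodular_eigenspace :: "int ^ 'd ^ 'd \<Rightarrow> (real ^ 'd) set" where
  "unimodular_eigenspace A =
    {x. complex_vec x \<in> vec.span (\<Union>l\<in>{l. cmod l = 1}. eigenspace (complex_mat A) l)}"


section \<open>Orbits\<close>

definition equidistributed_points :: "('d::finite torus \<Rightarrow> 'd torus) \<Rightarrow> 'd torus set" where
  "equidistributed_points F =
    {x. \<forall>f :: 'd torus \<Rightarrow> complex. continuous_on UNIV f \<longrightarrow>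
      (\<lambda>N. (\<Sum>n<N. f ((F ^^ n) x)) / of_nat N) \<longlonglongrightarrow> integral\<^sup>L haar_torus f}"

definition dense_orbit_points :: "('d::finite torus \<Rightarrow> 'd torus) \<Rightarrow> 'd torus set" where
  "dense_orbit_points F = {x. closure (range (\<lambda>n. (F ^^ n) x)) = UNIV}"

definition nondense_orbit_points :: "('d::finite torus \<Rightarrow> 'd torus) \<Rightarrow> 'd torus set" where
  "nondense_orbit_points F = - dense_orbit_points F"


section \<open>Hausdorff dimension\<close>

text \<open>The usual convention: the empty set contributes nothing, and \<open>diam U ^ 0 = 1\<close> for
  nonempty \<open>U\<close>, even when the diameter is \<open>0\<close> (where \<open>0 powr 0 = 0\<close>).\<close>

definition hausdorff_gauge :: "real \<Rightarrow> 'a::metric_space set \<Rightarrow> ennreal" where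
  "hausdorff_gauge s U =
    (if U = {} then 0 else if s = 0 then 1 else ennreal (diameter U powr s))"

text \<open>Boundedness is required because \<open>diameter\<close> carries no information on unbounded sets.\<close>

definition hausdorff_premeasure :: "real \<Rightarrow> real \<Rightarrow> 'a::metric_space set \<Rightarrow> ennreal" where
  "hausdorff_premeasure s \<delta> A =
    (INF U\<in>{U :: nat \<Rightarrow> 'a set. A \<subseteq> (\<Union>i. U i) \<and> (\<forall>i. bounded (U i) \<and> diameter (U i) \<le> \<delta>)}.
      \<Sum>i. hausdorff_gauge s (U i))"

definition hausdorff_outer_measure :: "real \<Rightarrow> 'a::metric_space set \<Rightarrow> ennreal" where
  "hausdorff_outer_measure s A = (SUP \<delta>\<in>{0<..}. hausdorff_premeasure s \<delta> A)"

definition hausdorff_dim :: "'a::metric_space set \<Rightarrow> ennreal" where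
  "hausdorff_dim A = Inf {ennreal s | s. s \<ge> 0 \<and> hausdorff_outer_measure s A = 0}"

end

theory Submission
  imports Defs
    "HOL-Computational_Algebra.Fundamental_Theorem_Algebra"
    "HOL-Computational_Algebra.Polynomial_Factorial"
    "HOL-Computational_Algebra.Field_as_Ring"
    "HOL-Real_Asymp.Real_Asymp"
begin

text \<open>
  Choose a nonzero integer covector \<open>k\<close> annihilated by a squarefree polynomial in the transpose of
  \<open>T\<close>. For every \<open>u\<close> the sequence \<open>k \<bullet> T\<^sup>n u\<close> is then a combination of pure powers \<open>z\<^sup>n\<close>, so if it is
  unbounded it grows geometrically. As \<open>T\<close> is quasihyperbolic, it is unbounded for some \<open>u\<close>; as it
  is bounded on \<open>t\<^sub>- + t\<^sub>0'\<close>, the spanning hypothesis provides such a \<open>u\<close> in \<open>s\<^sub>- + s\<^sub>0'\<close>.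

  The orbit of \<open>u\<close> under \<open>S\<close> is bounded. By a van der Corput argument, equidistribution under \<open>S\<close> is
  therefore inherited by all points \<open>x + t u\<close>, so almost every line in direction \<open>u\<close> lies in
  \<open>Eq(S)\<close>. On every line in direction \<open>u\<close> the geometric growth allows a Cantor construction of
  parameters \<open>t\<close>, of dimension arbitrarily close to \<open>1\<close> and uniformly in \<open>x\<close>, for which
  \<open>T\<^sup>n (x + t u)\<close> avoids a neighbourhood of \<open>0\<close>. Integrating over \<open>x\<close> gives dimension \<open>d\<close>.
\<close>

section \<open>Polynomials of a matrix acting on a vector\<close>

text \<open>Jordan blocks on the unit circle give characters of polynomial growth; the constraints
  of too many times would then fall on the same scale for the Cantor construction to survive.
  Squarefreeness removes the polynomial factors, and it is arranged over the rationals so that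
  \<open>k\<close> can be scaled into the lattice. Even geometric growth leaves occasional small
  terms, since several eigenvalues may share the largest modulus; hence lower bounds and gaps are
  stated for windows of \<open>m\<close> consecutive times.

  Along \<open>u\<close> the \<open>S\<close>-orbit is only bounded, not contracted, because of the
  eigenvalues of modulus 1. Two points of a line in direction \<open>u\<close> need not be
  asymptotic, and recurrence of the orbit of \<open>u\<close> has to do the work of contraction.

  The slice bound is quantitative: one \<eta> serves all lines. A single cheap cover of the whole
  set can therefore be tested against all lines at once and integrated, with no measurability of the
  slices.\<close>

definition poly_act :: "'a::field ^ 'n ^ 'n \<Rightarrow> 'a poly \<Rightarrow> 'a ^ 'n \<Rightarrow> 'a ^ 'n" where
  "poly_act B p v = (\<Sum>i\<le>degree p. coeff p i *s (((*v) B) ^^ i) v)"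

lemma poly_act_altdef:
  assumes "degree p \<le> N"
  shows "poly_act B p v = (\<Sum>i\<le>N. coeff p i *s (((*v) B) ^^ i) v)"
  unfolding poly_act_def using assms
  by (intro sum.mono_neutral_left) (auto simp: coeff_eq_0)

lemma funpow_matrix_add:
  fixes B :: "'a::field ^ 'n ^ 'n"
  shows "(((*v) B) ^^ i) (v + w) = (((*v) B) ^^ i) v + (((*v) B) ^^ i) w"
  by (induction i) (simp_all add: matrix_vector_right_distrib)

lemma funpow_matrix_diff:
  fixes B :: "'a::field ^ 'n ^ 'n"
  shows "(((*v) B) ^^ i) (v - w) = (((*v) B) ^^ i) v - (((*v) B) ^^ i) w"
  by (induction i) (simp_all add: matrix_vector_mult_diff_distrib)

lemma funpow_matrix_scale:
  fixes B :: "'a::field ^ 'n ^ 'n"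
  shows "(((*v) B) ^^ i) (c *s v) = c *s (((*v) B) ^^ i) v"
  by (induction i) (simp_all add: vector_scalar_commute)

lemma funpow_matrix_0 [simp]:
  fixes B :: "'a::field ^ 'n ^ 'n"
  shows "(((*v) B) ^^ i) 0 = 0"
  by (induction i) simp_all

lemma funpow_matrix_sum:
  fixes B :: "'a::field ^ 'n ^ 'n"
  shows "(((*v) B) ^^ i) (\<Sum>j\<in>J. v j) = (\<Sum>j\<in>J. (((*v) B) ^^ i) (v j))"
  by (induction J rule: infinite_finite_induct) (simp_all add: funpow_matrix_add)

lemma poly_act_0 [simp]: "poly_act B 0 v = 0"
  by (simp add: poly_act_def)

lemma poly_act_zero_vec [simp]: "poly_act B p 0 = 0"
  by (simp add: poly_act_def)

lemma poly_act_add_poly: "poly_act B (p + q) v = poly_act B p v + poly_act B q v"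
proof -
  let ?N = "max (degree p) (degree q)"
  have "degree (p + q) \<le> ?N" by (rule degree_add_le_max)
  then show ?thesis
    by (simp add: poly_act_altdef[of _ ?N] vector_sadd_rdistrib sum.distrib)
qed

lemma poly_act_smult: "poly_act B (smult c p) v = c *s poly_act B p v"
  by (simp add: poly_act_altdef[of _ "degree p"] degree_smult_le vector_smult_assoc
      vec.scale_sum_right)

lemma poly_act_scale_vec: "poly_act B p (c *s v) = c *s poly_act B p v"
  by (simp add: poly_act_def funpow_matrix_scale vec.scale_sum_right vector_smult_assoc mult.commute)

lemma matrix_vector_mult_sum:
  fixes B :: "'a::field ^ 'n ^ 'm"
  shows "B *v (\<Sum>j\<in>J. v j) = (\<Sum>j\<in>J. B *v v j)"
  by (induction J rule: infinite_finite_induct) (simp_all add: matrix_vector_right_distrib)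

lemma poly_act_pCons: "poly_act B (pCons a p) v = a *s v + B *v poly_act B p v"
proof -
  have "degree (pCons a p) \<le> Suc (degree p)" by (rule degree_pCons_le)
  then have "poly_act B (pCons a p) v
      = (\<Sum>i\<le>Suc (degree p). coeff (pCons a p) i *s (((*v) B) ^^ i) v)"
    by (rule poly_act_altdef)
  also have "\<dots> = a *s v + (\<Sum>i\<le>degree p. coeff p i *s (((*v) B) ^^ Suc i) v)"
    by (subst sum.atMost_Suc_shift) simp
  finally show ?thesis
    by (simp add: poly_act_def matrix_vector_mult_sum vector_scalar_commute)
qed

lemma poly_act_mult: "poly_act B (p * q) v = poly_act B p (poly_act B q v)"
  by (induction p) (simp_all add: poly_act_add_poly poly_act_smult poly_act_pCons)

lemma poly_act_const [simp]: "poly_act B [:c:] v = c *s v"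
  by (simp add: poly_act_pCons)

lemma poly_act_1 [simp]: "poly_act B 1 v = v"
  by (simp add: poly_act_def)

lemma poly_act_linear_factor: "poly_act B [:- z, 1:] v = B *v v - z *s v"
  by (simp add: poly_act_pCons)

lemma poly_act_monom: "poly_act B (monom c n) v = c *s (((*v) B) ^^ n) v"
proof -
  have "poly_act B (monom c n) v = (\<Sum>i\<le>n. coeff (monom c n) i *s (((*v) B) ^^ i) v)"
    by (rule poly_act_altdef) (rule degree_monom_le)
  also have "\<dots> = (\<Sum>i\<in>{n}. coeff (monom c n) i *s (((*v) B) ^^ i) v)"
    by (rule sum.mono_neutral_right) auto
  finally show ?thesis by simp
qed

section \<open>Annihilating polynomials and eigenvectors\<close>

lemma funpow_eigenvector:
  fixes B :: "'a::field ^ 'n ^ 'n"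
  assumes "B *v v = z *s v"
  shows "(((*v) B) ^^ n) v = z ^ n *s v"
  by (induction n) (simp_all add: vector_scalar_commute assms vector_smult_assoc)

text \<open>Split off a linear factor, p = (X - z) q: either q(B) already kills v and the degree
  drops, or q(B) v is an eigenvector for z.\<close>

lemma eigenvalue_of_annihilator:
  fixes B :: "complex ^ 'n ^ 'n"
  assumes "poly_act B p v = 0" "p \<noteq> 0" "v \<noteq> 0"
  shows "\<exists>z. eigenvalue B z \<and> poly p z = 0"
  using assms
proof (induction "degree p" arbitrary: p rule: less_induct)
  case less
  have "degree p \<noteq> 0"
  proof
    assume "degree p = 0"
    then obtain c where "p = [:c:]" by (rule degree_eq_zeroE)
    with less.prems show False by simp
  qed
  then obtain z where z: "poly p z = 0"
    using fundamental_theorem_of_algebra by (metis constant_degree)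
  then obtain q where q: "p = [:- z, 1:] * q" by (auto simp: poly_eq_0_iff_dvd elim: dvdE)
  with less.prems have "q \<noteq> 0" by auto
  show ?case
  proof (cases "poly_act B q v = 0")
    case True
    have "degree p = Suc (degree q)"
      using \<open>q \<noteq> 0\<close> unfolding q by (subst degree_mult_eq) auto
    with less.hyps[of q] True \<open>q \<noteq> 0\<close> less.prems(3)
    obtain z where "eigenvalue B z \<and> poly q z = 0" by auto
    then show ?thesis by (auto simp: q)
  next
    case False
    from less.prems(1) have "poly_act B [:- z, 1:] (poly_act B q v) = 0"
      by (simp only: q poly_act_mult)
    then have "B *v poly_act B q v = z *s poly_act B q v"
      by (simp only: poly_act_linear_factor) simp
    with False z show ?thesis by (auto simp: eigenvalue_def)
  qed
qed

text \<open>If \<open>(B - z) v = (\<Sum>y\<in>Z. w y)\<close> with \<open>B (w y) = y (w y)\<close>, then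
  \<open>v - (\<Sum>y\<in>Z. w y / (y - z))\<close> is an eigenvector for \<open>z\<close>.\<close>

lemma eigenvector_decomposition:
  fixes B :: "'a::field ^ 'n ^ 'n"
  assumes "finite Z" "poly_act B (\<Prod>z\<in>Z. [:- z, 1:]) v = 0"
  shows "\<exists>w. (\<forall>z\<in>Z. B *v w z = z *s w z) \<and> v = (\<Sum>z\<in>Z. w z)"
  using assms
proof (induction Z arbitrary: v)
  case empty
  then show ?case by simp
next
  case (insert z Z)
  let ?x = "poly_act B [:- z, 1:] v"
  have "poly_act B (\<Prod>z\<in>Z. [:- z, 1:]) ?x = 0"
  proof -
    have "(\<Prod>z\<in>insert z Z. [:- z, 1:]) = (\<Prod>z\<in>Z. [:- z, 1:]) * [:- z, 1:]"
      using insert.hyps by (simp add: mult.commute)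
    with insert.prems show ?thesis by (metis poly_act_mult)
  qed
  from insert.IH[OF this] obtain w
    where w: "\<And>y. y \<in> Z \<Longrightarrow> B *v w y = y *s w y" and x: "?x = (\<Sum>y\<in>Z. w y)"
    by blast
  define w' where "w' y = inverse (y - z) *s w y" for y
  define u where "u = v - (\<Sum>y\<in>Z. w' y)"
  have w': "B *v w' y = y *s w' y" if "y \<in> Z" for y
    using w[OF that] by (simp add: w'_def vector_scalar_commute vector_smult_assoc mult.commute)
  have "B *v u - z *s u = ?x - (\<Sum>y\<in>Z. B *v w' y - z *s w' y)"
    unfolding u_def poly_act_linear_factor
    by (simp add: matrix_vector_mult_diff_distrib matrix_vector_mult_sum vec.scale_sum_right
        vec.scale_right_diff_distrib sum_subtractf)
  also have "(\<Sum>y\<in>Z. B *v w' y - z *s w' y) = (\<Sum>y\<in>Z. w y)"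
  proof (rule sum.cong[OF refl])
    fix y assume "y \<in> Z"
    with insert.hyps have "y - z \<noteq> 0" by auto
    have "B *v w' y - z *s w' y = (y - z) *s w' y"
      by (simp add: w' \<open>y \<in> Z\<close> vec.scale_left_diff_distrib)
    also have "\<dots> = w y"
      using \<open>y - z \<noteq> 0\<close> by (simp add: w'_def vector_smult_assoc)
    finally show "B *v w' y - z *s w' y = w y" .
  qed
  finally have u: "B *v u = z *s u" by (simp add: x)
  show ?case
  proof (intro exI[of _ "w'(z := u)"] conjI ballI)
    fix y assume "y \<in> insert z Z"
    then show "B *v (w'(z := u)) y = y *s (w'(z := u)) y" using u w' by auto
  next
    have "(\<Sum>y\<in>Z. (w'(z := u)) y) = (\<Sum>y\<in>Z. w' y)"
      using insert.hyps by (intro sum.cong) auto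
    then show "v = (\<Sum>y\<in>insert z Z. (w'(z := u)) y)"
      using insert.hyps by (simp add: u_def)
  qed
qed

text \<open>The d + 1 vectors v, B v, ..., B^d v are linearly dependent. A repetition among them is
  treated apart, as it would be lost in the set that they form.\<close>

lemma exists_annihilator:
  fixes B :: "'a::field ^ 'n ^ 'n"
  shows "\<exists>p. p \<noteq> 0 \<and> poly_act B p v = 0"
proof (cases "inj_on (\<lambda>i. (((*v) B) ^^ i) v) {..CARD('n)}")
  case False
  then obtain i j where ij: "i \<noteq> j" "(((*v) B) ^^ i) v = (((*v) B) ^^ j) v"
    by (auto simp: inj_on_def)
  let ?p = "monom 1 i + monom (-1) j :: 'a poly"
  have "coeff ?p i = 1" using ij by simp
  then have "?p \<noteq> 0" by (metis coeff_0 zero_neq_one)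
  moreover have "poly_act B ?p v = 0"
    using ij by (simp add: poly_act_add_poly poly_act_monom)
  ultimately show ?thesis by blast
next
  case True
  let ?f = "\<lambda>i. (((*v) B) ^^ i) v"
  let ?S = "?f ` {..CARD('n)}"
  have "card ?S = Suc (CARD('n))" using card_image[OF True] by simp
  moreover have "vec.dim ?S \<le> CARD('n)"
    using vec.dim_subset_UNIV[of ?S] unfolding vec.dimension_def by (simp add: card_cart_basis)
  ultimately have "vec.dependent ?S" by (intro vec.dependent_biggerset_general) simp
  then obtain u where u: "\<exists>x\<in>?S. u x \<noteq> 0" "(\<Sum>x\<in>?S. u x *s x) = 0"
    by (auto simp: vec.dependent_finite)
  define p where "p = (\<Sum>i\<le>CARD('n). monom (u (?f i)) i)"
  have c: "coeff p i = (if i \<le> CARD('n) then u (?f i) else 0)" for i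
    by (simp add: p_def coeff_sum)
  from u(1) have "p \<noteq> 0" by (auto simp: poly_eq_iff c)
  have dg: "degree p \<le> CARD('n)" by (rule degree_le) (simp add: c)
  have "poly_act B p v = (\<Sum>i\<le>CARD('n). u (?f i) *s ?f i)"
    unfolding poly_act_altdef[OF dg] by (rule sum.cong) (simp_all add: c)
  also have "\<dots> = (\<Sum>x\<in>?S. u x *s x)"
    by (subst sum.reindex[OF True]) simp
  finally have "poly_act B p v = 0" using u by simp
  with \<open>p \<noteq> 0\<close> show ?thesis by blast
qed


section \<open>Orbits of integer matrices\<close>

abbreviation real_mat :: "int ^ 'n ^ 'm \<Rightarrow> real ^ 'n ^ 'm" where
  "real_mat \<equiv> map_matrix real_of_int"

lemma real_mat_transpose: "real_mat (transpose A) = transpose (real_mat A)"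
  by (simp add: vec_eq_iff transpose_def)

lemma complex_mat_transpose: "complex_mat (transpose A) = transpose (complex_mat A)"
  by (simp add: vec_eq_iff transpose_def complex_mat_def)

text \<open>Moves the dynamics from points to covectors, whose orbit stays in the lattice if it
  starts there.\<close>

lemma inner_funpow_adjoint:
  fixes A :: "int ^ 'd ^ 'd"
  shows "k \<bullet> (((*v) (real_mat A)) ^^ n) x = (((*v) (real_mat (transpose A))) ^^ n) k \<bullet> x"
proof (induction n arbitrary: k)
  case (Suc n)
  have "k \<bullet> (real_mat A *v y) = (real_mat (transpose A) *v k) \<bullet> y" for y
    by (simp add: dot_lmul_matrix[symmetric] real_mat_transpose)
  then have "k \<bullet> (((*v) (real_mat A)) ^^ Suc n) x
      = (real_mat (transpose A) *v k) \<bullet> (((*v) (real_mat A)) ^^ n) x"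
    by simp
  then show ?case by (simp only: Suc funpow_Suc_right o_apply)
qed simp

lemma int_lattice_real_mat: "k \<in> int_lattice \<Longrightarrow> real_mat A *v k \<in> int_lattice"
  by (auto simp: int_lattice_def matrix_vector_mult_def intro!: Ints_sum Ints_mult)

lemma int_lattice_funpow:
  fixes A :: "int ^ 'd ^ 'd"
  shows "k \<in> int_lattice \<Longrightarrow> (((*v) (real_mat A)) ^^ n) k \<in> int_lattice"
  by (induction n) (simp_all add: int_lattice_real_mat)

lemma torus_map_funpow:
  "(torus_map A ^^ n) (torus_proj x) = torus_proj ((((*v) (real_mat A)) ^^ n) x)"
  by (induction n) (simp_all add: torus_map.abs_eq)

lemma det_real_mat: "det (real_mat A) = of_int (det A)"
  by (simp add: det_def)

lemma inj_real_mat: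
  assumes "toral_automorphism A"
  shows "inj ((*v) (real_mat A))"
proof -
  have "det (real_mat A) \<noteq> 0"
    using assms by (auto simp: toral_automorphism_def det_real_mat)
  then have "invertible (real_mat A)" by (simp add: invertible_det_nz)
  then show ?thesis
    by (simp add: invertible_left_inverse flip: matrix_left_invertible_injective)
qed

lemma toral_automorphism_transpose: "toral_automorphism (transpose A) = toral_automorphism A"
  by (simp add: toral_automorphism_def det_transpose)

lemma complex_vec_real_mat: "complex_vec (real_mat A *v x) = complex_mat A *v complex_vec x"
  by (simp add: vec_eq_iff complex_vec_def complex_mat_def matrix_vector_mult_def)

lemma complex_vec_funpow:
  "complex_vec ((((*v) (real_mat A)) ^^ n) x) = (((*v) (complex_mat A)) ^^ n) (complex_vec x)"
  by (induction n) (simp_all add: complex_vec_real_mat)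

lemma complex_vec_eq_0_iff: "complex_vec x = 0 \<longleftrightarrow> x = 0"
  by (simp add: vec_eq_iff complex_vec_def)

lemma norm_complex_vec: "norm (complex_vec x) = norm x"
  by (simp add: norm_vec_def complex_vec_def)

lemma matrix_minus_mat: "(A - mat l) *v v = A *v v - l *s (v :: 'a::field ^ 'n)"
proof -
  have "mat l *v v = l *s v"
    by (simp add: vec_eq_iff matrix_vector_mult_def mat_def if_distrib if_distribR cong: if_cong)
  then show ?thesis by (simp add: matrix_vector_mult_diff_rdistrib)
qed

section \<open>Eigenvalues of the transpose and its orbits on the lattice\<close>

lemma eigenvalue_iff_det: "eigenvalue A z \<longleftrightarrow> det (A - mat z) = 0"
proof -
  have "eigenvalue A z \<longleftrightarrow> \<not> (\<forall>v. (A - mat z) *v v = 0 \<longrightarrow> v = 0)"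
    by (auto simp: eigenvalue_def matrix_minus_mat)
  also have "\<dots> \<longleftrightarrow> \<not> invertible (A - mat z)"
    by (simp add: invertible_left_inverse matrix_left_invertible_ker)
  finally show ?thesis by (simp add: invertible_det_nz)
qed

lemma eigenvalue_transpose: "eigenvalue (transpose A) z \<longleftrightarrow> eigenvalue A z"
proof -
  have "transpose A - mat z = transpose (A - mat z)"
    by (simp add: vec_eq_iff transpose_def mat_def)
  then show ?thesis by (simp add: eigenvalue_iff_det det_transpose)
qed

text \<open>By injectivity of the matrix a repetition makes k periodic, B^q k = k, so X^q - 1
  annihilates it and one of its roots, a root of unity, is an eigenvalue. This is ergodicity
  expressed on characters: those met along a dual orbit are pairwise orthogonal.\<close>

lemma inj_dual_orbit:
  fixes A :: "int ^ 'd ^ 'd"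
  assumes "toral_automorphism A" "quasihyperbolic A" "k \<noteq> 0"
  shows "inj (\<lambda>n. (((*v) (real_mat (transpose A))) ^^ n) k)"
proof (rule ccontr)
  let ?B = "(*v) (real_mat (transpose A))"
  assume "\<not> ?thesis"
  then obtain m n where "m < n" and eq: "(?B ^^ m) k = (?B ^^ n) k"
    unfolding inj_def by (metis linorder_neqE_nat)
  define q where "q = n - m"
  have "q > 0" "n = m + q" using \<open>m < n\<close> by (auto simp: q_def)
  have "inj (?B ^^ m)"
    by (intro inj_fn inj_real_mat) (simp add: toral_automorphism_transpose assms)
  moreover have "(?B ^^ m) ((?B ^^ q) k) = (?B ^^ m) k"
    using eq by (simp add: \<open>n = m + q\<close> funpow_add)
  ultimately have k: "(?B ^^ q) k = k" by (simp add: inj_eq)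
  let ?C = "complex_mat (transpose A)"
  let ?p = "monom 1 q - 1 :: complex poly"
  have "poly_act ?C ?p (complex_vec k) = 0"
  proof -
    have "poly_act ?C (monom 1 q + [:-1:]) (complex_vec k) = 0"
      unfolding poly_act_add_poly
      by (simp add: poly_act_monom k flip: complex_vec_funpow)
    moreover have "?p = monom 1 q + [:-1:]" by (simp add: one_pCons)
    ultimately show ?thesis by (simp only:)
  qed
  moreover have "coeff ?p q = 1" using \<open>q > 0\<close> by simp
  then have "?p \<noteq> 0" by (metis coeff_0 zero_neq_one)
  ultimately obtain z where "eigenvalue ?C z" "poly ?p z = 0"
    using eigenvalue_of_annihilator complex_vec_eq_0_iff assms(3) by blast
  then have "eigenvalue (complex_mat A) z" "z ^ q = 1"
    by (simp_all add: complex_mat_transpose eigenvalue_transpose poly_monom)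
  with assms(2) \<open>q > 0\<close> show False unfolding quasihyperbolic_def by blast
qed

text \<open>A convergent subsequence has two terms at distance below 1, while distinct lattice
  points are at distance at least 1.\<close>

lemma bounded_int_lattice_not_inj:
  fixes f :: "nat \<Rightarrow> real ^ 'd"
  assumes "range f \<subseteq> int_lattice" "bounded (range f)"
  shows "\<not> inj f"
proof
  assume "inj f"
  obtain l r where r: "strict_mono r" and l: "(f \<circ> r) \<longlonglongrightarrow> l"
    using bounded_imp_convergent_subsequence[OF assms(2)] by blast
  then have "Cauchy (f \<circ> r)" by (simp add: LIMSEQ_imp_Cauchy)
  then obtain M where M: "\<forall>m\<ge>M. \<forall>n\<ge>M. dist ((f \<circ> r) m) ((f \<circ> r) n) < 1"
    unfolding Cauchy_def using zero_less_one by blast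
  define d where "d = f (r M) - f (r (Suc M))"
  have "norm d < 1" using M[rule_format, of M "Suc M"] by (simp add: d_def dist_norm)
  moreover have "d \<in> int_lattice" using assms(1) by (auto simp: d_def intro!: int_lattice_diff)
  ultimately have "d $ i = 0" for i
  proof -
    have "\<bar>d $ i\<bar> < 1" using component_le_norm_cart[of d i] \<open>norm d < 1\<close> by linarith
    moreover have "d $ i \<in> \<int>" using \<open>d \<in> int_lattice\<close> by (simp add: int_lattice_def)
    ultimately show ?thesis using Ints_nonzero_abs_less1 by blast
  qed
  then have "f (r M) = f (r (Suc M))" by (simp add: d_def vec_eq_iff)
  with \<open>inj f\<close> have "r M = r (Suc M)" by (simp add: inj_eq)
  moreover have "r M < r (Suc M)" using r by (simp add: strict_mono_Suc_iff)
  ultimately show False by simp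
qed

lemma finite_int_lattice_bounded:
  fixes X :: "(real ^ 'd) set"
  assumes "X \<subseteq> int_lattice" "bounded X"
  shows "finite X"
proof (rule ccontr)
  assume "infinite X"
  then obtain f :: "nat \<Rightarrow> real ^ 'd" where f: "inj f" "range f \<subseteq> X"
    using infinite_countable_subset by blast
  have "range f \<subseteq> int_lattice" using f(2) assms(1) by (rule subset_trans)
  moreover have "bounded (range f)" using assms(2) f(2) by (rule bounded_subset)
  ultimately show False using bounded_int_lattice_not_inj f(1) by blast
qed

text \<open>Boundedness along the coordinate directions would confine the orbit of k under the
  transpose to a bounded set of lattice points, although this orbit is injective.\<close>

lemma exists_unbounded_coordinate:
  fixes A :: "int ^ 'd ^ 'd"
  assumes "toral_automorphism A" "quasihyperbolic A" "k \<in> int_lattice" "k \<noteq> 0"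
  shows "\<exists>x. \<not> bounded (range (\<lambda>n. k \<bullet> (((*v) (real_mat A)) ^^ n) x))"
proof (rule ccontr)
  assume "\<not> ?thesis"
  then have b: "bounded (range (\<lambda>n. k \<bullet> (((*v) (real_mat A)) ^^ n) x))" for x by blast
  let ?f = "\<lambda>n. (((*v) (real_mat (transpose A))) ^^ n) k"
  have "\<exists>C. \<forall>n. \<bar>?f n $ i\<bar> \<le> C" for i
    using b[of "axis i 1"] unfolding bounded_iff
    by (auto simp: inner_funpow_adjoint inner_axis)
  then obtain C where C: "\<bar>?f n $ i\<bar> \<le> C i" for n i by metis
  have "norm (?f n) \<le> (\<Sum>i\<in>UNIV. C i)" for n
    using norm_le_l1_cart[of "?f n"] C sum_mono[of UNIV "\<lambda>i. \<bar>?f n $ i\<bar>" C] by (meson order_trans)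
  then have "bounded (range ?f)" unfolding bounded_iff by blast
  moreover have "range ?f \<subseteq> int_lattice" using int_lattice_funpow[OF assms(3)] by blast
  ultimately show False
    using bounded_int_lattice_not_inj inj_dual_orbit[OF assms(1,2,4)] by blast
qed

section \<open>Vectors with bounded forward orbit\<close>

lemma norm_scale_vec: "norm (c *s v) = norm c * norm (v :: complex ^ 'n)"
  by (simp add: norm_vec_def norm_mult L2_set_right_distrib)

text \<open>Contracted vectors and eigenvectors of modulus 1 share this property, and the spanning
  hypothesis enters through it: bounded orbits of \<open>S\<close> recur, and bounded orbits of
  \<open>T\<close> cannot carry the growth of a character.\<close>

definition bounded_orbit :: "'a::real_normed_field ^ 'n ^ 'n \<Rightarrow> 'a ^ 'n \<Rightarrow> bool" where
  "bounded_orbit A v \<longleftrightarrow> bounded (range (\<lambda>n. (((*v) A) ^^ n) v))"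

lemma bounded_orbitI: "(\<And>n. norm ((((*v) A) ^^ n) v) \<le> C) \<Longrightarrow> bounded_orbit A v"
  by (auto simp: bounded_orbit_def bounded_iff)

lemma bounded_orbitD:
  assumes "bounded_orbit A v"
  shows "\<exists>C\<ge>0. \<forall>n. norm ((((*v) A) ^^ n) v) \<le> C"
proof -
  obtain C where C: "\<forall>n. norm ((((*v) A) ^^ n) v) \<le> C"
    using assms by (auto simp: bounded_orbit_def bounded_iff)
  moreover have "C \<ge> 0" using C norm_ge_zero order_trans by blast
  ultimately show ?thesis by blast
qed

lemma bounded_orbit_add:
  assumes "bounded_orbit A v" "bounded_orbit A w"
  shows "bounded_orbit A (v + w)"
proof -
  obtain C where C: "\<And>n. norm ((((*v) A) ^^ n) v) \<le> C" using bounded_orbitD[OF assms(1)] by blast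
  obtain D where D: "\<And>n. norm ((((*v) A) ^^ n) w) \<le> D" using bounded_orbitD[OF assms(2)] by blast
  show ?thesis
    by (rule bounded_orbitI[of _ _ "C + D"])
      (unfold funpow_matrix_add, rule norm_triangle_mono[OF C D])
qed

lemma bounded_orbit_scaleR:
  fixes A :: "real ^ 'd ^ 'd"
  assumes "bounded_orbit A v"
  shows "bounded_orbit A (c *\<^sub>R v)"
proof -
  obtain C where C: "\<And>n. norm ((((*v) A) ^^ n) v) \<le> C" using bounded_orbitD[OF assms] by blast
  have "(((*v) A) ^^ n) (c *\<^sub>R v) = c *\<^sub>R (((*v) A) ^^ n) v" for n
    unfolding scalar_mult_eq_scaleR[symmetric] by (rule funpow_matrix_scale)
  then show ?thesis
    by (intro bounded_orbitI[of _ _ "\<bar>c\<bar> * C"]) (simp add: mult_left_mono C)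
qed

lemma bounded_orbit_span:
  fixes A :: "complex ^ 'd ^ 'd"
  assumes "\<And>v. v \<in> X \<Longrightarrow> bounded_orbit A v" "v \<in> vec.span X"
  shows "bounded_orbit A v"
  using assms(2)
proof (induction rule: vec.span_induct_alt)
  case base
  then show ?case by (auto intro: bounded_orbitI[of _ _ 0])
next
  case (step c x y)
  obtain C where C: "\<And>n. norm ((((*v) A) ^^ n) x) \<le> C"
    using bounded_orbitD[OF assms(1)[OF step(1)]] by blast
  have "bounded_orbit A (c *s x)"
    by (rule bounded_orbitI[of _ _ "norm c * C"])
      (simp add: funpow_matrix_scale norm_scale_vec mult_left_mono C)
  then show ?case by (rule bounded_orbit_add) (rule step.IH)
qed

text \<open>Induction on the nilpotency order: with w = A v - l v the norms x(n) along the orbit of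
  v satisfy x(n+1) \<le> |l| x(n) + C, where C bounds the orbit of w.\<close>

lemma bounded_orbit_gen_eigenvector:
  fixes A :: "complex ^ 'd ^ 'd"
  assumes "(((*v) (A - mat l)) ^^ j) v = 0" "cmod l < 1"
  shows "bounded_orbit A v"
  using assms(1)
proof (induction j arbitrary: v)
  case 0
  then show ?case by (auto intro: bounded_orbitI[of _ _ 0])
next
  case (Suc j)
  define w where "w = (A - mat l) *v v"
  have "(((*v) (A - mat l)) ^^ j) w = 0" using Suc.prems by (simp add: w_def funpow_swap1)
  from bounded_orbitD[OF Suc.IH[OF this]] obtain C where "C \<ge> 0" and C: "\<And>n. norm ((((*v) A) ^^ n) w) \<le> C"
    by blast
  \<comment> \<open>At least the fixed point of the map sending x to |l| x + C, so that this map
    preserves [0, D], and at least the initial value.\<close>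
  define D where "D = max (norm v) (C / (1 - cmod l))"
  have D: "cmod l * D + C \<le> D"
  proof -
    have "C / (1 - cmod l) \<le> D" by (simp add: D_def)
    with assms(2) have "C \<le> D * (1 - cmod l)" by (simp add: pos_divide_le_eq)
    then show ?thesis by (simp add: algebra_simps)
  qed
  have "norm ((((*v) A) ^^ n) v) \<le> D" for n
  proof (induction n)
    case 0
    then show ?case by (simp add: D_def)
  next
    case (Suc n)
    have "A *v v = l *s v + w" by (simp add: w_def matrix_minus_mat)
    then have "(((*v) A) ^^ Suc n) v = l *s (((*v) A) ^^ n) v + (((*v) A) ^^ n) w"
      by (simp add: funpow_swap1 funpow_matrix_add funpow_matrix_scale)
    then have "norm ((((*v) A) ^^ Suc n) v) \<le> cmod l * norm ((((*v) A) ^^ n) v) + C"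
      using norm_triangle_ineq[of "l *s (((*v) A) ^^ n) v" "(((*v) A) ^^ n) w"] C[of n]
      by (simp add: norm_scale_vec)
    also have "\<dots> \<le> cmod l * D + C" using Suc.IH by (simp add: mult_left_mono)
    finally show ?case using D by simp
  qed
  then show ?case by (rule bounded_orbitI)
qed

lemma bounded_orbit_complex_vec:
  "bounded_orbit (complex_mat A) (complex_vec x) \<longleftrightarrow> bounded_orbit (real_mat A) x"
  by (simp add: bounded_orbit_def bounded_iff norm_complex_vec flip: complex_vec_funpow)

lemma bounded_orbit_contracted_space:
  assumes "x \<in> contracted_space A"
  shows "bounded_orbit (real_mat A) x"
proof -
  have "bounded_orbit (complex_mat A) (complex_vec x)"
    using assms unfolding contracted_space_def mem_Collect_eq
    by (rule bounded_orbit_span[rotated])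
      (auto simp: gen_eigenspace_def intro: bounded_orbit_gen_eigenvector)
  then show ?thesis by (simp add: bounded_orbit_complex_vec)
qed

lemma bounded_orbit_unimodular_eigenspace:
  assumes "x \<in> unimodular_eigenspace A"
  shows "bounded_orbit (real_mat A) x"
proof -
  have "bounded_orbit (complex_mat A) (complex_vec x)"
    using assms unfolding unimodular_eigenspace_def mem_Collect_eq
  proof (rule bounded_orbit_span[rotated])
    fix v assume "v \<in> (\<Union>l\<in>{l. cmod l = 1}. eigenspace (complex_mat A) l)"
    then obtain l where l: "cmod l = 1" "complex_mat A *v v = l *s v"
      by (auto simp: eigenspace_def matrix_minus_mat)
    show "bounded_orbit (complex_mat A) v"
      by (rule bounded_orbitI[of _ _ "norm v"])
        (simp add: funpow_eigenvector[OF l(2)] norm_scale_vec norm_power l(1))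
  qed
  then show ?thesis by (simp add: bounded_orbit_complex_vec)
qed

text \<open>These vectors form a finite-dimensional subspace, and bounds on an orthonormal basis add
  up to a common one. Its use: a vector of the subspace that is small once stays small.\<close>

lemma bounded_orbit_uniform:
  fixes A :: "real ^ 'd ^ 'd"
  shows "\<exists>C>0. \<forall>v n. bounded_orbit A v \<longrightarrow> norm ((((*v) A) ^^ n) v) \<le> C * norm v"
proof -
  let ?V = "{v. bounded_orbit A v}"
  have "subspace ?V"
    by (rule subspaceI) (auto simp: bounded_orbit_add bounded_orbit_scaleR intro: bounded_orbitI[of _ _ 0])
  then obtain X where X: "X \<subseteq> ?V" "pairwise orthogonal X" "\<And>x. x \<in> X \<Longrightarrow> norm x = 1"
      "independent X" "card X = dim ?V" "span X = ?V"
    using orthonormal_basis_subspace by blast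
  have "finite X" using X(4) by (rule independent_imp_finite)
  have "\<forall>x\<in>X. \<exists>C\<ge>0. \<forall>n. norm ((((*v) A) ^^ n) x) \<le> C"
    using X(1) bounded_orbitD by (metis mem_Collect_eq subsetD)
  then obtain C where C: "\<And>x. x \<in> X \<Longrightarrow> C x \<ge> 0"
      "\<And>x n. x \<in> X \<Longrightarrow> norm ((((*v) A) ^^ n) x) \<le> C x"
    by metis
  \<comment> \<open>The summand 1 keeps D positive when the subspace is trivial.\<close>
  define D where "D = 1 + (\<Sum>x\<in>X. C x)"
  have "D > 0" using sum_nonneg[of X C] C(1) by (simp add: D_def)
  moreover have "norm ((((*v) A) ^^ n) v) \<le> D * norm v" if "bounded_orbit A v" for v n
  proof -
    have v: "v = (\<Sum>x\<in>X. (v \<bullet> x) *s x)"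
    proof -
      have "v \<in> span X" using X(6) that by simp
      then have "(\<Sum>x\<in>X. (v \<bullet> x) *\<^sub>R x) = v"
        by (intro orthonormal_basis_expand X(2,3) \<open>finite X\<close>)
      then show ?thesis by (simp add: inner_commute scalar_mult_eq_scaleR)
    qed
    have "norm ((((*v) A) ^^ n) v) = norm (\<Sum>x\<in>X. (v \<bullet> x) *s (((*v) A) ^^ n) x)"
      by (subst v) (simp add: funpow_matrix_sum funpow_matrix_scale)
    also have "\<dots> \<le> (\<Sum>x\<in>X. \<bar>v \<bullet> x\<bar> * norm ((((*v) A) ^^ n) x))"
      by (rule order_trans[OF norm_sum]) (simp add: scalar_mult_eq_scaleR)
    also have "\<dots> \<le> (\<Sum>x\<in>X. norm v * C x)"
    proof (rule sum_mono)
      fix x assume "x \<in> X"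
      have "\<bar>v \<bullet> x\<bar> \<le> norm v" using Cauchy_Schwarz_ineq2[of v x] X(3)[OF \<open>x \<in> X\<close>] by simp
      then show "\<bar>v \<bullet> x\<bar> * norm ((((*v) A) ^^ n) x) \<le> norm v * C x"
        using C[OF \<open>x \<in> X\<close>] by (intro mult_mono) auto
    qed
    also have "\<dots> \<le> D * norm v"
      by (simp add: D_def algebra_simps sum_distrib_left)
    finally show ?thesis .
  qed
  ultimately show ?thesis by blast
qed


section \<open>Growth of a character along an orbit\<close>

definition complex_poly_of_rat :: "rat poly \<Rightarrow> complex poly" where
  "complex_poly_of_rat = map_poly of_rat"

lemma coeff_complex_poly_of_rat [simp]: "coeff (complex_poly_of_rat p) n = of_rat (coeff p n)"
  by (simp add: complex_poly_of_rat_def coeff_map_poly)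

lemma complex_poly_of_rat_add:
  "complex_poly_of_rat (p + q) = complex_poly_of_rat p + complex_poly_of_rat q"
  by (rule poly_eqI) (simp add: of_rat_add)

lemma complex_poly_of_rat_mult:
  "complex_poly_of_rat (p * q) = complex_poly_of_rat p * complex_poly_of_rat q"
  by (rule poly_eqI) (simp add: coeff_mult of_rat_sum of_rat_mult)

lemma complex_poly_of_rat_1: "complex_poly_of_rat 1 = 1"
  by (rule poly_eqI) simp

lemma complex_poly_of_rat_pderiv: "complex_poly_of_rat (pderiv p) = pderiv (complex_poly_of_rat p)"
  by (rule poly_eqI) (simp add: coeff_pderiv of_rat_mult of_rat_add)

lemma complex_poly_of_rat_pCons:
  "complex_poly_of_rat (pCons a p) = pCons (of_rat a) (complex_poly_of_rat p)"
  by (rule poly_eqI) (simp add: coeff_pCons split: nat.split)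

text \<open>A Bezout identity for p and its derivative survives the passage to the complex numbers,
  so the two have no common complex root.\<close>

lemma rsquarefree_complex_poly_of_rat:
  assumes "coprime p (pderiv p)"
  shows "rsquarefree (complex_poly_of_rat p)"
proof -
  obtain a b where "a * p + b * pderiv p = gcd p (pderiv p)"
    using bezout_coefficients_fst_snd by blast
  then have "a * p + b * pderiv p = 1" using assms by simp
  then have "complex_poly_of_rat (a * p + b * pderiv p) = 1"
    by (simp add: complex_poly_of_rat_1)
  then have eq: "complex_poly_of_rat a * complex_poly_of_rat p
      + complex_poly_of_rat b * pderiv (complex_poly_of_rat p) = 1"
    by (simp add: complex_poly_of_rat_add complex_poly_of_rat_mult complex_poly_of_rat_pderiv)
  have "\<not> (poly (complex_poly_of_rat p) z = 0 \<and> poly (pderiv (complex_poly_of_rat p)) z = 0)" for z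
    using arg_cong[OF eq, of "\<lambda>q. poly q z"] by auto
  then show ?thesis by (simp add: rsquarefree_roots)
qed

text \<open>A pair \<open>(k, p)\<close> with \<open>p(B) k = 0\<close> and \<open>p\<close> of minimal degree: a repeated factor of \<open>p\<close> would
  give a pair of smaller degree.\<close>

lemma exists_squarefree_annihilator:
  fixes B :: "rat ^ 'd ^ 'd"
  shows "\<exists>k p. k \<noteq> 0 \<and> p \<noteq> 0 \<and> poly_act B p k = 0 \<and> coprime p (pderiv p)"
proof -
  let ?P = "\<lambda>(k, p). k \<noteq> 0 \<and> p \<noteq> 0 \<and> poly_act B p k = 0"
  obtain p1 where p1: "p1 \<noteq> 0" "poly_act B p1 1 = 0"
    using exists_annihilator by blast
  have "(1 :: rat ^ 'd) \<noteq> 0" by (simp add: vec_eq_iff)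
  then have "?P (1, p1)" using p1 by simp
  then obtain kp where kp: "?P kp" "\<And>y. ?P y \<Longrightarrow> degree (snd kp) \<le> degree (snd y)"
    using ex_has_least_nat[of ?P "(1, p1)" "\<lambda>kp. degree (snd kp)"] by blast
  obtain k p where "kp = (k, p)" by (cases kp)
  with kp have k: "k \<noteq> 0" and p: "p \<noteq> 0" "poly_act B p k = 0"
    and min: "\<And>k' p'. k' \<noteq> 0 \<Longrightarrow> p' \<noteq> 0 \<Longrightarrow> poly_act B p' k' = 0 \<Longrightarrow> degree p \<le> degree p'"
    by auto
  have "degree p \<noteq> 0"
  proof
    assume "degree p = 0"
    then obtain c where "p = [:c:]" by (rule degree_eq_zeroE)
    with p k show False by simp
  qed
  define g where "g = gcd p (pderiv p)"
  obtain h where h: "p = g * h" unfolding g_def by (meson dvdE gcd_dvd1)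
  have "g \<noteq> 0" "h \<noteq> 0" using h p by auto
  have "pderiv p \<noteq> 0" using \<open>degree p \<noteq> 0\<close> by (simp add: pderiv_eq_0_iff)
  then have "degree g \<le> degree (pderiv p)" by (simp add: g_def dvd_imp_degree_le)
  then have "degree g < degree p" using \<open>degree p \<noteq> 0\<close> by (simp add: degree_pderiv)
  \<comment> \<open>If h(B) k is nonzero, then g annihilates it and has too small a degree. So h
    already annihilates k, and minimality leaves only a constant for g.\<close>
  have "poly_act B h k \<noteq> 0 \<Longrightarrow> degree p \<le> degree g"
    using min[of "poly_act B h k" g] \<open>g \<noteq> 0\<close> p by (simp add: h flip: poly_act_mult)
  with \<open>degree g < degree p\<close> have "poly_act B h k = 0" by auto
  then have "degree p \<le> degree h" using min[of k h] k \<open>h \<noteq> 0\<close> by simp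
  moreover have "degree p = degree g + degree h"
    using h \<open>g \<noteq> 0\<close> \<open>h \<noteq> 0\<close> by (simp add: degree_mult_eq)
  ultimately have "degree g = 0" by simp
  then have "is_unit g" using \<open>g \<noteq> 0\<close> by (simp add: is_unit_iff_degree)
  then have "coprime p (pderiv p)" unfolding g_def by (simp add: coprime_iff_gcd_eq_1)
  with k p show ?thesis by blast
qed

lemma rat_vec_clear_denominators:
  fixes k :: "rat ^ 'd"
  shows "\<exists>m::int. m \<noteq> 0 \<and> (\<forall>i. of_int m * k $ i \<in> \<int>)"
proof -
  have "\<exists>m::int. m \<noteq> 0 \<and> (\<forall>i\<in>I. of_int m * k $ i \<in> \<int>)" if "finite I" for I
    using that
  proof (induction I)
    case empty
    show ?case by (rule exI[of _ 1]) simp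
  next
    case (insert j I)
    then obtain m :: int where m: "m \<noteq> 0" "\<forall>i\<in>I. of_int m * k $ i \<in> \<int>" by blast
    obtain a b where ab: "quotient_of (k $ j) = (a, b)" by (cases "quotient_of (k $ j)")
    have "b > 0" using ab by (rule quotient_of_denom_pos)
    have kj: "k $ j = of_int a / of_int b" using ab by (rule quotient_of_div)
    have "of_int (b * m) * k $ i \<in> \<int>" if "i \<in> insert j I" for i
    proof (cases "i = j")
      case True
      have "of_int (b * m) * k $ j = of_int (m * a)" using \<open>b > 0\<close> by (simp add: kj)
      then show ?thesis using True by (metis Ints_of_int)
    next
      case False
      then have "of_int m * k $ i \<in> \<int>" using m that by blast
      then have "of_int b * (of_int m * k $ i) \<in> \<int>" by (rule Ints_mult[OF Ints_of_int])
      then show ?thesis unfolding of_int_mult mult.assoc .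
    qed
    moreover have "b * m \<noteq> 0" using m \<open>b > 0\<close> by simp
    ultimately show ?case by blast
  qed
  from this[of UNIV] show ?thesis by simp
qed

text \<open>The annihilator is taken over the rationals so that clearing denominators puts k into
  the lattice. Being squarefree, it has simple complex roots, and its linear factors split k into
  eigenvectors.\<close>

lemma exists_diagonalizable_character:
  fixes A :: "int ^ 'd ^ 'd"
  shows "\<exists>k\<in>int_lattice. k \<noteq> 0 \<and> (\<exists>Z w. finite Z \<and>
    (\<forall>z\<in>Z. complex_mat (transpose A) *v w z = z *s w z) \<and> complex_vec k = (\<Sum>z\<in>Z. w z))"
proof -
  define B :: "rat ^ 'd ^ 'd" where "B = map_matrix of_int (transpose A)"
  let ?C = "complex_mat (transpose A)"
  obtain q p where qp: "q \<noteq> 0" "p \<noteq> 0" "poly_act B p q = 0" "coprime p (pderiv p)"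
    using exists_squarefree_annihilator[of B] by blast
  obtain m :: int where m: "m \<noteq> 0" "\<And>i. of_int m * q $ i \<in> \<int>"
    using rat_vec_clear_denominators[of q] by blast
  define k where "k = of_int m *s q"
  define R :: "rat ^ 'd \<Rightarrow> complex ^ 'd" where "R v = (\<chi> i. of_rat (v $ i))" for v
  have R_add: "R (x + y) = R x + R y" and R_scale: "R (c *s x) = of_rat c *s R x" for x y c
    by (simp_all add: R_def vec_eq_iff of_rat_add of_rat_mult)
  have R_B: "R (B *v x) = ?C *v R x" for x
    by (simp add: R_def B_def complex_mat_def vec_eq_iff matrix_vector_mult_def of_rat_sum of_rat_mult)
  have R_poly: "R (poly_act B f x) = poly_act ?C (complex_poly_of_rat f) (R x)" for f x
  proof (induction f)
    case 0
    have "complex_poly_of_rat 0 = 0" by (rule poly_eqI) simp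
    then show ?case by (simp add: R_def vec_eq_iff)
  next
    case (pCons a f)
    then show ?case by (simp add: poly_act_pCons complex_poly_of_rat_pCons R_add R_scale R_B)
  qed
  let ?f = "complex_poly_of_rat p"
  let ?Z = "{z. poly ?f z = 0}"
  have "?f \<noteq> 0"
  proof
    assume "?f = 0"
    then have "coeff ?f (degree p) = 0" by simp
    then show False using qp(2) by simp
  qed
  have "poly_act B p k = 0" by (simp add: k_def poly_act_scale_vec qp)
  then have "poly_act ?C ?f (R k) = 0" using R_poly[of p k] by (simp add: R_def zero_vec_def)
  moreover have f: "smult (lead_coeff ?f) (\<Prod>z\<in>?Z. [:- z, 1:]) = ?f"
    by (rule complex_poly_decompose_rsquarefree) (rule rsquarefree_complex_poly_of_rat[OF qp(4)])
  ultimately have "lead_coeff ?f *s poly_act ?C (\<Prod>z\<in>?Z. [:- z, 1:]) (R k) = 0"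
    by (metis poly_act_smult)
  moreover have "lead_coeff ?f \<noteq> 0" using \<open>?f \<noteq> 0\<close> by (simp only: leading_coeff_0_iff not_False_eq_True)
  ultimately have "poly_act ?C (\<Prod>z\<in>?Z. [:- z, 1:]) (R k) = 0"
    using vec.scale_eq_0_iff by blast
  then obtain w where w: "\<forall>z\<in>?Z. ?C *v w z = z *s w z" "R k = (\<Sum>z\<in>?Z. w z)"
    using eigenvector_decomposition poly_roots_finite[OF \<open>?f \<noteq> 0\<close>] by metis
  define k' where "k' = (\<chi> i. real_of_rat (k $ i))"
  have "k $ i \<in> \<int>" for i using m(2)[of i] by (simp add: k_def)
  then have "k' \<in> int_lattice"
    by (simp add: k'_def int_lattice_def) (metis Ints_cases Ints_of_int of_rat_of_int_eq)
  moreover have "k' \<noteq> 0" using qp(1) m(1) by (auto simp: k'_def k_def vec_eq_iff)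
  moreover have "complex_vec k' = R k"
  proof -
    have "complex_of_real (of_rat x) = of_rat x" for x
      by (cases x) (simp add: of_rat_rat)
    then show ?thesis by (simp add: complex_vec_def R_def k'_def vec_eq_iff)
  qed
  ultimately show ?thesis using w poly_roots_finite[OF \<open>?f \<noteq> 0\<close>]
    by (intro bexI[of _ k'] conjI exI[of _ ?Z] exI[of _ w]) simp_all
qed

text \<open>Applying the product of the operators \<open>shift - z\<close>, \<open>z \<noteq> z\<^sub>0\<close>, isolates the term of the dominant \<open>z\<^sub>0\<close>, so a
  window of fixed length always contains a term of the maximal order of magnitude.\<close>

lemma exponential_sum_growth:
  fixes c :: "nat \<Rightarrow> complex"
  assumes "finite Z" and c: "\<And>n. c n = (\<Sum>z\<in>Z. \<gamma> z * z ^ n)" and "\<not> bounded (range c)"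
  shows "\<exists>m \<rho> a b. \<rho> > 1 \<and> a > 0 \<and> b > 0 \<and> (\<forall>n. cmod (c n) \<le> b * \<rho> ^ n) \<and>
    (\<forall>n. \<exists>i<m. a * \<rho> ^ n \<le> cmod (c (n + i)))"
proof -
  \<comment> \<open>Terms with coefficient 0 are dropped so that the maximal modulus \<rho> is that
    of a term really present.\<close>
  define Z' where "Z' = {z\<in>Z. \<gamma> z \<noteq> 0}"
  have "finite Z'" using assms(1) by (simp add: Z'_def)
  have c': "c n = (\<Sum>z\<in>Z'. \<gamma> z * z ^ n)" for n
    unfolding c by (rule sum.mono_neutral_right) (auto simp: Z'_def assms(1))
  have "Z' \<noteq> {}"
  proof
    assume "Z' = {}"
    then have "c n = 0" for n by (simp add: c')
    then have "range c = {0}" by auto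
    with assms(3) show False by simp
  qed
  define \<rho> where "\<rho> = Max (cmod ` Z')"
  have \<rho>: "cmod z \<le> \<rho>" if "z \<in> Z'" for z using that \<open>finite Z'\<close> by (simp add: \<rho>_def)
  have "\<rho> \<in> cmod ` Z'" unfolding \<rho>_def using \<open>finite Z'\<close> \<open>Z' \<noteq> {}\<close> by (intro Max_in) auto
  then obtain z0 where z0: "z0 \<in> Z'" "\<rho> = cmod z0" by blast
  define b where "b = 1 + (\<Sum>z\<in>Z'. cmod (\<gamma> z))"
  have "b > 0" unfolding b_def by (rule add_pos_nonneg) (auto intro: sum_nonneg)
  have upper: "cmod (c n) \<le> b * \<rho> ^ n" for n
  proof -
    have "cmod (c n) \<le> (\<Sum>z\<in>Z'. cmod (\<gamma> z) * cmod z ^ n)"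
      unfolding c' by (rule order_trans[OF norm_sum]) (simp add: norm_mult norm_power)
    also have "\<dots> \<le> (\<Sum>z\<in>Z'. cmod (\<gamma> z) * \<rho> ^ n)"
      by (intro sum_mono mult_left_mono power_mono \<rho>) auto
    also have "\<dots> \<le> b * \<rho> ^ n"
      unfolding b_def distrib_right sum_distrib_right[symmetric] using z0 by simp
    finally show ?thesis .
  qed
  have "\<rho> > 1"
  proof (rule ccontr)
    assume "\<not> ?thesis"
    then have "\<rho> ^ n \<le> 1" for n using z0 by (intro power_le_one) auto
    then have "cmod (c n) \<le> b" for n
      using order_trans[OF upper mult_left_le] \<open>b > 0\<close> less_imp_le by blast
    then have "bounded (range c)" unfolding bounded_iff by blast
    with assms(3) show False by simp
  qed
  define h where "h = (\<Prod>z\<in>Z' - {z0}. [:- z, 1:])"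
  have h0: "poly h z = 0" if "z \<in> Z'" "z \<noteq> z0" for z
    using that \<open>finite Z'\<close> by (auto simp: h_def poly_prod)
  have hz0: "poly h z0 \<noteq> 0" using \<open>finite Z'\<close> by (auto simp: h_def poly_prod)
  have shift: "(\<Sum>j\<le>degree h. coeff h j * c (n + j)) = \<gamma> z0 * z0 ^ n * poly h z0" for n
  proof -
    have "(\<Sum>j\<le>degree h. coeff h j * c (n + j))
        = (\<Sum>z\<in>Z'. \<gamma> z * z ^ n * (\<Sum>j\<le>degree h. coeff h j * z ^ j))"
      unfolding c' sum_distrib_left
      by (subst sum.swap) (simp add: power_add mult_ac)
    also have "\<dots> = (\<Sum>z\<in>Z'. \<gamma> z * z ^ n * poly h z)" by (simp add: poly_altdef)
    also have "\<dots> = (\<Sum>z\<in>{z0}. \<gamma> z * z ^ n * poly h z)"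
      using z0 h0 \<open>finite Z'\<close> by (intro sum.mono_neutral_right) auto
    finally show ?thesis by simp
  qed
  \<comment> \<open>The summand 1 makes L exceed the sum of the moduli of the coefficients, which
    produces the strict inequality in \<open>lower\<close>.\<close>
  define L where "L = 1 + (\<Sum>j\<le>degree h. cmod (coeff h j))"
  have "L > 0" unfolding L_def by (rule add_pos_nonneg) (auto intro: sum_nonneg)
  define g where "g = cmod (\<gamma> z0 * poly h z0)"
  have "g > 0" using z0 hz0 by (simp add: g_def Z'_def)
  define a where "a = g / L"
  have "a > 0" using \<open>g > 0\<close> \<open>L > 0\<close> by (simp add: a_def)
  have lower: "\<exists>i<Suc (degree h). a * \<rho> ^ n \<le> cmod (c (n + i))" for n
  proof (rule ccontr)
    assume "\<not> ?thesis"
    then have less: "cmod (c (n + j)) \<le> a * \<rho> ^ n" if "j \<le> degree h" for j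
      using that by (meson less_Suc_eq_le linear)
    have "g * \<rho> ^ n = cmod (\<Sum>j\<le>degree h. coeff h j * c (n + j))"
      unfolding shift by (simp add: g_def z0 norm_mult norm_power)
    also have "\<dots> \<le> (\<Sum>j\<le>degree h. cmod (coeff h j) * (a * \<rho> ^ n))"
      by (rule order_trans[OF norm_sum], rule sum_mono) (simp add: norm_mult mult_left_mono less)
    also have "\<dots> = (L - 1) * (a * \<rho> ^ n)" by (simp add: L_def sum_distrib_right)
    also have "\<dots> < L * (a * \<rho> ^ n)"
      using \<open>a > 0\<close> \<open>\<rho> > 1\<close> by (simp add: algebra_simps)
    also have "\<dots> = g * \<rho> ^ n" using \<open>L > 0\<close> by (simp add: a_def)
    finally show False by simp
  qed
  from \<open>\<rho> > 1\<close> \<open>a > 0\<close> \<open>b > 0\<close> upper lower show ?thesis by blast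
qed

text \<open>Splitting k into eigenvectors of the transpose turns c into an exponential sum without
  polynomial factors, whose coefficients are the bilinear pairings of the eigenvectors with
  u.\<close>

lemma character_growth:
  fixes A :: "int ^ 'd ^ 'd"
  assumes "finite Z" "\<forall>z\<in>Z. complex_mat (transpose A) *v w z = z *s w z"
    and "complex_vec k = (\<Sum>z\<in>Z. w z)"
    and c_def: "\<And>n. c n = k \<bullet> (((*v) (real_mat A)) ^^ n) u"
    and "\<not> bounded (range c)"
  shows "\<exists>m \<rho> a b. \<rho> > 1 \<and> a > 0 \<and> b > 0 \<and> (\<forall>n. \<bar>c n\<bar> \<le> b * \<rho> ^ n) \<and>
    (\<forall>n. \<exists>i<m. a * \<rho> ^ n \<le> \<bar>c (n + i)\<bar>)"
proof -
  let ?C = "complex_mat (transpose A)"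
  define \<gamma> where "\<gamma> z = (\<Sum>i\<in>UNIV. w z $ i * of_real (u $ i))" for z
  have "complex_of_real (c n) = (\<Sum>z\<in>Z. \<gamma> z * z ^ n)" for n
  proof -
    have "complex_of_real (c n)
        = (\<Sum>i\<in>UNIV. complex_vec ((((*v) (real_mat (transpose A))) ^^ n) k) $ i * of_real (u $ i))"
      unfolding c_def inner_funpow_adjoint by (simp add: inner_vec_def complex_vec_def)
    also have "complex_vec ((((*v) (real_mat (transpose A))) ^^ n) k) = (\<Sum>z\<in>Z. z ^ n *s w z)"
      unfolding complex_vec_funpow assms(3) funpow_matrix_sum
      using assms(2) by (intro sum.cong refl funpow_eigenvector) auto
    also have "(\<Sum>i\<in>UNIV. (\<Sum>z\<in>Z. z ^ n *s w z) $ i * of_real (u $ i)) = (\<Sum>z\<in>Z. \<gamma> z * z ^ n)"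
      unfolding \<gamma>_def sum_distrib_right sum_component vector_smult_component
      by (subst sum.swap) (simp add: mult_ac)
    finally show ?thesis .
  qed
  moreover have "\<not> bounded (range (\<lambda>n. complex_of_real (c n)))"
    using assms(5) by (simp add: bounded_iff)
  ultimately show ?thesis
    using exponential_sum_growth[OF assms(1), of "\<lambda>n. complex_of_real (c n)" \<gamma>]
    unfolding norm_of_real by blast
qed


section \<open>A Cantor construction on a line\<close>

text \<open>Three, not two: the intervals are closed, so a set filling one of them also touches both
  neighbours.\<close>

lemma card_children_le_3:
  fixes X :: "real set"
  assumes "h > 0" and diam: "\<And>t t'. t \<in> X \<Longrightarrow> t' \<in> X \<Longrightarrow> \<bar>t - t'\<bar> \<le> h"
  shows "finite {p::nat. X \<inter> {x + p * h..x + (p + 1) * h} \<noteq> {}} \<and>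
    card {p::nat. X \<inter> {x + p * h..x + (p + 1) * h} \<noteq> {}} \<le> 3"
proof -
  let ?P = "{p::nat. X \<inter> {x + p * h..x + (p + 1) * h} \<noteq> {}}"
  have "\<exists>p0. ?P \<subseteq> {p0..p0 + 2}"
  proof (cases "?P = {}")
    case False
    define p0 where "p0 = (LEAST p. p \<in> ?P)"
    have "p0 \<in> ?P" unfolding p0_def using False LeastI_ex[of "\<lambda>p. p \<in> ?P"] by blast
    have "p \<in> {p0..p0 + 2}" if p: "p \<in> ?P" for p
    proof -
      have "p0 \<le> p" unfolding p0_def using p by (rule Least_le)
      obtain t where t: "t \<in> X" "x + p * h \<le> t" using p by auto
      obtain t' where t': "t' \<in> X" "t' \<le> x + (real p0 + 1) * h" using \<open>p0 \<in> ?P\<close> by (auto simp: add.commute)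
      have "t - t' \<le> h" using diam[OF t(1) t'(1)] by simp
      then have "real p * h \<le> (real p0 + 2) * h" using t t' by (simp add: algebra_simps)
      then have "real p \<le> real p0 + 2" using \<open>h > 0\<close> by (simp add: mult_le_cancel_right)
      with \<open>p0 \<le> p\<close> show ?thesis by simp
    qed
    then show ?thesis by blast
  qed auto
  then obtain p0 where p0: "?P \<subseteq> {p0..p0 + 2}" ..
  then have "finite ?P" by (rule finite_subset) simp
  moreover have "card ?P \<le> card {p0..p0 + 2}" using p0 by (intro card_mono) simp_all
  ultimately show ?thesis by simp
qed

text \<open>Taking q near ln K / ln \<rho> makes both 3 q and K^\<sigma>, \<sigma> < 1, negligible
  against K. The first will count the children lost to the forbidden phases of one level, the second
  those that a covering can crowd.\<close>

lemma exists_branching_number: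
  fixes \<rho> \<sigma> C :: real
  assumes "\<rho> > 1" "\<sigma> < 1"
  shows "\<exists>K q. 2 \<le> K \<and> real K \<le> \<rho> ^ q \<and> 3 * real q + C * real K powr \<sigma> < real K"
proof -
  define L where "L = ln \<rho>"
  have "L > 0" using assms(1) by (simp add: L_def)
  have "eventually (\<lambda>x::real. 3 * (ln x / L + 1) + C * x powr \<sigma> < x) at_top"
  proof -
    have "((\<lambda>x::real. x powr (\<sigma> - 1)) \<longlongrightarrow> 0) at_top"
      using assms(2) by (intro tendsto_neg_powr filterlim_ident) auto
    moreover have "((\<lambda>x::real. 3 * (ln x / L + 1) / x) \<longlongrightarrow> 0) at_top"
      using \<open>L > 0\<close> by real_asymp
    ultimately have "((\<lambda>x::real. 3 * (ln x / L + 1) / x + C * x powr (\<sigma> - 1)) \<longlongrightarrow> 0 + C * 0) at_top"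
      by (intro tendsto_intros)
    then have "eventually (\<lambda>x::real. 3 * (ln x / L + 1) / x + C * x powr (\<sigma> - 1) < 1) at_top"
      by (rule order_tendstoD) simp
    with eventually_gt_at_top[of "0::real"] show ?thesis
    proof eventually_elim
      case (elim x)
      have "x powr \<sigma> = x powr (\<sigma> - 1) * x" using elim by (simp add: powr_diff)
      then have "3 * (ln x / L + 1) + C * x powr \<sigma>
          = (3 * (ln x / L + 1) / x + C * x powr (\<sigma> - 1)) * x"
        using elim by (simp add: distrib_right)
      also have "\<dots> < 1 * x" using elim by (intro mult_strict_right_mono)
      finally show ?case by simp
    qed
  qed
  then have "eventually (\<lambda>K::nat. 3 * (ln (real K) / L + 1) + C * real K powr \<sigma> < real K) at_top"
    by (rule eventually_compose_filterlim) (rule filterlim_real_sequentially)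
  moreover have "eventually (\<lambda>K::nat. 2 \<le> K) at_top" by (rule eventually_ge_at_top)
  ultimately have "eventually (\<lambda>K::nat. 3 * (ln (real K) / L + 1) + C * real K powr \<sigma> < real K
      \<and> 2 \<le> K) at_top"
    by (rule eventually_conj)
  then obtain K :: nat where K: "3 * (ln (real K) / L + 1) + C * real K powr \<sigma> < real K" "2 \<le> K"
    by (auto simp: eventually_at_top_linorder)
  define q where "q = nat \<lceil>ln (real K) / L\<rceil>"
  have "ln (real K) / L \<ge> 0" using K \<open>L > 0\<close> by simp
  then have q: "ln (real K) / L \<le> real q" "real q \<le> ln (real K) / L + 1"
    unfolding q_def by linarith+
  have "ln (real K) \<le> real q * L" using q(1) \<open>L > 0\<close> by (simp add: pos_divide_le_eq)
  also have "\<dots> = ln (\<rho> ^ q)" using assms(1) by (simp add: L_def ln_realpow)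
  finally have "real K \<le> \<rho> ^ q" using K assms(1) by simp
  moreover have "3 * real q + C * real K powr \<sigma> < real K" using q(2) by (intro le_less_trans[OF _ K(1)]) simp
  ultimately show ?thesis using K(2) by blast
qed

lemma nested_intervals_point:
  fixes x h :: "nat \<Rightarrow> real"
  assumes "\<And>j. x j \<le> x (Suc j)" "\<And>j. x (Suc j) + h (Suc j) \<le> x j + h j" "\<And>j. h j \<ge> 0"
  shows "\<exists>t. \<forall>j. t \<in> {x j..x j + h j}"
proof -
  have mono: "x j \<le> x k" if "j \<le> k" for j k using that assms(1) by (rule lift_Suc_mono_le[rotated])
  have anti: "x k + h k \<le> x j + h j" if "j \<le> k" for j k
    using that assms(2) by (rule lift_Suc_antimono_le[of "\<lambda>j. x j + h j", rotated])
  have le: "x j \<le> x k + h k" for j k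
    using mono[of j "max j k"] anti[of k "max j k"] assms(3)[of "max j k"] by simp
  then have bdd: "bdd_above (range x)" by (intro bdd_aboveI) auto
  have "(SUP j. x j) \<in> {x j..x j + h j}" for j
    using le by (auto intro!: cSUP_upper bdd cSUP_least)
  then show ?thesis by blast
qed

lemma ennreal_le_suminf: "f i \<le> (\<Sum>i. f i :: ennreal)"
  using sum_le_suminf[of f "{i}"] by (simp add: summableI)

text \<open>\<open>X\<close> stays out of reach of coverings whose \<open>\<sigma>\<close>-dimensional total size on \<open>[0, 1]\<close> is below
  \<open>\<eta>\<close>. The \<open>i\<close>-th member of a covering is a union of \<open>card F\<close> sets of size \<open>l i\<close>, because a small
  subset of the torus meets a line segment in several short pieces.\<close>

definition uncoverable :: "real \<Rightarrow> 'b set \<Rightarrow> real \<Rightarrow> real set \<Rightarrow> bool" where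
  "uncoverable \<sigma> F \<eta> X \<longleftrightarrow> (\<forall>(G :: nat \<Rightarrow> 'b \<Rightarrow> real set) l.
    (\<forall>i. l i > 0) \<longrightarrow>
    (\<forall>i. \<forall>p\<in>F. \<forall>t\<in>G i p. \<forall>t'\<in>G i p. \<bar>t - t'\<bar> \<le> l i) \<longrightarrow>
    (\<Sum>i. ennreal (l i powr \<sigma>) * indicator {i. (\<Union>p\<in>F. G i p) \<inter> {0..1} \<noteq> {}} i) < ennreal \<eta> \<longrightarrow>
    (\<exists>t\<in>{0..1} \<inter> X. \<forall>i. t \<notin> (\<Union>p\<in>F. G i p)))"

lemma uncoverable_mono:
  assumes "uncoverable \<sigma> F \<eta> X" "X \<subseteq> Y"
  shows "uncoverable \<sigma> F \<eta> Y"
  unfolding uncoverable_def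
proof (intro allI impI)
  fix G l
  assume G: "\<forall>i. l i > 0" "\<forall>i. \<forall>p\<in>F. \<forall>t\<in>G i p. \<forall>t'\<in>G i p. \<bar>t - t'\<bar> \<le> l i"
    "(\<Sum>i. ennreal (l i powr \<sigma>) * indicator {i. (\<Union>p\<in>F. G i p) \<inter> {0..1} \<noteq> {}} i) < ennreal \<eta>"
  have "\<exists>t\<in>{0..1} \<inter> X. \<forall>i. t \<notin> (\<Union>p\<in>F. G i p)"
    by (rule assms(1)[unfolded uncoverable_def, THEN spec, THEN spec, THEN mp, THEN mp, THEN mp, OF G])
  with assms(2) show "\<exists>t\<in>{0..1} \<inter> Y. \<forall>i. t \<notin> (\<Union>p\<in>F. G i p)"
    by blast
qed

text \<open>Greedy descent through \<open>K\<close>-adic intervals: at level \<open>j\<close> the times \<open>n\<close> with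
  \<open>K\<^sup>j\<^sup>-\<^sup>1 < 4 B \<rho>\<^sup>n \<le> K\<^sup>j\<close> forbid at most \<open>3 q\<close> of the \<open>K\<close> children, and among the others some
  child meets few members of the covering.\<close>

lemma uncoverable_gap_set:
  fixes c :: "nat \<Rightarrow> real" and F :: "'b set"
  assumes "\<rho> > 1" "a > 0" "b > 0"
    and upper: "\<And>n. \<bar>c n\<bar> \<le> b * \<rho> ^ n"
    and lower: "\<And>n. \<exists>i<m. a * \<rho> ^ n \<le> \<bar>c (n + i)\<bar>"
    and "0 < \<sigma>" "\<sigma> < 1" "finite F"
  shows "\<exists>r>0. \<exists>\<eta>>0. \<forall>\<alpha> :: nat \<Rightarrow> real. uncoverable \<sigma> F \<eta>
    {t. \<forall>n. \<exists>i<m. \<forall>z\<in>\<int>. r \<le> \<bar>\<alpha> (n + i) + t * c (n + i) - z\<bar>}"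
proof -
  \<comment> \<open>A member of the covering has \<open>card F\<close> pieces, and a piece no longer
    than a child meets at most three children.\<close>
  define N where "N = 3 * card F"
  obtain K q where K: "2 \<le> K" "real K \<le> \<rho> ^ q" "3 * real q + real N * real K powr \<sigma> < real K"
    using exists_branching_number[OF assms(1,7)] by blast
  \<comment> \<open>Bounds the growth over a whole window of m times. The maximum with 1 gives
    \<open>1 < 4 * B * \<rho> ^ n\<close>, so every time n belongs to some level j \<ge> 1.\<close>
  define B where "B = max 1 b * \<rho> ^ m"
  have "B \<ge> 1" unfolding B_def using assms(1) one_le_power[of \<rho> m]
    by (metis less_imp_le max.cobounded1 mult_mono' mult_1 zero_le_one)
  have c_le: "\<bar>c (n + i)\<bar> \<le> B * \<rho> ^ n" if "i < m" for n i
  proof -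
    have "\<bar>c (n + i)\<bar> \<le> b * \<rho> ^ (n + i)" by (rule upper)
    also have "\<dots> \<le> max 1 b * \<rho> ^ (n + m)"
      using assms(1,3) that by (intro mult_mono power_increasing) auto
    finally show ?thesis by (simp add: B_def power_add mult_ac)
  qed
  \<comment> \<open>The bound 1 / 4 identifies the two integers in \<open>bad_diam\<close>, since
    then |z - z'| < 1/4 + 2 r < 1. The other bound makes the width 2 r / (a \<rho>^n) of a forbidden
    set at most \<open>h (Suc j)\<close>, because K^j < 4 B K \<rho>^n for n in
    \<open>T j\<close>.\<close>
  define r where "r = min (1 / 4) (a / (8 * B * real K ^ 2))"
  have "r > 0" using assms(2) \<open>B \<ge> 1\<close> K(1) by (simp add: r_def)
  define h where "h j = inverse (real K ^ j)" for j
  have h: "h j > 0" "real K * h (Suc j) = h j" for j using K(1) by (simp_all add: h_def)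
  have h0: "h 0 = 1" by (simp add: h_def)
  \<comment> \<open>Invariant of the descent: the members meeting the interval of level j have total
    size below \<open>h (Suc j) powr \<sigma>\<close>, hence each is shorter than a child. This is
    its value at j = 0.\<close>
  define \<eta> where "\<eta> = h 1 powr \<sigma>"
  have "\<eta> > 0" using h(1)[of 1] by (simp add: \<eta>_def)
  show ?thesis
  proof (rule exI[of _ r], intro conjI \<open>r > 0\<close>, rule exI[of _ \<eta>], intro conjI \<open>\<eta> > 0\<close> allI,
      unfold uncoverable_def, intro allI impI)
    fix \<alpha> :: "nat \<Rightarrow> real" and G :: "nat \<Rightarrow> 'b \<Rightarrow> real set" and l :: "nat \<Rightarrow> real"
    define J where "J i = (\<Union>p\<in>F. G i p)" for i
    assume l: "\<forall>i. l i > 0"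
      and G: "\<forall>i. \<forall>p\<in>F. \<forall>t\<in>G i p. \<forall>t'\<in>G i p. \<bar>t - t'\<bar> \<le> l i"
      and "(\<Sum>i. ennreal (l i powr \<sigma>) * indicator {i. (\<Union>p\<in>F. G i p) \<inter> {0..1} \<noteq> {}} i) < ennreal \<eta>"
    then have small: "(\<Sum>i. ennreal (l i powr \<sigma>) * indicator {i. J i \<inter> {0..1} \<noteq> {}} i) < ennreal \<eta>"
      by (simp only: J_def)
    define \<Phi> where
      "\<Phi> X = (\<Sum>i. ennreal (l i powr \<sigma>) * indicator {i. J i \<inter> X \<noteq> {}} i)" for X :: "real set"
    define bad where
      "bad n t \<longleftrightarrow> (\<forall>i<m. \<exists>z\<in>\<int>. \<bar>\<alpha> (n + i) + t * c (n + i) - z\<bar> < r)" for n t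
    define T where "T j = {n. real K ^ j < real K * (4 * B * \<rho> ^ n) \<and> 4 * B * \<rho> ^ n \<le> real K ^ j}" for j
    \<comment> \<open>Within one level \<rho>^n varies by a factor below K \<le> \<rho>^q, so the
      level spans fewer than q + 1 consecutive times.\<close>
    have T_card: "finite (T j) \<and> card (T j) \<le> q" for j
    proof -
      have "\<exists>n0. T j \<subseteq> {n0..<n0 + q}"
      proof (cases "T j = {}")
        case False
        define n0 where "n0 = (LEAST n. n \<in> T j)"
        have "n0 \<in> T j" unfolding n0_def using False LeastI_ex[of "\<lambda>n. n \<in> T j"] by blast
        have "n \<in> {n0..<n0 + q}" if "n \<in> T j" for n
        proof -
          have "n0 \<le> n" unfolding n0_def using that by (rule Least_le)
          moreover have "n < n0 + q"
          proof (rule ccontr)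
            assume "\<not> ?thesis"
            then have "\<rho> ^ (n0 + q) \<le> \<rho> ^ n" using assms(1) by (intro power_increasing) auto
            moreover have "\<rho> ^ n0 * real K \<le> \<rho> ^ (n0 + q)"
              unfolding power_add using K(2) assms(1) by (intro mult_left_mono) auto
            ultimately have "\<rho> ^ n0 * real K \<le> \<rho> ^ n" by linarith
            then have "4 * B * (\<rho> ^ n0 * real K) \<le> 4 * B * \<rho> ^ n"
              using \<open>B \<ge> 1\<close> by (intro mult_left_mono) auto
            with \<open>n0 \<in> T j\<close> that show False by (simp add: T_def mult_ac)
          qed
          ultimately show ?thesis by simp
        qed
        then show ?thesis by blast
      qed auto
      then obtain n0 where "T j \<subseteq> {n0..<n0 + q}" ..
      then show ?thesis using card_mono[of "{n0..<n0 + q}" "T j"] finite_subset by auto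
    qed
    have T_ex: "\<exists>j. n \<in> T j" for n
    proof -
      have "\<exists>j. 4 * B * \<rho> ^ n \<le> real K ^ j"
        using real_arch_pow[of "real K" "4 * B * \<rho> ^ n"] K(1) by (auto intro: less_imp_le)
      define j where "j = (LEAST j. 4 * B * \<rho> ^ n \<le> real K ^ j)"
      have j: "4 * B * \<rho> ^ n \<le> real K ^ j" unfolding j_def by (rule LeastI_ex) fact
      have "1 < 4 * B * \<rho> ^ n"
      proof -
        have "1 * 1 \<le> B * \<rho> ^ n"
          using \<open>B \<ge> 1\<close> assms(1) by (intro mult_mono one_le_power) auto
        then show ?thesis by simp
      qed
      with j have "j \<noteq> 0" by (metis not_le power_0)
      then obtain j' where j': "j = Suc j'" by (cases j) auto
      then have "\<not> 4 * B * \<rho> ^ n \<le> real K ^ j'"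
        using not_less_Least[of j' "\<lambda>j. 4 * B * \<rho> ^ n \<le> real K ^ j"] by (simp add: j_def)
      then have "real K * real K ^ j' < real K * (4 * B * \<rho> ^ n)"
        using K(1) by (intro mult_strict_left_mono) auto
      with j j' show ?thesis by (intro exI[of _ j]) (simp add: T_def)
    qed
    \<comment> \<open>The phases of the window move by at most 1/4 across the interval, so both
      parameters are close to the same integer; the term with
      \<open>a * \<rho> ^ n \<le> \<bar>c (n + i)\<bar>\<close> then forces them together.\<close>
    have bad_diam: "\<bar>t - t'\<bar> \<le> h (Suc j)"
      if n: "n \<in> T j" and tt': "t \<in> {x..x + h j}" "t' \<in> {x..x + h j}" and "bad n t" "bad n t'"
      for n j t t' x
    proof -
      obtain i where i: "i < m" "a * \<rho> ^ n \<le> \<bar>c (n + i)\<bar>" using lower by blast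
      obtain z z' where z: "z \<in> \<int>" "\<bar>\<alpha> (n + i) + t * c (n + i) - z\<bar> < r"
        and z': "z' \<in> \<int>" "\<bar>\<alpha> (n + i) + t' * c (n + i) - z'\<bar> < r"
        using \<open>bad n t\<close> \<open>bad n t'\<close> i(1) unfolding bad_def by blast
      have "\<bar>t - t'\<bar> \<le> h j" using tt' by auto
      then have "\<bar>t - t'\<bar> * \<bar>c (n + i)\<bar> \<le> h j * (B * \<rho> ^ n)"
        using c_le[OF i(1)] h(1)[of j] by (intro mult_mono) (auto intro: less_imp_le)
      also have "\<dots> \<le> h j * (real K ^ j / 4)"
        using n h(1)[of j] by (intro mult_left_mono) (auto simp: T_def intro: less_imp_le)
      also have "\<dots> = 1 / 4" using K(1) by (simp add: h_def)
      finally have quarter: "\<bar>(t - t') * c (n + i)\<bar> \<le> 1 / 4" by (simp add: abs_mult)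
      have r4: "r \<le> 1 / 4" by (simp add: r_def)
      have "\<bar>z - z'\<bar> < 1"
      proof -
        have "z - z' = (t - t') * c (n + i) - (\<alpha> (n + i) + t * c (n + i) - z)
            + (\<alpha> (n + i) + t' * c (n + i) - z')"
          by (simp add: algebra_simps)
        then show ?thesis using quarter z(2) z'(2) r4 by linarith
      qed
      then have "z - z' = 0" using Ints_nonzero_abs_less1[of "z - z'"] z(1) z'(1) by auto
      then have "(t - t') * c (n + i) = (\<alpha> (n + i) + t * c (n + i) - z)
            - (\<alpha> (n + i) + t' * c (n + i) - z')"
        by (simp add: algebra_simps)
      then have "\<bar>(t - t') * c (n + i)\<bar> \<le> 2 * r" using z(2) z'(2) by linarith
      then have "\<bar>t - t'\<bar> * (a * \<rho> ^ n) \<le> 2 * r"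
        using mult_left_mono[OF i(2), of "\<bar>t - t'\<bar>"] by (simp add: abs_mult)
      also have "2 * r \<le> 2 * (a / (8 * B * real K ^ 2))" by (simp add: r_def)
      finally have "\<bar>t - t'\<bar> * \<rho> ^ n * a \<le> 1 / (4 * B * real K ^ 2) * a" by (simp add: field_simps)
      then have "\<bar>t - t'\<bar> * \<rho> ^ n \<le> 1 / (4 * B * real K ^ 2)"
        using assms(2) by (rule mult_right_le_imp_le)
      then have "\<bar>t - t'\<bar> * \<rho> ^ n * (4 * B * real K ^ 2) \<le> 1"
        using \<open>B \<ge> 1\<close> K(1) by (simp add: pos_le_divide_eq)
      moreover have "\<bar>t - t'\<bar> * real K ^ Suc j \<le> \<bar>t - t'\<bar> * (\<rho> ^ n * (4 * B * real K ^ 2))"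
      proof (rule mult_left_mono)
        have "real K * real K ^ j \<le> real K * (real K * (4 * B * \<rho> ^ n))"
          using n by (intro mult_left_mono) (auto simp: T_def)
        then show "real K ^ Suc j \<le> \<rho> ^ n * (4 * B * real K ^ 2)"
          by (simp add: power2_eq_square mult_ac)
      qed simp
      ultimately have "\<bar>t - t'\<bar> * real K ^ Suc j \<le> 1" by (simp add: mult_ac)
      then show ?thesis unfolding h_def using K(1)
        by (simp add: divide_inverse[symmetric] inverse_eq_divide pos_le_divide_eq del: power_Suc)
    qed
    have l_less: "l i < s" if X: "\<Phi> X < ennreal (s powr \<sigma>)" "J i \<inter> X \<noteq> {}" "s > 0" for X s i
    proof -
      let ?f = "\<lambda>i. ennreal (l i powr \<sigma>) * indicator {i. J i \<inter> X \<noteq> {}} i"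
      have "ennreal (l i powr \<sigma>) = ?f i" using X(2) by simp
      also have "\<dots> \<le> \<Phi> X" unfolding \<Phi>_def
        by (rule ennreal_le_suminf)
      finally have "ennreal (l i powr \<sigma>) < ennreal (s powr \<sigma>)" using X(1) by (rule le_less_trans)
      then have less: "l i powr \<sigma> < s powr \<sigma>" by (simp add: ennreal_less_iff)
      show ?thesis
      proof (rule ccontr)
        assume "\<not> ?thesis"
        then have "s powr \<sigma> \<le> l i powr \<sigma>"
          using X(3) assms(6) by (intro powr_mono2) auto
        with less show False by simp
      qed
    qed
    have step: "\<exists>y\<ge>x. y + h (Suc j) \<le> x + h j \<and> (\<forall>n\<in>T j. \<forall>t\<in>{y..y + h (Suc j)}. \<not> bad n t) \<and>
        \<Phi> {y..y + h (Suc j)} < ennreal (h (Suc (Suc j)) powr \<sigma>)"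
      if x: "\<Phi> {x..x + h j} < ennreal (h (Suc j) powr \<sigma>)" for x j
    proof -
      define child where "child p = {x + real p * h (Suc j)..x + (real p + 1) * h (Suc j)}" for p :: nat
      have child_sub: "child p \<subseteq> {x..x + h j}" if "p < K" for p
      proof -
        have "(real p + 1) * h (Suc j) \<le> real K * h (Suc j)"
          using that h(1)[of "Suc j"] by (intro mult_right_mono) auto
        moreover have "0 \<le> real p * h (Suc j)" using h(1)[of "Suc j"] by simp
        ultimately show ?thesis using h(2)[of j] by (auto simp: child_def)
      qed
      define Bad where "Bad = {p. p < K \<and> (\<exists>n\<in>T j. \<exists>t\<in>child p. bad n t)}"
      have "card Bad \<le> 3 * q"
      proof -
        let ?X = "\<lambda>n. {t. t \<in> {x..x + h j} \<and> bad n t}"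
        let ?C = "\<lambda>n. {p. ?X n \<inter> child p \<noteq> {}}"
        have C: "finite (?C n) \<and> card (?C n) \<le> 3" if "n \<in> T j" for n
          unfolding child_def using bad_diam[OF that] h(1)[of "Suc j"]
          by (intro card_children_le_3) auto
        have "Bad \<subseteq> (\<Union>n\<in>T j. ?C n)" unfolding Bad_def using child_sub by blast
        then have "card Bad \<le> card (\<Union>n\<in>T j. ?C n)"
          using C T_card by (intro card_mono) auto
        also have "\<dots> \<le> (\<Sum>n\<in>T j. card (?C n))" using T_card by (intro card_UN_le) auto
        also have "\<dots> \<le> (\<Sum>n\<in>T j. 3)" using C by (intro sum_mono) auto
        also have "\<dots> \<le> 3 * q" using T_card[of j] by simp
        finally show ?thesis .
      qed
      define Good where "Good = {..<K} - Bad"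
      have Bad_sub: "Bad \<subseteq> {..<K}" by (auto simp: Bad_def)
      have "card Good = K - card Bad"
        unfolding Good_def using Bad_sub by (subst card_Diff_subset) (auto intro: finite_subset)
      then have card_Good: "real K - 3 * real q \<le> real (card Good)" using \<open>card Bad \<le> 3 * q\<close> by linarith
      have fin: "finite Good" by (simp add: Good_def)
      have l_small: "l i < h (Suc j)" if "J i \<inter> {x..x + h j} \<noteq> {}" for i
        using x that h(1) by (rule l_less)
      \<comment> \<open>Double counting: a member meeting the parent interval is shorter than a
        child, so it is counted for at most N of the children.\<close>
      have sum_le: "(\<Sum>p\<in>Good. \<Phi> (child p)) \<le> of_nat N * \<Phi> {x..x + h j}"
      proof -
        have "(\<Sum>p\<in>Good. \<Phi> (child p))
            = (\<Sum>i. \<Sum>p\<in>Good. ennreal (l i powr \<sigma>) * indicator {i. J i \<inter> child p \<noteq> {}} i)"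
          unfolding \<Phi>_def by (subst suminf_sum) (auto intro: summableI)
        also have "\<dots> \<le> (\<Sum>i. of_nat N *
            (ennreal (l i powr \<sigma>) * indicator {i. J i \<inter> {x..x + h j} \<noteq> {}} i))"
        proof (rule suminf_le)
          fix i
          let ?Q = "{p\<in>Good. J i \<inter> child p \<noteq> {}}"
          have eq: "(\<Sum>p\<in>Good. ennreal (l i powr \<sigma>) * indicator {i. J i \<inter> child p \<noteq> {}} i)
              = ennreal (l i powr \<sigma>) * of_nat (card ?Q)"
          proof -
            have "(\<Sum>p\<in>Good. ennreal (l i powr \<sigma>) * indicator {i. J i \<inter> child p \<noteq> {}} i)
                = ennreal (l i powr \<sigma>) * (\<Sum>p\<in>Good. if J i \<inter> child p \<noteq> {} then 1 else 0)"
              unfolding sum_distrib_left by (intro sum.cong) (auto simp: indicator_def)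
            also have "(\<Sum>p\<in>Good. if J i \<inter> child p \<noteq> {} then 1 else 0 :: ennreal) = of_nat (card ?Q)"
              by (subst sum.inter_filter[symmetric, OF fin]) simp
            finally show ?thesis .
          qed
          show "(\<Sum>p\<in>Good. ennreal (l i powr \<sigma>) * indicator {i. J i \<inter> child p \<noteq> {}} i)
              \<le> of_nat N * (ennreal (l i powr \<sigma>) * indicator {i. J i \<inter> {x..x + h j} \<noteq> {}} i)"
          proof (cases "J i \<inter> {x..x + h j} = {}")
            case True
            then have "?Q = {}" using child_sub unfolding Good_def by blast
            then show ?thesis unfolding eq by (simp only: card.empty) simp
          next
            case False
            let ?C = "\<lambda>p. {k. G i p \<inter> child k \<noteq> {}}"
            have C: "finite (?C p) \<and> card (?C p) \<le> 3" if "p \<in> F" for p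
              unfolding child_def
            proof (rule card_children_le_3[OF h(1)])
              fix t t' assume "t \<in> G i p" "t' \<in> G i p"
              with G that have "\<bar>t - t'\<bar> \<le> l i" by blast
              with l_small[OF False] show "\<bar>t - t'\<bar> \<le> h (Suc j)" by simp
            qed
            have "?Q \<subseteq> (\<Union>p\<in>F. ?C p)" by (auto simp: J_def)
            then have "card ?Q \<le> card (\<Union>p\<in>F. ?C p)"
              using C assms(8) by (intro card_mono) auto
            also have "\<dots> \<le> (\<Sum>p\<in>F. card (?C p))" using assms(8) by (rule card_UN_le)
            also have "\<dots> \<le> (\<Sum>p\<in>F. 3)" using C by (intro sum_mono) auto
            finally have "card ?Q \<le> N" by (simp add: N_def)
            then have "(of_nat (card ?Q) :: ennreal) \<le> of_nat N" by (rule of_nat_mono)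
            then have "ennreal (l i powr \<sigma>) * of_nat (card ?Q) \<le> ennreal (l i powr \<sigma>) * of_nat N"
              by (rule mult_left_mono) simp
            then show ?thesis unfolding eq using False by (simp add: mult.commute)
          qed
        qed (auto intro: summableI)
        also have "\<dots> = of_nat N * \<Phi> {x..x + h j}" unfolding \<Phi>_def by (rule ennreal_suminf_cmult)
        finally show ?thesis .
      qed
      \<comment> \<open>Pigeonhole: if every good child failed, dividing by
        \<open>h (Suc (Suc j)) powr \<sigma>\<close> would give card Good \<le> N K^\<sigma>,
        against the choice of K and q.\<close>
      have "\<exists>p\<in>Good. \<Phi> (child p) < ennreal (h (Suc (Suc j)) powr \<sigma>)"
      proof (rule ccontr)
        assume "\<not> ?thesis"
        then have "of_nat (card Good) * ennreal (h (Suc (Suc j)) powr \<sigma>) \<le> (\<Sum>p\<in>Good. \<Phi> (child p))"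
          using sum_bounded_below[of Good "ennreal (h (Suc (Suc j)) powr \<sigma>)" "\<lambda>p. \<Phi> (child p)"]
          by (simp add: not_less)
        also have "\<dots> \<le> of_nat N * \<Phi> {x..x + h j}" by (rule sum_le)
        also have "\<dots> \<le> of_nat N * ennreal (h (Suc j) powr \<sigma>)"
          using x by (intro mult_left_mono) auto
        finally have "ennreal (real (card Good) * h (Suc (Suc j)) powr \<sigma>)
            \<le> ennreal (real N * h (Suc j) powr \<sigma>)"
          by (simp add: ennreal_mult'' ennreal_of_nat_eq_real_of_nat)
        then have "real (card Good) * h (Suc (Suc j)) powr \<sigma> \<le> real N * h (Suc j) powr \<sigma>"
          by (simp add: ennreal_le_iff)
        also have "h (Suc j) = real K * h (Suc (Suc j))" by (rule h(2)[symmetric])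
        also have "(real K * h (Suc (Suc j))) powr \<sigma> = real K powr \<sigma> * h (Suc (Suc j)) powr \<sigma>" by (rule powr_mult)
        finally have "real (card Good) * h (Suc (Suc j)) powr \<sigma>
            \<le> (real N * real K powr \<sigma>) * h (Suc (Suc j)) powr \<sigma>" by (simp only: mult.assoc)
        then have "real (card Good) \<le> real N * real K powr \<sigma>"
          using h(1)[of "Suc (Suc j)"] by (simp add: mult_le_cancel_right)
        with card_Good K(3) show False by linarith
      qed
      then obtain p where p: "p \<in> Good" "\<Phi> (child p) < ennreal (h (Suc (Suc j)) powr \<sigma>)" by blast
      define y where "y = x + real p * h (Suc j)"
      have ch: "child p = {y..y + h (Suc j)}" by (simp add: child_def y_def algebra_simps)
      have "p < K" "p \<notin> Bad" using p(1) by (auto simp: Good_def)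
      have "y \<ge> x" using h(1)[of "Suc j"] by (simp add: y_def)
      moreover have "y + h (Suc j) \<le> x + h j"
        using child_sub[OF \<open>p < K\<close>] h(1)[of "Suc j"] by (simp add: ch)
      moreover have "\<forall>n\<in>T j. \<forall>t\<in>{y..y + h (Suc j)}. \<not> bad n t"
        using \<open>p \<notin> Bad\<close> \<open>p < K\<close> ch by (auto simp: Bad_def)
      ultimately show ?thesis using p(2) unfolding ch by blast
    qed
    have "\<exists>x. \<forall>j. (\<Phi> {x j..x j + h j} < ennreal (h (Suc j) powr \<sigma>) \<and> (j = 0 \<longrightarrow> x j = 0)) \<and>
        (x j \<le> x (Suc j) \<and> x (Suc j) + h (Suc j) \<le> x j + h j \<and>
          (\<forall>n\<in>T j. \<forall>t\<in>{x (Suc j)..x (Suc j) + h (Suc j)}. \<not> bad n t))"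
    proof (rule dependent_nat_choice)
      show "\<exists>x. \<Phi> {x..x + h 0} < ennreal (h (Suc 0) powr \<sigma>) \<and> (0 = (0::nat) \<longrightarrow> x = 0)"
        using small by (intro exI[of _ 0]) (simp add: \<Phi>_def \<eta>_def h0)
    next
      fix x j
      assume "\<Phi> {x..x + h j} < ennreal (h (Suc j) powr \<sigma>) \<and> (j = 0 \<longrightarrow> x = 0)"
      then show "\<exists>y. (\<Phi> {y..y + h (Suc j)} < ennreal (h (Suc (Suc j)) powr \<sigma>) \<and> (Suc j = 0 \<longrightarrow> y = 0)) \<and>
          x \<le> y \<and> y + h (Suc j) \<le> x + h j \<and> (\<forall>n\<in>T j. \<forall>t\<in>{y..y + h (Suc j)}. \<not> bad n t)"
        using step[of x j] by auto
    qed
    then obtain x where x: "\<And>j. \<Phi> {x j..x j + h j} < ennreal (h (Suc j) powr \<sigma>)" "x 0 = 0"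
        "\<And>j. x j \<le> x (Suc j)" "\<And>j. x (Suc j) + h (Suc j) \<le> x j + h j"
        "\<And>j n t. n \<in> T j \<Longrightarrow> t \<in> {x (Suc j)..x (Suc j) + h (Suc j)} \<Longrightarrow> \<not> bad n t"
      by blast
    have "\<exists>t. \<forall>j. t \<in> {x j..x j + h j}"
      using x(3,4) h(1) by (intro nested_intervals_point) (auto intro: less_imp_le)
    then obtain t where t: "\<And>j. t \<in> {x j..x j + h j}" by blast
    have t01: "t \<in> {0..1}" using t[of 0] x(2) h0 by simp
    \<comment> \<open>A member containing t meets the intervals of all levels and is therefore
      shorter than every \<open>h (Suc j)\<close>, which its positive size forbids.\<close>
    have notJ: "t \<notin> J i" for i
    proof
      assume "t \<in> J i"
      have "l i < h (Suc j)" for j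
        using x(1) _ h(1)
      proof (rule l_less)
        show "J i \<inter> {x j..x j + h j} \<noteq> {}" using \<open>t \<in> J i\<close> t by blast
      qed
      then have "l i * real K ^ Suc j < 1" for j
        using K(1) by (simp add: h_def field_simps del: power_Suc)
      moreover obtain j where "1 / l i < real K ^ j"
        using real_arch_pow[of "real K" "1 / l i"] K(1) by auto
      moreover have "real K ^ j \<le> real K ^ Suc j" using K(1) by (intro power_increasing) auto
      ultimately show False using l by (metis less_le_trans mult.commute not_less_iff_gr_or_eq pos_divide_less_eq)
    qed
    have gap: "\<exists>i<m. \<forall>z\<in>\<int>. r \<le> \<bar>\<alpha> (n + i) + t * c (n + i) - z\<bar>" for n
    proof -
      obtain j where "n \<in> T j" using T_ex by blast
      then have "\<not> bad n t" using x(5) t by blast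
      then show ?thesis unfolding bad_def by (meson not_le)
    qed
    show "\<exists>t\<in>{0..1} \<inter> {t. \<forall>n. \<exists>i<m. \<forall>z\<in>\<int>. r \<le> \<bar>\<alpha> (n + i) + t * c (n + i) - z\<bar>}.
        \<forall>i. t \<notin> (\<Union>p\<in>F. G i p)"
    proof (rule bexI[of _ t])
      show "\<forall>i. t \<notin> (\<Union>p\<in>F. G i p)" using notJ unfolding J_def by (rule allI)
      show "t \<in> {0..1} \<inter> {t. \<forall>n. \<exists>i<m. \<forall>z\<in>\<int>. r \<le> \<bar>\<alpha> (n + i) + t * c (n + i) - z\<bar>}"
        by (intro IntI t01 CollectI allI gap)
    qed
  qed
qed


section \<open>Van der Corput averaging\<close>

lemma norm_sum_shift_diff_le:
  fixes a :: "nat \<Rightarrow> 'a::real_normed_vector"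
  assumes "\<And>n. norm (a n) \<le> 1"
  shows "norm ((\<Sum>n<N. a (n + h)) - (\<Sum>n<N. a n)) \<le> 2 * real h"
proof (induction h)
  case (Suc h)
  have "(\<Sum>n<Suc N. a (n + h)) = a h + (\<Sum>n<N. a (n + Suc h))"
    by (subst sum.lessThan_Suc_shift) simp
  then have "(\<Sum>n<N. a (n + Suc h)) = (\<Sum>n<N. a (n + h)) + a (N + h) - a h" by simp
  then have "(\<Sum>n<N. a (n + Suc h)) - (\<Sum>n<N. a n)
      = ((\<Sum>n<N. a (n + h)) - (\<Sum>n<N. a n)) + (a (N + h) - a h)" by simp
  then have "norm ((\<Sum>n<N. a (n + Suc h)) - (\<Sum>n<N. a n))
      \<le> norm ((\<Sum>n<N. a (n + h)) - (\<Sum>n<N. a n)) + norm (a (N + h) - a h)"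
    using norm_triangle_ineq by metis
  moreover have "norm (a (N + h) - a h) \<le> 2"
    using norm_triangle_ineq4[of "a (N + h)" "a h"] assms[of "N + h"] assms[of h] by linarith
  ultimately show ?case using Suc by simp
qed simp

text \<open>Cauchy-Schwarz in n, then expansion of the square over pairs of shifts: the M diagonal
  pairs cost N each, the others at most \<epsilon> N each.\<close>

lemma norm_sum_square_le:
  fixes a :: "nat \<Rightarrow> complex" and \<epsilon> :: real
  assumes a: "\<And>n. norm (a n) \<le> 1" and "\<epsilon> \<ge> 0"
    and off: "\<And>i j. i < M \<Longrightarrow> j < M \<Longrightarrow> i \<noteq> j \<Longrightarrow>
      norm (\<Sum>n<N. a (n + h i) * cnj (a (n + h j))) \<le> \<epsilon> * N"
  shows "(norm (\<Sum>n<N. \<Sum>i<M. a (n + h i)))\<^sup>2 \<le> (real N)\<^sup>2 * (real M + (real M)\<^sup>2 * \<epsilon>)"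
proof -
  let ?b = "\<lambda>n. \<Sum>i<M. a (n + h i)"
  have diag: "norm (\<Sum>n<N. a (n + h i) * cnj (a (n + h i))) \<le> real N" for i
  proof -
    have "norm (\<Sum>n<N. a (n + h i) * cnj (a (n + h i))) \<le> (\<Sum>n<N. 1)"
      by (rule sum_norm_le) (simp add: norm_mult a mult_le_one)
    then show ?thesis by simp
  qed
  have "complex_of_real (\<Sum>n<N. (norm (?b n))\<^sup>2)
      = (\<Sum>n<N. \<Sum>i<M. \<Sum>j<M. a (n + h i) * cnj (a (n + h j)))"
    by (simp only: of_real_sum complex_norm_square cnj_sum sum_product)
  also have "\<dots> = (\<Sum>i<M. \<Sum>n<N. \<Sum>j<M. a (n + h i) * cnj (a (n + h j)))"
    by (rule sum.swap)
  also have "\<dots> = (\<Sum>i<M. \<Sum>j<M. \<Sum>n<N. a (n + h i) * cnj (a (n + h j)))"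
    by (intro sum.cong refl sum.swap)
  finally have eq: "complex_of_real (\<Sum>n<N. (norm (?b n))\<^sup>2)
      = (\<Sum>i<M. \<Sum>j<M. \<Sum>n<N. a (n + h i) * cnj (a (n + h j)))" .
  have "(\<Sum>n<N. (norm (?b n))\<^sup>2) = norm (complex_of_real (\<Sum>n<N. (norm (?b n))\<^sup>2))"
    unfolding norm_of_real by (simp add: sum_nonneg)
  also have "\<dots> \<le> (\<Sum>i<M. \<Sum>j<M. (if i = j then real N else 0) + \<epsilon> * N)"
    unfolding eq
  proof (intro sum_norm_le)
    fix i j assume ij: "i \<in> {..<M}" "j \<in> {..<M}"
    show "norm (\<Sum>n<N. a (n + h i) * cnj (a (n + h j))) \<le> (if i = j then real N else 0) + \<epsilon> * N"
      using diag[of i] off[of i j] ij assms(2) by (auto intro: add_increasing2)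
  qed
  also have "\<dots> = N * (real M + (real M)\<^sup>2 * \<epsilon>)"
    by (simp add: sum.distrib) (simp add: power2_eq_square algebra_simps)
  finally have sq: "(\<Sum>n<N. (norm (?b n))\<^sup>2) \<le> N * (real M + (real M)\<^sup>2 * \<epsilon>)" .
  have "(norm (\<Sum>n<N. ?b n))\<^sup>2 \<le> (\<Sum>n<N. norm (?b n))\<^sup>2"
    by (intro power_mono norm_sum) simp
  also have "\<dots> \<le> (\<Sum>n<N. (norm (?b n))\<^sup>2) * card {..<N}"
    by (rule sum_squared_le_sum_of_squares)
  also have "\<dots> \<le> (N * (real M + (real M)\<^sup>2 * \<epsilon>)) * N" using sq by (simp add: mult_right_mono)
  finally show ?thesis by (simp add: power2_eq_square mult_ac)
qed

text \<open>The classical inequality takes consecutive shifts. Here they are arbitrary and may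
  depend on M and \<epsilon>, because decorrelation will be available only along return times of a
  bounded orbit.\<close>

lemma van_der_Corput_shifts:
  fixes a :: "nat \<Rightarrow> complex"
  assumes a: "\<And>n. norm (a n) \<le> 1"
    and cor: "\<And>M \<epsilon>. \<epsilon> > 0 \<Longrightarrow> \<exists>h :: nat \<Rightarrow> nat. \<forall>i<M. \<forall>j<M. i \<noteq> j \<longrightarrow>
      eventually (\<lambda>N. norm (\<Sum>n<N. a (n + h i) * cnj (a (n + h j))) \<le> \<epsilon> * real N) sequentially"
  shows "(\<lambda>N. (\<Sum>n<N. a n) / of_nat N) \<longlonglongrightarrow> 0"
proof (rule tendstoI)
  fix e :: real assume "e > 0"
  \<comment> \<open>With M \<ge> 1 / \<epsilon> the diagonal contributes at most \<epsilon> M^2, as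
    much as the other pairs, and 2 \<epsilon> = (e/2)^2. This uses half of e; the other half absorbs
    the boundary terms, 2 H against N.\<close>
  define \<epsilon> where "\<epsilon> = e\<^sup>2 / 8"
  have "\<epsilon> > 0" using \<open>e > 0\<close> by (simp add: \<epsilon>_def)
  obtain M0 :: nat where M0: "inverse (real (Suc M0)) < \<epsilon>" using reals_Archimedean[OF \<open>\<epsilon> > 0\<close>] by blast
  define M where "M = Suc M0"
  have "M > 0" "1 / real M < \<epsilon>" using M0 by (simp_all add: M_def inverse_eq_divide)
  then have M: "1 \<le> \<epsilon> * M" by (simp add: field_simps)
  obtain h where h: "\<forall>i<M. \<forall>j<M. i \<noteq> j \<longrightarrow>
      eventually (\<lambda>N. norm (\<Sum>n<N. a (n + h i) * cnj (a (n + h j))) \<le> \<epsilon> * real N) sequentially"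
    using cor[OF \<open>\<epsilon> > 0\<close>, of M] ..
  have "eventually (\<lambda>N. \<forall>i\<in>{..<M}. \<forall>j\<in>{..<M}. i \<noteq> j \<longrightarrow>
      norm (\<Sum>n<N. a (n + h i) * cnj (a (n + h j))) \<le> \<epsilon> * real N) sequentially"
  proof (intro eventually_ball_finite ballI finite_lessThan)
    fix i j assume "i \<in> {..<M}" "j \<in> {..<M}"
    then show "eventually (\<lambda>N. i \<noteq> j \<longrightarrow>
        norm (\<Sum>n<N. a (n + h i) * cnj (a (n + h j))) \<le> \<epsilon> * real N) sequentially"
      using h by (cases "i = j") simp_all
  qed
  moreover define H where "H = (\<Sum>i<M. h i)"
  have "eventually (\<lambda>N. real N > 4 * real H / e) sequentially"
    using filterlim_real_sequentially by (rule filterlim_at_top_dense[THEN iffD1, rule_format])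
  ultimately show "eventually (\<lambda>N. dist ((\<Sum>n<N. a n) / of_nat N) 0 < e) sequentially"
  proof eventually_elim
    case (elim N)
    have "N > 0"
    proof -
      have "0 \<le> 4 * real H / e" using \<open>e > 0\<close> by simp
      then have "0 < real N" using elim(2) by linarith
      then show ?thesis by simp
    qed
    let ?b = "\<Sum>n<N. \<Sum>i<M. a (n + h i)"
    have "(norm ?b)\<^sup>2 \<le> (real N)\<^sup>2 * (real M + (real M)\<^sup>2 * \<epsilon>)"
      using elim(1) \<open>\<epsilon> > 0\<close> by (intro norm_sum_square_le a) auto
    also have "\<dots> \<le> (real N)\<^sup>2 * ((e / 2)\<^sup>2 * (real M)\<^sup>2)"
    proof (rule mult_left_mono)
      have "real M * 1 \<le> real M * (\<epsilon> * M)" using M by (intro mult_left_mono) auto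
      then have "real M + (real M)\<^sup>2 * \<epsilon> \<le> (\<epsilon> + \<epsilon>) * (real M)\<^sup>2" by (simp add: power2_eq_square algebra_simps)
      also have "\<epsilon> + \<epsilon> = (e / 2)\<^sup>2" by (simp add: \<epsilon>_def power2_eq_square)
      finally show "real M + (real M)\<^sup>2 * \<epsilon> \<le> (e / 2)\<^sup>2 * (real M)\<^sup>2" .
    qed simp
    also have "\<dots> = (N * (e / 2) * M)\<^sup>2" by (simp add: power2_eq_square)
    finally have b: "norm ?b \<le> N * (e / 2) * M"
      by (rule power2_le_imp_le) (use \<open>e > 0\<close> in simp)
    have "norm (of_nat M * (\<Sum>n<N. a n) - ?b) \<le> 2 * real H"
    proof -
      have "?b = (\<Sum>i<M. \<Sum>n<N. a (n + h i))" by (rule sum.swap)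
      then have "of_nat M * (\<Sum>n<N. a n) - ?b = (\<Sum>i<M. (\<Sum>n<N. a n) - (\<Sum>n<N. a (n + h i)))"
        by (simp add: sum_subtractf)
      also have "norm \<dots> \<le> (\<Sum>i<M. 2 * real (h i))"
        by (rule sum_norm_le) (subst norm_minus_commute, rule norm_sum_shift_diff_le[OF a])
      also have "\<dots> = 2 * real H" by (simp add: H_def sum_distrib_left)
      finally show ?thesis .
    qed
    then have "norm (of_nat M * (\<Sum>n<N. a n)) \<le> 2 * real H + N * (e / 2) * M"
      using norm_triangle_sub[of "of_nat M * (\<Sum>n<N. a n)" ?b] b by linarith
    then have "M * norm (\<Sum>n<N. a n) \<le> 2 * real H + N * (e / 2) * M" by (simp add: norm_mult)
    moreover have "2 * real H < N * (e / 2)" using elim(2) \<open>e > 0\<close> by (simp add: field_simps)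
    moreover have "N * (e / 2) \<le> N * (e / 2) * M"
      using \<open>M > 0\<close> \<open>e > 0\<close> mult_left_mono[of 1 "real M" "real N * (e / 2)"] by simp
    moreover have "M * (N * e) = N * (e / 2) * M + N * (e / 2) * M" by simp
    ultimately have "M * norm (\<Sum>n<N. a n) < M * (N * e)" by linarith
    then have "norm (\<Sum>n<N. a n) < N * e" using \<open>M > 0\<close> by simp
    then show ?case using \<open>N > 0\<close> by (simp add: norm_divide field_simps)
  qed
qed

lemma exists_nat_sqrt: "\<exists>j::nat. j\<^sup>2 \<le> N \<and> N < (j + 1)\<^sup>2"
proof (induction N)
  case (Suc N)
  then obtain j where j: "j\<^sup>2 \<le> N" "N < (j + 1)\<^sup>2" by blast
  show ?case
  proof (cases "Suc N < (j + 1)\<^sup>2")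
    case True
    with j show ?thesis by (intro exI[of _ j]) auto
  next
    case False
    with j have "Suc N = (j + 1)\<^sup>2" by simp
    then show ?thesis by (intro exI[of _ "j + 1"]) (simp add: power2_eq_square)
  qed
qed (intro exI[of _ 0], simp)

text \<open>Consecutive squares differ by O(j), negligible against j^2, and the terms are bounded.
  Squares are sparse enough for the second moments to be summable.\<close>

lemma average_tendsto_zero_along_squares:
  fixes a :: "nat \<Rightarrow> complex"
  assumes a: "\<And>n. norm (a n) \<le> 1"
    and sq: "(\<lambda>j. (\<Sum>n<(Suc j)\<^sup>2. a n) / of_nat ((Suc j)\<^sup>2)) \<longlonglongrightarrow> 0"
  shows "(\<lambda>N. (\<Sum>n<N. a n) / of_nat N) \<longlonglongrightarrow> 0"
proof (rule tendstoI)
  fix e :: real assume "e > 0"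
  have "(\<lambda>j. (\<Sum>n<j\<^sup>2. a n) / of_nat (j\<^sup>2)) \<longlonglongrightarrow> 0"
    using sq by (rule LIMSEQ_imp_Suc)
  then have "eventually (\<lambda>j. dist ((\<Sum>n<j\<^sup>2. a n) / of_nat (j\<^sup>2)) 0 < e / 2) sequentially"
    using \<open>e > 0\<close> by (intro tendstoD) auto
  moreover have "eventually (\<lambda>j. real j > 4 / e) sequentially"
    using filterlim_real_sequentially by (rule filterlim_at_top_dense[THEN iffD1, rule_format])
  ultimately have "eventually (\<lambda>j. dist ((\<Sum>n<j\<^sup>2. a n) / of_nat (j\<^sup>2)) 0 < e / 2 \<and> real j > 4 / e) sequentially"
    by (rule eventually_conj)
  then obtain J where J: "\<And>j. j \<ge> J \<Longrightarrow> dist ((\<Sum>n<j\<^sup>2. a n) / of_nat (j\<^sup>2)) 0 < e / 2"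
      "\<And>j. j \<ge> J \<Longrightarrow> real j > 4 / e"
    by (auto simp: eventually_sequentially)
  have "dist ((\<Sum>n<N. a n) / of_nat N) 0 < e" if N: "N \<ge> (J + 1)\<^sup>2" for N
  proof -
    obtain j where j: "j\<^sup>2 \<le> N" "N < (j + 1)\<^sup>2" using exists_nat_sqrt by blast
    have "(J + 1)\<^sup>2 < (j + 1)\<^sup>2" using N j(2) by linarith
    then have "J < j" using power2_less_imp_less by fastforce
    then have "j > 0" by simp
    have "norm (\<Sum>n<j\<^sup>2. a n) < e / 2 * (real j)\<^sup>2"
      using J(1)[of j] \<open>J < j\<close> \<open>j > 0\<close> by (simp add: norm_divide norm_power field_simps)
    moreover have "(\<Sum>n<N. a n) = (\<Sum>n<j\<^sup>2. a n) + (\<Sum>n\<in>{j\<^sup>2..<N}. a n)"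
      using j(1) by (metis sum.atLeastLessThan_concat lessThan_atLeast0 le0)
    then have "norm (\<Sum>n<N. a n) \<le> norm (\<Sum>n<j\<^sup>2. a n) + norm (\<Sum>n\<in>{j\<^sup>2..<N}. a n)"
      by (simp add: norm_triangle_ineq)
    moreover have "norm (\<Sum>n\<in>{j\<^sup>2..<N}. a n) \<le> real (N - j\<^sup>2)"
      using sum_norm_le[of "{j\<^sup>2..<N}" a "\<lambda>_. 1"] a by simp
    moreover have "N - j\<^sup>2 \<le> 2 * j" using j by (simp add: power2_eq_square)
    then have "real (N - j\<^sup>2) \<le> 2 * real j" by (metis of_nat_mono of_nat_mult of_nat_numeral)
    moreover have "2 * real j \<le> e / 2 * (real j)\<^sup>2"
      using J(2)[of j] \<open>J < j\<close> \<open>e > 0\<close> by (simp add: power2_eq_square field_simps)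
    ultimately have "norm (\<Sum>n<N. a n) < e * (real j)\<^sup>2" by linarith
    also have "\<dots> \<le> e * real N"
    proof -
      have "real (j\<^sup>2) \<le> real N" using j(1) by (rule of_nat_mono)
      then show ?thesis using \<open>e > 0\<close> by simp
    qed
    finally have less: "norm (\<Sum>n<N. a n) < e * real N" .
    have "real N > 0" using j(1) \<open>j > 0\<close> by (metis gr_zeroI le_zero_eq of_nat_0_less_iff power_eq_0_iff)
    with less show ?thesis by (simp add: norm_divide field_simps)
  qed
  then show "eventually (\<lambda>N. dist ((\<Sum>n<N. a n) / of_nat N) 0 < e) sequentially"
    unfolding eventually_sequentially by blast
qed


section \<open>Characters of the torus\<close>

definition character :: "real ^ 'd \<Rightarrow> real ^ 'd \<Rightarrow> complex" where
  "character k x = cis (2 * pi * (k \<bullet> x))"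

lemma norm_character [simp]: "norm (character k x) = 1"
  by (simp add: character_def)

lemma character_add_left: "character (k + l) x = character k x * character l x"
  by (simp add: character_def cis_mult inner_add_left distrib_left)

lemma character_add_right: "character k (x + y) = character k x * character k y"
  by (simp add: character_def cis_mult inner_add_right distrib_left)

lemma cnj_character: "cnj (character k x) = character (- k) x"
  by (simp add: character_def cis_cnj)

lemma character_0 [simp]: "character 0 x = 1"
  by (simp add: character_def)

lemma inner_int_lattice: "k \<in> int_lattice \<Longrightarrow> l \<in> int_lattice \<Longrightarrow> k \<bullet> l \<in> \<int>"
  by (auto simp: int_lattice_def inner_vec_def intro!: Ints_sum Ints_mult)

lemma character_int_lattice:
  assumes "k \<in> int_lattice" "l \<in> int_lattice"
  shows "character k l = 1"
proof -
  obtain n where "k \<bullet> l = of_int n" using inner_int_lattice[OF assms] by (auto elim: Ints_cases)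
  then show ?thesis by (simp add: character_def cis_multiple_2pi)
qed

text \<open>The chord equals 2 |sin((a - b)/2)| and is no longer than the arc.\<close>

lemma norm_cis_diff_le: "norm (cis a - cis b) \<le> \<bar>a - b\<bar>"
proof -
  have "(norm (cis a - cis b))\<^sup>2 = (cos a - cos b)\<^sup>2 + (sin a - sin b)\<^sup>2"
    by (simp add: cmod_power2)
  also have "\<dots> = 2 - 2 * (cos a * cos b + sin a * sin b)"
    using sin_cos_squared_add2[of a] sin_cos_squared_add2[of b]
    by (simp add: power2_eq_square algebra_simps)
  also have "cos a * cos b + sin a * sin b = cos (2 * ((a - b) / 2))" by (simp add: cos_diff)
  also have "2 - 2 * cos (2 * ((a - b) / 2)) = (2 * sin ((a - b) / 2))\<^sup>2"
    unfolding cos_double_sin by (simp add: power_mult_distrib)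
  finally have "(norm (cis a - cis b))\<^sup>2 = \<bar>2 * sin ((a - b) / 2)\<bar>\<^sup>2" by simp
  then have "norm (cis a - cis b) = \<bar>2 * sin ((a - b) / 2)\<bar>"
    by (simp only: power2_eq_iff_nonneg norm_ge_zero abs_ge_zero)
  also have "\<dots> \<le> \<bar>a - b\<bar>" using abs_sin_x_le_abs_x[of "(a - b) / 2"] by (simp add: abs_mult)
  finally show ?thesis .
qed

lemma norm_character_diff_le:
  "norm (character k x - character k y) \<le> 2 * pi * norm k * norm (x - y)"
proof -
  have "norm (character k x - character k y) \<le> \<bar>2 * pi * (k \<bullet> (x - y))\<bar>"
    using norm_cis_diff_le[of "2 * pi * (k \<bullet> x)" "2 * pi * (k \<bullet> y)"]
    by (simp add: character_def inner_diff_right right_diff_distrib)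
  also have "\<dots> = 2 * pi * \<bar>k \<bullet> (x - y)\<bar>" by (simp add: abs_mult)
  also have "\<dots> \<le> 2 * pi * (norm k * norm (x - y))"
    by (intro mult_left_mono Cauchy_Schwarz_ineq2) simp
  finally show ?thesis by (simp add: mult.assoc)
qed

lemma continuous_on_character: "continuous_on A (character k)"
  unfolding character_def cis_conv_exp by (intro continuous_intros)

lemma borel_measurable_character [measurable]: "character k \<in> borel_measurable borel"
  by (rule borel_measurable_continuous_onI) (rule continuous_on_character)

lemma torus_proj_rep_torus [simp]: "torus_proj (rep_torus z) = z"
  using Quotient_torus by (rule Quotient_abs_rep)

lemma rep_torus_diff: "rep_torus (torus_proj x) - x \<in> int_lattice"
  unfolding torus.abs_eq_iff[symmetric] by simp

lemma dist_torus_proj_attained: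
  obtains l where "l \<in> int_lattice" "dist (torus_proj x) (torus_proj y) = norm (x - y - l)"
  using infdist_attains_inf[OF closed_int_lattice, of "x - y"] int_lattice_0
  by (metis dist_norm dist_torus.abs_eq empty_iff)

text \<open>Evaluated at an arbitrary representative, hence independent of that choice only for
  lattice vectors k; this is why membership in \<open>int_lattice\<close> recurs below.\<close>

definition torus_character :: "real ^ 'd \<Rightarrow> 'd::finite torus \<Rightarrow> complex" where
  "torus_character k z = character k (rep_torus z)"

lemma torus_character_proj:
  assumes "k \<in> int_lattice"
  shows "torus_character k (torus_proj x) = character k x"
proof -
  have "torus_character k (torus_proj x) = character k (rep_torus (torus_proj x) - x + x)"
    by (simp add: torus_character_def)
  then show ?thesis
    using character_int_lattice[OF assms rep_torus_diff] by (simp only: character_add_right) simp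
qed

lemma torus_character_add: "torus_character (k + l) z = torus_character k z * torus_character l z"
  by (simp add: torus_character_def character_add_left)

lemma cnj_torus_character: "cnj (torus_character k z) = torus_character (- k) z"
  by (simp add: torus_character_def cnj_character)

lemma torus_character_0 [simp]: "torus_character 0 z = 1"
  by (simp add: torus_character_def)

lemma norm_torus_character_diff_le:
  assumes "k \<in> int_lattice"
  shows "norm (torus_character k z - torus_character k w) \<le> 2 * pi * norm k * dist z w"
proof -
  let ?x = "rep_torus z" and ?y = "rep_torus w"
  obtain l where l: "l \<in> int_lattice" "dist (torus_proj ?x) (torus_proj ?y) = norm (?x - ?y - l)"
    by (rule dist_torus_proj_attained)
  have "character k ?x = character k (?x - l) * character k l"
    by (simp flip: character_add_right)
  then have "character k ?x = character k (?x - l)"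
    using character_int_lattice[OF assms l(1)] by simp
  then have "norm (torus_character k z - torus_character k w) \<le> 2 * pi * norm k * norm (?x - l - ?y)"
    using norm_character_diff_le[of k "?x - l" ?y] by (simp add: torus_character_def)
  then show ?thesis using l(2) by (simp add: algebra_simps)
qed

lemma continuous_on_torus_character:
  assumes "k \<in> int_lattice"
  shows "continuous_on A (torus_character k)"
proof -
  have "(2 * pi * norm k)-lipschitz_on A (torus_character k)"
    by (rule lipschitz_onI) (simp_all add: norm_torus_character_diff_le[OF assms] dist_norm)
  then show ?thesis by (rule lipschitz_on_continuous_on)
qed

lemma torus_proj_cube_surj:
  fixes z :: "'d::finite torus"
  shows "\<exists>y\<in>cbox 0 (1 :: real ^ 'd). torus_proj y = z"
proof -
  let ?x = "rep_torus z"
  let ?y = "(\<chi> i. frac (?x $ i)) :: real ^ 'd"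
  have "torus_proj ?y = torus_proj ?x"
    unfolding torus.abs_eq_iff by (simp add: int_lattice_def frac_def)
  moreover have "?y \<in> cbox 0 1"
    by (simp add: mem_box_cart frac_lt_1 less_imp_le)
  ultimately show ?thesis by (intro bexI[of _ ?y]) simp_all
qed

lemma compact_torus: "compact (UNIV :: 'd::finite torus set)"
proof -
  have "UNIV = torus_proj ` cbox 0 (1 :: real ^ 'd)" 
    using torus_proj_cube_surj by (metis UNIV_eq_I imageI)
  also have "compact \<dots>"
    by (intro compact_continuous_image continuous_on_torus_proj compact_cbox)
  finally show ?thesis .
qed

section \<open>Trigonometric polynomials\<close>

inductive trig_poly :: "('d::finite torus \<Rightarrow> complex) \<Rightarrow> bool" where
  character: "k \<in> int_lattice \<Longrightarrow> trig_poly (\<lambda>z. c * torus_character k z)"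
| add: "trig_poly f \<Longrightarrow> trig_poly g \<Longrightarrow> trig_poly (\<lambda>z. f z + g z)"

lemma trig_poly_continuous: "trig_poly f \<Longrightarrow> continuous_on A f"
  by (induction rule: trig_poly.induct)
    (auto intro!: continuous_intros continuous_on_torus_character)

lemma trig_poly_mult_character:
  assumes "trig_poly f" "k \<in> int_lattice"
  shows "trig_poly (\<lambda>z. f z * (c * torus_character k z))"
  using assms
proof (induction rule: trig_poly.induct)
  case (character l d)
  then have "trig_poly (\<lambda>z. (d * c) * torus_character (l + k) z)"
    by (intro trig_poly.character int_lattice_add)
  then show ?case by (simp add: torus_character_add mult_ac)
next
  case (add f g)
  then show ?case by (simp add: distrib_right trig_poly.add)
qed

lemma trig_poly_mult:
  assumes "trig_poly f" "trig_poly g"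
  shows "trig_poly (\<lambda>z. f z * g z)"
  using assms(2,1)
proof (induction rule: trig_poly.induct)
  case (character k c)
  then show ?case by (intro trig_poly_mult_character)
next
  case (add g h)
  then show ?case by (simp add: distrib_left trig_poly.add)
qed

text \<open>Stone-Weierstrass for the algebra of real functions whose complexification is a
  trigonometric polynomial, applied to real and imaginary parts separately.\<close>

lemma trig_poly_dense:
  fixes f :: "'d::finite torus \<Rightarrow> complex"
  assumes "continuous_on UNIV f" "e > 0"
  shows "\<exists>g. trig_poly g \<and> (\<forall>z. norm (f z - g z) < e)"
proof -
  have scaled: "trig_poly (\<lambda>z. \<i> * g z)" if "trig_poly g" for g :: "'d torus \<Rightarrow> complex"
  proof -
    have "trig_poly (\<lambda>z. g z * (\<i> * torus_character 0 z))"
      using that int_lattice_0 by (rule trig_poly_mult_character)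
    then show ?thesis by (simp add: mult.commute)
  qed
  have real: "\<exists>g. trig_poly (\<lambda>z. of_real (g z)) \<and> (\<forall>z\<in>UNIV. \<bar>f z - g z\<bar> < e)"
    if "continuous_on UNIV f" "e > 0" for f :: "'d torus \<Rightarrow> real" and e
  proof (rule Stone_Weierstrass_HOL[OF compact_torus _ _ _ _ _ that])
    fix c :: real
    have "trig_poly (\<lambda>z :: 'd torus. of_real c * torus_character 0 z)"
      by (rule trig_poly.character) (rule int_lattice_0)
    then show "trig_poly (\<lambda>z :: 'd torus. of_real c)" by simp
  next
    fix f :: "'d torus \<Rightarrow> real"
    assume "trig_poly (\<lambda>z. of_real (f z))"
    then have "continuous_on UNIV (\<lambda>z. Re (of_real (f z)))"
      by (intro continuous_intros trig_poly_continuous)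
    then show "continuous_on UNIV f" by simp
  next
    fix f g :: "'d torus \<Rightarrow> real"
    assume "trig_poly (\<lambda>z. of_real (f z)) \<and> trig_poly (\<lambda>z. of_real (g z))"
    then show "trig_poly (\<lambda>z. of_real (f z + g z))" "trig_poly (\<lambda>z. of_real (f z * g z))"
      by (auto intro: trig_poly.add trig_poly_mult)
  next
    fix z w :: "'d torus"
    assume "z \<in> UNIV \<and> w \<in> UNIV \<and> z \<noteq> w"
    let ?x = "rep_torus z" and ?y = "rep_torus w"
    have "torus_proj ?x \<noteq> torus_proj ?y" using \<open>_ \<and> _ \<and> z \<noteq> w\<close> by simp
    then have "?x - ?y \<notin> int_lattice" unfolding torus.abs_eq_iff .
    then obtain i where i: "?x $ i - ?y $ i \<notin> \<int>" by (auto simp: int_lattice_def)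
    \<comment> \<open>Some coordinate of the difference is not an integer, and the character of that
      coordinate separates the two points.\<close>
    let ?k = "axis i 1 :: real ^ 'd"
    have k: "?k \<in> int_lattice" by (simp add: int_lattice_def axis_def)
    have "torus_character ?k z \<noteq> torus_character ?k w"
    proof
      assume "torus_character ?k z = torus_character ?k w"
      then have "character ?k (?x - ?y) * character ?k ?y = 1 * character ?k ?y"
        by (simp add: torus_character_def flip: character_add_right)
      then have "character ?k (?x - ?y) = 1" by (metis mult_right_cancel norm_character norm_zero zero_neq_one)
      then have "cos (2 * pi * (?x $ i - ?y $ i)) = 1"
        by (simp add: character_def inner_axis' complex_eq_iff)
      then obtain n where "2 * pi * (?x $ i - ?y $ i) = of_int n * 2 * pi"
        by (auto simp: cos_one_2pi_int)
      then have "?x $ i - ?y $ i = of_int n" by simp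
      with i show False by simp
    qed
    \<comment> \<open>Conjugation replaces k by - k, so the real and imaginary parts of a character
      lie in the algebra, and at least one of them differs at the two points.\<close>
    moreover have re: "of_real (Re (torus_character ?k z)) =
        1 / 2 * torus_character ?k z + 1 / 2 * torus_character (- ?k) z" for z :: "'d torus"
      by (simp add: cnj_torus_character[symmetric] complex_eq_iff)
    moreover have im: "of_real (Im (torus_character ?k z)) =
        (- \<i> / 2) * torus_character ?k z + (\<i> / 2) * torus_character (- ?k) z" for z :: "'d torus"
      by (simp add: cnj_torus_character[symmetric] complex_eq_iff)
    have "trig_poly (\<lambda>z. complex_of_real (Re (torus_character ?k z)))"
      unfolding re by (intro trig_poly.intros int_lattice_minus k)
    moreover have "trig_poly (\<lambda>z. complex_of_real (Im (torus_character ?k z)))"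
      unfolding im by (intro trig_poly.intros int_lattice_minus k)
    ultimately show "\<exists>f. trig_poly (\<lambda>z. complex_of_real (f z)) \<and> f z \<noteq> f w"
      by (metis complex_eqI)
  qed
  have "continuous_on UNIV (\<lambda>z. Re (f z))" "continuous_on UNIV (\<lambda>z. Im (f z))"
    using assms(1) by (auto intro!: continuous_intros)
  then obtain g h where g: "trig_poly (\<lambda>z. of_real (g z))" "\<forall>z\<in>UNIV. \<bar>Re (f z) - g z\<bar> < e / 2"
    and h: "trig_poly (\<lambda>z. of_real (h z))" "\<forall>z\<in>UNIV. \<bar>Im (f z) - h z\<bar> < e / 2"
    using real[of "\<lambda>z. Re (f z)" "e / 2"] real[of "\<lambda>z. Im (f z)" "e / 2"] assms(2) by auto
  let ?g = "\<lambda>z. of_real (g z) + \<i> * of_real (h z) :: complex"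
  have "trig_poly ?g" by (intro trig_poly.add scaled g h)
  moreover have "norm (f z - ?g z) < e" for z
  proof -
    have "\<bar>Re (f z) - g z\<bar> < e / 2" "\<bar>Im (f z) - h z\<bar> < e / 2" using g(2) h(2) by blast+
    moreover have "norm (f z - ?g z) \<le> \<bar>Re (f z) - g z\<bar> + \<bar>Im (f z) - h z\<bar>"
      using cmod_le[of "f z - ?g z"] by simp
    ultimately show ?thesis by simp
  qed
  ultimately show ?thesis by blast
qed


section \<open>Equidistribution\<close>

abbreviation unit_cube :: "(real ^ 'd) measure" where
  "unit_cube \<equiv> restrict_space lborel (cbox 0 1)"

lemma emeasure_unit_cube: "emeasure (unit_cube :: (real ^ 'd) measure) (space unit_cube) = 1"
proof -
  have "(1 :: real ^ 'd) \<bullet> b = 1" if "b \<in> Basis" for b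
    using that by (auto simp: Basis_vec_def inner_axis)
  then have "emeasure lborel (cbox 0 (1 :: real ^ 'd)) = 1"
    by (simp add: emeasure_lborel_cbox_eq)
  then show ?thesis by (simp add: emeasure_restrict_space space_restrict_space)
qed

lemma finite_measure_unit_cube: "finite_measure (unit_cube :: (real ^ 'd) measure)"
  by (rule finite_measureI) (subst emeasure_unit_cube, simp)

lemma measurable_unit_cube: "f \<in> borel_measurable borel \<Longrightarrow> f \<in> borel_measurable unit_cube"
  by (intro measurable_restrict_space1) simp

section \<open>Orthogonality of characters and averages along almost every orbit\<close>

lemma integral_cis_unit_interval:
  assumes "m \<in> \<int>" "m \<noteq> 0"
  shows "(LBINT t. indicator {0..1} t *\<^sub>R cis (2 * pi * m * t)) = 0"
proof -
  define w where "w = \<i> * complex_of_real (2 * pi * m)"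
  have "w \<noteq> 0" using assms(2) by (simp add: w_def)
  have cis: "cis (2 * pi * m * t) = exp (t *\<^sub>R w)" for t
    by (simp add: cis_conv_exp w_def scaleR_conv_of_real mult_ac)
  have "(LBINT t. indicator {0..1} t *\<^sub>R exp (t *\<^sub>R w))
      = exp (1 *\<^sub>R w) / w - exp (0 *\<^sub>R w) / w"
  proof (rule integral_FTC_Icc)
    fix t :: real
    have "((\<lambda>t. exp (t *\<^sub>R w) * inverse w) has_vector_derivative exp (t *\<^sub>R w) * w * inverse w)
        (at t within {0..1})"
      by (intro has_vector_derivative_mult_left exp_scaleR_has_vector_derivative_right)
    then show "((\<lambda>t. exp (t *\<^sub>R w) / w) has_vector_derivative exp (t *\<^sub>R w)) (at t within {0..1})"
      using \<open>w \<noteq> 0\<close> by (simp add: divide_inverse mult.assoc)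
  qed (auto intro!: continuous_intros)
  also have "exp (1 *\<^sub>R w) = 1"
  proof -
    obtain n where n: "m = of_int n" using assms(1) by (auto elim: Ints_cases)
    show ?thesis using cis[of 1] by (simp add: n cis_multiple_2pi)
  qed
  finally show ?thesis by (simp add: cis)
qed

text \<open>Both the character and the indicator of the cube are products over the coordinates, so
  the integral is a product of one-dimensional ones; a nonzero coordinate of k makes one factor an
  integral over full periods.\<close>

lemma character_integral_zero:
  fixes k :: "real ^ 'd"
  assumes "k \<in> int_lattice" "k \<noteq> 0"
  shows "(\<integral>x. character k x \<partial>unit_cube) = 0"
proof -
  define g where "g b t = indicator {0..1} t *\<^sub>R cis (2 * pi * (k \<bullet> b) * t)" for b and t :: real
  have g_int: "integrable lborel (g b)" for b
    unfolding g_def by (rule borel_integrable_compact) (auto intro!: continuous_intros simp: cis_conv_exp)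
  have prod: "indicator (cbox 0 1) x *\<^sub>R character k x = (\<Prod>b\<in>Basis. g b (x \<bullet> b))" for x
  proof -
    have one: "(1 :: real ^ 'd) \<bullet> b = 1" if "b \<in> Basis" for b
      using that by (auto simp: Basis_vec_def inner_axis)
    have "character k x = (\<Prod>b\<in>Basis. cis (2 * pi * (k \<bullet> b) * (x \<bullet> b)))"
    proof -
      have "2 * pi * (k \<bullet> x) = (\<Sum>b\<in>Basis. 2 * pi * (k \<bullet> b) * (x \<bullet> b))"
        by (simp add: euclidean_inner[of k x] sum_distrib_left mult.assoc)
      moreover have "cis (sum f S) = (\<Prod>b\<in>S. cis (f b))" if "finite S" for f and S :: "(real ^ 'd) set"
        using that by (induction S) (simp_all add: cis_mult[symmetric])
      ultimately show ?thesis by (simp add: character_def)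
    qed
    moreover have "indicator (cbox 0 1) x = (\<Prod>b\<in>Basis. indicator {0..1} (x \<bullet> b) :: real)"
      by (auto simp: indicator_def mem_box one)
    ultimately show ?thesis
      by (simp add: g_def scaleR_conv_of_real prod.distrib)
  qed
  have "(\<integral>x. character k x \<partial>unit_cube) = (\<integral>x. (\<Prod>b\<in>Basis. g b (x \<bullet> b)) \<partial>lborel)"
    by (subst integral_restrict_space) (simp_all add: prod)
  also have "\<dots> = (\<integral>f. (\<Prod>b\<in>Basis. g b ((\<Sum>b\<in>Basis. f b *\<^sub>R b) \<bullet> b)) \<partial>Pi\<^sub>M Basis (\<lambda>b :: real ^ 'd. lborel))"
  proof (subst lborel_eq, rule integral_distr)
    have [measurable]: "g b \<in> borel_measurable borel" for b
      using g_int[of b] borel_measurable_integrable by fastforce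
    show "(\<lambda>x :: real ^ 'd. \<Prod>b\<in>Basis. g b (x \<bullet> b)) \<in> borel_measurable borel" by measurable
  qed measurable
  also have "\<dots> = (\<integral>f. (\<Prod>b\<in>Basis. g b (f b)) \<partial>Pi\<^sub>M Basis (\<lambda>b :: real ^ 'd. lborel))"
    by (intro Bochner_Integration.integral_cong refl prod.cong) (simp add: inner_sum_left_Basis)
  also have "\<dots> = (\<Prod>b\<in>Basis. \<integral>t. g b t \<partial>lborel)"
  proof -
    interpret product_sigma_finite "\<lambda>b :: real ^ 'd. lborel :: real measure"
      by unfold_locales
    show ?thesis by (intro product_integral_prod g_int) simp
  qed
  also have "\<dots> = 0"
  proof -
    obtain i where i: "k $ i \<noteq> 0" using assms(2) by (auto simp: vec_eq_iff)
    have "k \<bullet> axis i 1 \<in> \<int>" using assms(1) by (simp add: inner_axis int_lattice_def)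
    moreover have "k \<bullet> axis i 1 \<noteq> 0" using i by (simp add: inner_axis)
    ultimately have "(\<integral>t. g (axis i 1) t \<partial>lborel) = 0"
      unfolding g_def by (rule integral_cis_unit_interval)
    moreover have "axis i 1 \<in> (Basis :: (real ^ 'd) set)" by (simp add: axis_in_Basis_iff)
    ultimately show ?thesis by (metis finite_Basis prod_zero)
  qed
  finally show ?thesis .
qed

lemma integrable_unit_cube:
  fixes f :: "real ^ 'd \<Rightarrow> 'b::{banach, second_countable_topology}"
  assumes "f \<in> borel_measurable borel" "\<And>x. norm (f x) \<le> B"
  shows "integrable unit_cube f"
  by (rule finite_measure.integrable_const_bound[OF finite_measure_unit_cube])
    (auto intro: measurable_unit_cube assms)

lemma integral_unit_cube_const: "(\<integral>x. c \<partial>(unit_cube :: (real ^ 'd) measure)) = (c :: complex)"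
proof -
  have "measure (unit_cube :: (real ^ 'd) measure) (space unit_cube) = 1"
    by (simp only: measure_def emeasure_unit_cube) simp
  then show ?thesis by (simp only: lebesgue_integral_const) simp
qed

text \<open>After expansion only the pairs with n = m survive, since by injectivity all others are
  characters of nonzero lattice vectors.\<close>

lemma second_moment_characters:
  fixes k :: "nat \<Rightarrow> real ^ 'd"
  assumes "inj k" "\<And>n. k n \<in> int_lattice"
  shows "(\<integral>\<^sup>+x. ennreal ((norm (\<Sum>n<N. character (k n) x))\<^sup>2) \<partial>unit_cube) = ennreal (real N)"
proof -
  let ?S = "\<lambda>x. \<Sum>n<N. character (k n) x"
  have S_le: "norm (?S x) \<le> real N" for x
    using sum_norm_le[of "{..<N}" "\<lambda>n. character (k n) x" "\<lambda>_. 1"] by simp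
  have S_meas: "?S \<in> borel_measurable borel" by measurable
  have int: "integrable unit_cube (\<lambda>x. (norm (?S x))\<^sup>2)"
  proof (rule integrable_unit_cube[of _ "(real N)\<^sup>2"])
    show "(\<lambda>x. (norm (?S x))\<^sup>2) \<in> borel_measurable borel" by measurable
    show "norm ((norm (?S x))\<^sup>2) \<le> (real N)\<^sup>2" for x
      using power_mono[OF S_le norm_ge_zero, of x 2] by simp
  qed
  have "complex_of_real (\<integral>x. (norm (?S x))\<^sup>2 \<partial>unit_cube)
      = (\<integral>x. complex_of_real ((norm (?S x))\<^sup>2) \<partial>unit_cube)"
    by (rule integral_complex_of_real[symmetric])
  also have "\<dots> = (\<integral>x. (\<Sum>n<N. \<Sum>m<N. character (k n - k m) x) \<partial>unit_cube)"
  proof (intro Bochner_Integration.integral_cong refl)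
    fix x
    show "complex_of_real ((norm (?S x))\<^sup>2) = (\<Sum>n<N. \<Sum>m<N. character (k n - k m) x)"
      by (simp only: complex_norm_square cnj_sum sum_product cnj_character diff_conv_add_uminus
          character_add_left)
  qed
  also have "\<dots> = (\<Sum>n<N. \<Sum>m<N. \<integral>x. character (k n - k m) x \<partial>unit_cube)"
    by (subst Bochner_Integration.integral_sum,
        auto intro!: Bochner_Integration.integrable_sum Bochner_Integration.integral_sum sum.cong
          integrable_unit_cube[of _ 1])
  also have "\<dots> = (\<Sum>n<N. \<Sum>m<N. if n = m then 1 else 0)"
  proof (intro sum.cong refl)
    fix n m
    have "(\<integral>x. character (k n - k m) x \<partial>unit_cube) = 0" if "n \<noteq> m"
      using that assms by (intro character_integral_zero int_lattice_diff) (auto simp: inj_eq)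
    then show "(\<integral>x. character (k n - k m) x \<partial>unit_cube) = (if n = m then 1 else 0)"
    proof (cases "n = m")
      case True
      have "character (k n - k m) = (\<lambda>x. 1)" using True by (intro ext) simp
      then show ?thesis using True by (simp only: integral_unit_cube_const) simp
    qed simp
  qed
  also have "\<dots> = of_real (real N)" by simp
  finally have "(\<integral>x. (norm (?S x))\<^sup>2 \<partial>unit_cube) = real N" by (simp only: of_real_eq_iff)
  then show ?thesis using nn_integral_eq_integral[OF int] by simp
qed

text \<open>The average over (j+1)^2 terms has second moment 1/(j+1)^2, which is summable, so it
  tends to 0 almost everywhere along squares; the other lengths are interpolated. Orthogonality thus
  does the work of an ergodic theorem.\<close>

lemma AE_character_averages:
  fixes k :: "nat \<Rightarrow> real ^ 'd"
  assumes "inj k" "\<And>n. k n \<in> int_lattice"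
  shows "AE x in unit_cube. (\<lambda>N. (\<Sum>n<N. character (k n) x) / of_nat N) \<longlonglongrightarrow> 0"
proof -
  define f where "f j x = (norm ((\<Sum>n<(Suc j)\<^sup>2. character (k n) x) / of_nat ((Suc j)\<^sup>2)))\<^sup>2" for j x
  have f_meas: "(\<lambda>x. ennreal (f j x)) \<in> borel_measurable unit_cube" for j
    unfolding f_def by (rule measurable_unit_cube) measurable
  have f_int: "(\<integral>\<^sup>+x. ennreal (f j x) \<partial>unit_cube) = ennreal (inverse ((real (Suc j))\<^sup>2))" for j
  proof -
    have f_eq: "ennreal (f j x) = ennreal (inverse ((real ((Suc j)\<^sup>2))\<^sup>2)) *
        ennreal ((norm (\<Sum>n<(Suc j)\<^sup>2. character (k n) x))\<^sup>2)" for x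
      unfolding f_def norm_divide norm_of_nat
      by (subst ennreal_mult'[symmetric]) (simp_all add: divide_inverse power_mult_distrib mult.commute power_inverse)
    have meas: "(\<lambda>x. ennreal ((norm (\<Sum>n<(Suc j)\<^sup>2. character (k n) x))\<^sup>2)) \<in> borel_measurable unit_cube"
      by (rule measurable_unit_cube) measurable
    have "(\<integral>\<^sup>+x. ennreal (f j x) \<partial>unit_cube)
        = ennreal (inverse ((real ((Suc j)\<^sup>2))\<^sup>2)) * ennreal (real ((Suc j)\<^sup>2))"
      unfolding f_eq nn_integral_cmult[OF meas] second_moment_characters[OF assms] ..
    also have "\<dots> = ennreal (inverse ((real ((Suc j)\<^sup>2))\<^sup>2) * real ((Suc j)\<^sup>2))"
      by (rule ennreal_mult[symmetric]) simp_all
    also have "inverse ((real ((Suc j)\<^sup>2))\<^sup>2) * real ((Suc j)\<^sup>2) = inverse ((real (Suc j))\<^sup>2)"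
    proof -
      have "inverse ((x\<^sup>2)\<^sup>2) * x\<^sup>2 = inverse (x\<^sup>2)" if "x \<noteq> 0" for x :: real
        using that by (simp add: power2_eq_square field_simps)
      from this[of "real (Suc j)"] show ?thesis by (simp only: of_nat_power)
    qed
    finally show ?thesis .
  qed
  have "(\<integral>\<^sup>+x. (\<Sum>j. ennreal (f j x)) \<partial>unit_cube) = (\<Sum>j. ennreal (inverse ((real (Suc j))\<^sup>2)))"
    by (subst nn_integral_suminf) (simp_all add: f_meas f_int)
  also have "\<dots> \<noteq> \<infinity>"
  proof -
    have "summable (\<lambda>j. inverse ((real (Suc j))\<^sup>2))"
      using inverse_power_summable[of 2, where 'a = real] by (subst summable_Suc_iff) auto
    then have "(\<Sum>j. ennreal (inverse ((real (Suc j))\<^sup>2))) \<noteq> top"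
      by (rule ennreal_suminf_neq_top) simp
    then show ?thesis by (simp add: infinity_ennreal_def)
  qed
  finally have "AE x in unit_cube. (\<Sum>j. ennreal (f j x)) \<noteq> \<infinity>"
    using f_meas by (intro nn_integral_PInf_AE borel_measurable_suminf_order) auto
  then show ?thesis
  proof eventually_elim
    case (elim x)
    have "summable (\<lambda>j. f j x)"
      using elim by (intro summable_suminf_not_top) (auto simp: f_def infinity_ennreal_def)
    then have "(\<lambda>j. f j x) \<longlonglongrightarrow> 0" by (rule summable_LIMSEQ_zero)
    then have "(\<lambda>j. sqrt (f j x)) \<longlonglongrightarrow> sqrt 0" by (intro tendsto_intros)
    then have "(\<lambda>j. norm ((\<Sum>n<(Suc j)\<^sup>2. character (k n) x) / of_nat ((Suc j)\<^sup>2))) \<longlonglongrightarrow> 0"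
      by (simp add: f_def)
    then have "(\<lambda>j. (\<Sum>n<(Suc j)\<^sup>2. character (k n) x) / of_nat ((Suc j)\<^sup>2)) \<longlonglongrightarrow> 0"
      by (rule tendsto_norm_zero_cancel)
    then show ?case by (intro average_tendsto_zero_along_squares) simp_all
  qed
qed

lemma countable_int_lattice: "countable (int_lattice :: (real ^ 'd) set)"
proof -
  have "int_lattice \<subseteq> range (\<lambda>f :: 'd \<Rightarrow> int. \<chi> i. real_of_int (f i))"
  proof
    fix k :: "real ^ 'd" assume "k \<in> int_lattice"
    then have "k = (\<chi> i. real_of_int \<lfloor>k $ i\<rfloor>)"
      by (simp add: int_lattice_def vec_eq_iff)
    then show "k \<in> range (\<lambda>f :: 'd \<Rightarrow> int. \<chi> i. real_of_int (f i))" by (rule range_eqI[where x = "\<lambda>i. \<lfloor>k $ i\<rfloor>"])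
  qed
  then show ?thesis by (rule countable_subset) simp
qed

lemma AE_all_character_averages:
  fixes A :: "int ^ 'd ^ 'd"
  assumes "toral_automorphism A" "quasihyperbolic A"
  shows "AE x in unit_cube. \<forall>k\<in>int_lattice - {0}.
    (\<lambda>N. (\<Sum>n<N. character k ((((*v) (real_mat A)) ^^ n) x)) / of_nat N) \<longlonglongrightarrow> 0"
proof (rule AE_ball_countable')
  fix k :: "real ^ 'd" assume k: "k \<in> int_lattice - {0}"
  let ?k = "\<lambda>n. (((*v) (real_mat (transpose A))) ^^ n) k"
  have "AE x in unit_cube. (\<lambda>N. (\<Sum>n<N. character (?k n) x) / of_nat N) \<longlonglongrightarrow> 0"
    using k assms by (intro AE_character_averages inj_dual_orbit int_lattice_funpow) auto
  then show "AE x in unit_cube.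
      (\<lambda>N. (\<Sum>n<N. character k ((((*v) (real_mat A)) ^^ n) x)) / of_nat N) \<longlonglongrightarrow> 0"
    by (simp add: character_def inner_funpow_adjoint)
qed (simp add: countable_int_lattice)

text \<open>Wiener--Wintner type invariance: the return times of the bounded sequence \<open>A\<^sup>n v\<close> provide
  shifts along which the twist by \<open>v\<close> disappears from the correlations.\<close>

lemma averages_shift_bounded_orbit:
  fixes A :: "int ^ 'd ^ 'd"
  assumes "toral_automorphism A" "quasihyperbolic A" "bounded_orbit (real_mat A) v"
    and avg: "\<And>k. k \<in> int_lattice \<Longrightarrow> k \<noteq> 0 \<Longrightarrow>
      (\<lambda>N. (\<Sum>n<N. character k ((((*v) (real_mat A)) ^^ n) x)) / of_nat N) \<longlonglongrightarrow> 0"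
    and k: "k \<in> int_lattice" "k \<noteq> 0"
  shows "(\<lambda>N. (\<Sum>n<N. character k ((((*v) (real_mat A)) ^^ n) (x + v))) / of_nat N) \<longlonglongrightarrow> 0"
proof (rule van_der_Corput_shifts)
  let ?A = "\<lambda>n. ((*v) (real_mat A)) ^^ n" and ?B = "\<lambda>n. ((*v) (real_mat (transpose A))) ^^ n"
  fix M :: nat and \<epsilon> :: real assume "\<epsilon> > 0"
  \<comment> \<open>One constant for all bounded orbits: it is applied to the vector w below, whose
    smallness at time 0 must persist at all later times.\<close>
  obtain C where "C > 0" and C: "\<And>w n. bounded_orbit (real_mat A) w \<Longrightarrow> norm (?A n w) \<le> C * norm w"
    using bounded_orbit_uniform[of "real_mat A"] by blast
  define D where "D = 2 * pi * norm k * C"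
  \<comment> \<open>Half of \<epsilon> is granted to the twist by w, through
    \<open>D * \<delta>\<close>, and half to the averages of the untwisted character.\<close>
  define \<delta> where "\<delta> = \<epsilon> / (2 * D)"
  have "D > 0" using \<open>C > 0\<close> k by (simp add: D_def)
  then have "\<delta> > 0" and \<delta>: "D * \<delta> = \<epsilon> / 2"
    using \<open>\<epsilon> > 0\<close> by (simp_all add: \<delta>_def)
  obtain h :: "nat \<Rightarrow> nat" where h: "strict_mono h" and close: "\<And>i j. norm (?A (h i) v - ?A (h j) v) < \<delta>"
  proof -
    obtain l r where r: "strict_mono r" and l: "((\<lambda>n. ?A n v) \<circ> r) \<longlonglongrightarrow> l"
      using bounded_imp_convergent_subsequence[of "\<lambda>n. ?A n v"] assms(3)
      unfolding bounded_orbit_def by blast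
    then have "Cauchy ((\<lambda>n. ?A n v) \<circ> r)" by (simp add: LIMSEQ_imp_Cauchy)
    then obtain n0 where n0: "\<forall>i\<ge>n0. \<forall>j\<ge>n0. dist (((\<lambda>n. ?A n v) \<circ> r) i) (((\<lambda>n. ?A n v) \<circ> r) j) < \<delta>"
      using \<open>\<delta> > 0\<close> unfolding Cauchy_def by blast
    show ?thesis
    proof (rule that[of "\<lambda>i. r (n0 + i)"])
      show "strict_mono (\<lambda>i. r (n0 + i))" using r by (simp add: strict_mono_def)
      show "norm (?A (r (n0 + i)) v - ?A (r (n0 + j)) v) < \<delta>" for i j
        using n0[rule_format, of "n0 + i" "n0 + j"] by (simp add: dist_norm)
    qed
  qed
  show "\<exists>h :: nat \<Rightarrow> nat. \<forall>i<M. \<forall>j<M. i \<noteq> j \<longrightarrow> eventually (\<lambda>N.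
      norm (\<Sum>n<N. character k (?A (n + h i) (x + v)) * cnj (character k (?A (n + h j) (x + v))))
        \<le> \<epsilon> * real N) sequentially"
  proof (intro exI[of _ h] allI impI)
    fix i j :: nat assume "i \<noteq> j"
    \<comment> \<open>The correlation of the shifts h i and h j at x + v is the character of index
      k' along the orbit of x, times a factor depending only on w. Injectivity of the dual orbit
      makes k' nonzero, so \<open>avg\<close> applies to it.\<close>
    define k' where "k' = ?B (h i) k - ?B (h j) k"
    define w where "w = ?A (h i) v - ?A (h j) v"
    have "h i \<noteq> h j" using h \<open>i \<noteq> j\<close> by (simp add: strict_mono_eq)
    then have "k' \<noteq> 0" using inj_dual_orbit[OF assms(1,2) k(2)] by (auto simp: k'_def inj_def)
    have "k' \<in> int_lattice" unfolding k'_def by (intro int_lattice_diff int_lattice_funpow k)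
    have w_eq: "?A n w = ?A (n + h i) v - ?A (n + h j) v" for n
      by (simp add: w_def funpow_matrix_diff funpow_add)
    have w_bdd: "bounded_orbit (real_mat A) w"
    proof (rule bounded_orbitI[of _ _ "C * norm v + C * norm v"])
      fix n
      show "norm (?A n w) \<le> C * norm v + C * norm v"
        unfolding w_eq using norm_triangle_ineq4[of "?A (n + h i) v" "?A (n + h j) v"]
          C[OF assms(3), of "n + h i"] C[OF assms(3), of "n + h j"] by linarith
    qed
    have term_eq: "character k (?A (n + h i) (x + v)) * cnj (character k (?A (n + h j) (x + v)))
        = character k' (?A n x) * character k (?A n w)" for n
    proof -
      have inner: "k \<bullet> ?A (n + m) x = ?B m k \<bullet> ?A n x" for m
        unfolding add.commute[of n m] funpow_add comp_apply by (rule inner_funpow_adjoint)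
      have "k \<bullet> ?A (n + h i) (x + v) - k \<bullet> ?A (n + h j) (x + v)
          = k' \<bullet> ?A n x + k \<bullet> ?A n w"
        by (simp only: k'_def w_eq funpow_matrix_add inner_add_right inner_diff_right
            inner_diff_left inner)
      then have "2 * pi * (k \<bullet> ?A (n + h i) (x + v)) + - (2 * pi * (k \<bullet> ?A (n + h j) (x + v)))
          = 2 * pi * (k' \<bullet> ?A n x) + 2 * pi * (k \<bullet> ?A n w)"
        unfolding distrib_left[symmetric] by (simp add: right_diff_distrib[symmetric])
      then show ?thesis by (simp only: character_def cis_cnj cis_mult)
    qed
    have near: "norm (character k (?A n w) - 1) \<le> \<epsilon> / 2" for n
    proof -
      have "norm (character k (?A n w) - 1) \<le> 2 * pi * norm k * norm (?A n w)"
        using norm_character_diff_le[of k "?A n w" 0] by (simp add: character_def)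
      also have "\<dots> \<le> 2 * pi * norm k * (C * \<delta>)"
      proof (rule mult_left_mono)
        have "norm w \<le> \<delta>" using close[of i j] by (simp add: w_def)
        then have "C * norm w \<le> C * \<delta>" using \<open>C > 0\<close> by simp
        with C[OF w_bdd, of n] show "norm (?A n w) \<le> C * \<delta>" by linarith
      qed simp
      finally show ?thesis using \<delta> by (simp add: D_def mult.assoc)
    qed
    have "eventually (\<lambda>N. dist ((\<Sum>n<N. character k' (?A n x)) / of_nat N) 0 < \<epsilon> / 2) sequentially"
      using avg[OF \<open>k' \<in> int_lattice\<close> \<open>k' \<noteq> 0\<close>] \<open>\<epsilon> > 0\<close> by (intro tendstoD) auto
    with eventually_gt_at_top[of 0]
    show "eventually (\<lambda>N. norm (\<Sum>n<N. character k (?A (n + h i) (x + v)) *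
        cnj (character k (?A (n + h j) (x + v)))) \<le> \<epsilon> * real N) sequentially"
    proof eventually_elim
      case (elim N)
      have "(\<Sum>n<N. character k (?A (n + h i) (x + v)) * cnj (character k (?A (n + h j) (x + v))))
          = (\<Sum>n<N. character k' (?A n x)) + (\<Sum>n<N. character k' (?A n x) * (character k (?A n w) - 1))"
        unfolding term_eq by (simp add: right_diff_distrib sum_subtractf)
      moreover have "norm (\<Sum>n<N. character k' (?A n x)) \<le> \<epsilon> / 2 * real N"
        using elim by (simp add: norm_divide field_simps)
      moreover have "norm (\<Sum>n<N. character k' (?A n x) * (character k (?A n w) - 1)) \<le> (\<Sum>n<N. \<epsilon> / 2)"
        by (rule sum_norm_le) (simp only: norm_mult norm_character mult_1 near)
      ultimately show ?case
        using norm_triangle_ineq[of "\<Sum>n<N. character k' (?A n x)"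
            "\<Sum>n<N. character k' (?A n x) * (character k (?A n w) - 1)"] by (simp add: mult.commute)
    qed
  qed
qed simp

section \<open>Haar integrals and the Weyl criterion\<close>

lemma torus_character_haar_integral:
  assumes "k \<in> int_lattice" "k \<noteq> 0"
  shows "integral\<^sup>L haar_torus (torus_character k) = 0"
proof -
  have "integral\<^sup>L haar_torus (torus_character k)
      = (\<integral>x. torus_character k (torus_proj x) \<partial>unit_cube)"
    unfolding haar_torus_def
    by (rule integral_distr)
      (auto intro: measurable_unit_cube borel_measurable_continuous_onI
        continuous_on_torus_character[OF assms(1)])
  then show ?thesis by (simp add: torus_character_proj assms character_integral_zero)
qed

lemma finite_measure_haar_torus: "finite_measure (haar_torus :: 'd::finite torus measure)"
  by (rule finite_measureI) (simp add: space_haar_torus emeasure_haar_torus_UNIV)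

lemma integrable_haar_torus:
  fixes f :: "'d::finite torus \<Rightarrow> complex"
  assumes "continuous_on UNIV f"
  shows "integrable haar_torus f"
proof -
  have "bounded (f ` UNIV)"
    by (intro compact_imp_bounded compact_continuous_image assms compact_torus)
  then obtain B where "\<And>z. norm (f z) \<le> B" by (auto simp: bounded_iff)
  moreover have "f \<in> borel_measurable haar_torus"
    using borel_measurable_continuous_onI[OF assms] by (simp add: haar_torus_def)
  ultimately show ?thesis
    by (intro finite_measure.integrable_const_bound[OF finite_measure_haar_torus]) auto
qed

lemma haar_torus_integral_const: "(\<integral>z. c \<partial>(haar_torus :: 'd::finite torus measure)) = (c :: complex)"
  by (simp add: measure_def space_haar_torus emeasure_haar_torus_UNIV)

lemma Weyl_criterion:
  fixes F :: "'d::finite torus \<Rightarrow> 'd torus"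
  assumes avg: "\<And>k. k \<in> int_lattice \<Longrightarrow> k \<noteq> 0 \<Longrightarrow>
      (\<lambda>N. (\<Sum>n<N. torus_character k ((F ^^ n) z)) / of_nat N) \<longlonglongrightarrow> 0"
  shows "z \<in> equidistributed_points F"
  unfolding equidistributed_points_def mem_Collect_eq
proof (intro allI impI)
  have trig: "(\<lambda>N. (\<Sum>n<N. g ((F ^^ n) z)) / of_nat N) \<longlonglongrightarrow> integral\<^sup>L haar_torus g"
    if "trig_poly g" for g
    using that
  proof (induction rule: trig_poly.induct)
    case (character k c)
    have "(\<lambda>N. c * ((\<Sum>n<N. torus_character k ((F ^^ n) z)) / of_nat N))
        \<longlonglongrightarrow> c * integral\<^sup>L haar_torus (torus_character k)"
    proof (rule tendsto_mult_left, cases "k = 0")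
      case False
      then show "(\<lambda>N. (\<Sum>n<N. torus_character k ((F ^^ n) z)) / of_nat N)
          \<longlonglongrightarrow> integral\<^sup>L haar_torus (torus_character k)"
        using avg character by (simp add: torus_character_haar_integral)
    next
      case True
      have "integral\<^sup>L haar_torus (torus_character 0 :: 'd torus \<Rightarrow> complex) = 1"
      proof -
        have "(torus_character 0 :: 'd torus \<Rightarrow> complex) = (\<lambda>z. 1)" by (rule ext) simp
        then show ?thesis by (simp only: haar_torus_integral_const)
      qed
      \<comment> \<open>For N = 0 the quotient is 0, so the identity holds only eventually.\<close>
      moreover have "eventually (\<lambda>N. 1 = (\<Sum>n<N. torus_character 0 ((F ^^ n) z)) / of_nat N) sequentially"
        using eventually_gt_at_top[of 0] by eventually_elim simp
      ultimately show "(\<lambda>N. (\<Sum>n<N. torus_character k ((F ^^ n) z)) / of_nat N)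
          \<longlonglongrightarrow> integral\<^sup>L haar_torus (torus_character k)"
        unfolding True by (auto intro: Lim_transform_eventually[OF tendsto_const])
    qed
    then show ?case by (simp add: sum_distrib_left)
  next
    case (add f g)
    have "integrable haar_torus f" "integrable haar_torus g"
      by (intro integrable_haar_torus trig_poly_continuous add)+
    then show ?case
      using tendsto_add[OF add.IH] by (simp add: sum.distrib add_divide_distrib)
  qed
  fix f :: "'d torus \<Rightarrow> complex"
  assume f: "continuous_on UNIV f"
  show "(\<lambda>N. (\<Sum>n<N. f ((F ^^ n) z)) / of_nat N) \<longlonglongrightarrow> integral\<^sup>L haar_torus f"
  proof (rule tendstoI)
    fix e :: real assume "e > 0"
    then obtain g where g: "trig_poly g" "\<And>w. norm (f w - g w) < e / 3"
      using trig_poly_dense[OF f, of "e / 3"] by auto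
    have int_g: "integrable haar_torus g" by (intro integrable_haar_torus trig_poly_continuous g)
    have int_f: "integrable haar_torus f" by (rule integrable_haar_torus[OF f])
    have I: "norm (integral\<^sup>L haar_torus f - integral\<^sup>L haar_torus g) \<le> e / 3"
    proof -
      have "norm (\<integral>w. f w - g w \<partial>haar_torus) \<le> (\<integral>w. norm (f w - g w) \<partial>haar_torus)"
        by (rule integral_norm_bound)
      also have "\<dots> \<le> (\<integral>w. e / 3 \<partial>(haar_torus :: 'd torus measure))"
        using int_f int_g g(2)
        by (intro integral_mono finite_measure.integrable_const[OF finite_measure_haar_torus])
          (auto intro: less_imp_le)
      also have "\<dots> = e / 3" by (simp add: measure_def space_haar_torus emeasure_haar_torus_UNIV)
      finally show ?thesis using int_f int_g by simp
    qed
    have "eventually (\<lambda>N. dist ((\<Sum>n<N. g ((F ^^ n) z)) / of_nat N) (integral\<^sup>L haar_torus g) < e / 3) sequentially"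
      using trig[OF g(1)] \<open>e > 0\<close> by (intro tendstoD) auto
    with eventually_gt_at_top[of 0]
    show "eventually (\<lambda>N. dist ((\<Sum>n<N. f ((F ^^ n) z)) / of_nat N) (integral\<^sup>L haar_torus f) < e) sequentially"
    proof eventually_elim
      case (elim N)
      have "norm ((\<Sum>n<N. f ((F ^^ n) z)) - (\<Sum>n<N. g ((F ^^ n) z))) \<le> (\<Sum>n<N. e / 3)"
        unfolding sum_subtractf[symmetric] by (intro sum_norm_le less_imp_le g(2))
      then have "dist ((\<Sum>n<N. f ((F ^^ n) z)) / of_nat N) ((\<Sum>n<N. g ((F ^^ n) z)) / of_nat N) \<le> e / 3"
        using elim(1) by (simp add: dist_norm norm_divide field_simps flip: diff_divide_distrib)
      moreover have "dist (integral\<^sup>L haar_torus g) (integral\<^sup>L haar_torus f) \<le> e / 3"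
        using I by (simp add: dist_norm norm_minus_commute)
      ultimately show ?case using elim(2)
        using dist_triangle[of "(\<Sum>n<N. f ((F ^^ n) z)) / of_nat N" "integral\<^sup>L haar_torus f"
            "(\<Sum>n<N. g ((F ^^ n) z)) / of_nat N"]
          dist_triangle[of "(\<Sum>n<N. g ((F ^^ n) z)) / of_nat N" "integral\<^sup>L haar_torus f"
            "integral\<^sup>L haar_torus g"] by linarith
    qed
  qed
qed

text \<open>The null set is the one on which some character average of x fails. Each shift by t u
  preserves convergence without exception, so the same x serves all t at once.\<close>

lemma AE_line_equidistributed:
  fixes A :: "int ^ 'd ^ 'd"
  assumes "toral_automorphism A" "quasihyperbolic A" "bounded_orbit (real_mat A) u"
  shows "AE x in unit_cube. \<forall>t. torus_proj (x + t *\<^sub>R u) \<in> equidistributed_points (torus_map A)"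
  using AE_all_character_averages[OF assms(1,2)]
proof eventually_elim
  case (elim x)
  have scale: "bounded_orbit (real_mat A) (t *\<^sub>R u)" for t
    using bounded_orbit_scaleR[OF assms(3)] .
  show ?case
  proof (intro allI Weyl_criterion)
    fix t and k :: "real ^ 'd" assume k: "k \<in> int_lattice" "k \<noteq> 0"
    have "(\<lambda>N. (\<Sum>n<N. character k ((((*v) (real_mat A)) ^^ n) (x + t *\<^sub>R u))) / of_nat N) \<longlonglongrightarrow> 0"
      by (rule averages_shift_bounded_orbit[OF assms(1,2) scale _ k]) (use elim in blast)
    then show "(\<lambda>N. (\<Sum>n<N. torus_character k ((torus_map A ^^ n) (torus_proj (x + t *\<^sub>R u)))) / of_nat N) \<longlonglongrightarrow> 0"
      by (simp add: torus_map_funpow torus_character_proj k)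
  qed
qed


section \<open>Hausdorff measure on the torus\<close>

text \<open>Prepares a cover for \<open>uncoverable\<close>, which asks for positive sizes: small
  diameters are enlarged slightly, and the exponent is raised from s to s' > 0, at no cost because
  the diameters are at most 1. This also covers s = 0.\<close>

lemma hausdorff_outer_measure_zero_cover:
  assumes zero: "hausdorff_outer_measure s A = 0" and "0 \<le> s" "s \<le> s'" "0 < s'" "0 < \<epsilon>"
  shows "\<exists>(U :: nat \<Rightarrow> 'a::metric_space set) l. A \<subseteq> (\<Union>i. U i) \<and> (\<forall>i. 0 < l i \<and> l i \<le> 1) \<and>
    (\<forall>i. \<forall>x\<in>U i. \<forall>y\<in>U i. dist x y \<le> l i) \<and> (\<Sum>i. ennreal (l i powr s')) < ennreal \<epsilon>"
proof -
  have "hausdorff_premeasure s 1 A \<le> hausdorff_outer_measure s A"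
    unfolding hausdorff_outer_measure_def by (rule SUP_upper) simp
  also have "\<dots> < ennreal (\<epsilon> / 2)" using assms by simp
  finally obtain U :: "nat \<Rightarrow> 'a set" where U: "A \<subseteq> (\<Union>i. U i)" "\<And>i. bounded (U i)"
      "\<And>i. diameter (U i) \<le> 1" "(\<Sum>i. hausdorff_gauge s (U i)) < ennreal (\<epsilon> / 2)"
    unfolding hausdorff_premeasure_def INF_less_iff by blast
  \<comment> \<open>Padding the i-th size from below by \<open>e i powr (1 / s')\<close> costs e i
    after raising to the power s', in total at most \<epsilon> / 2; the cap 1 keeps the sizes at
    most 1.\<close>
  define e where "e i = min 1 (\<epsilon> / 2 * (1 / 2) ^ Suc i)" for i :: nat
  have e: "0 < e i" "e i \<le> 1" for i using \<open>0 < \<epsilon>\<close> by (simp_all add: e_def)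
  define l where "l i = max (diameter (U i)) (e i powr (1 / s'))" for i
  have "0 < l i" for i using e(1)[of i] by (simp add: l_def less_max_iff_disj)
  moreover have "l i \<le> 1" for i
    using e[of i] U(3)[of i] powr_mono2[of "1 / s'" "e i" 1] \<open>0 < s'\<close> by (simp add: l_def)
  moreover have "dist x y \<le> l i" if "x \<in> U i" "y \<in> U i" for i x y
    using diameter_bounded_bound[OF U(2) that] by (simp add: l_def)
  moreover have "(\<Sum>i. ennreal (l i powr s')) < ennreal \<epsilon>"
  proof -
    have le: "ennreal (l i powr s') \<le> hausdorff_gauge s (U i) + ennreal (\<epsilon> / 2 * (1 / 2) ^ Suc i)" for i
    proof -
      have diam: "0 \<le> diameter (U i)" using U(2) by (rule diameter_ge_0)
      have "l i powr s' \<le> diameter (U i) powr s' + (e i powr (1 / s')) powr s'"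
        by (simp add: l_def max_def)
      also have "(e i powr (1 / s')) powr s' = e i" using \<open>0 < s'\<close> e(1)[of i] by (simp add: powr_powr)
      also have "e i \<le> \<epsilon> / 2 * (1 / 2) ^ Suc i" by (simp add: e_def)
      finally have "ennreal (l i powr s')
          \<le> ennreal (diameter (U i) powr s' + \<epsilon> / 2 * (1 / 2) ^ Suc i)"
        by (intro ennreal_leI) simp
      also have "\<dots> = ennreal (diameter (U i) powr s') + ennreal (\<epsilon> / 2 * (1 / 2) ^ Suc i)"
        using \<open>0 < \<epsilon>\<close> by (intro ennreal_plus) auto
      also have "ennreal (diameter (U i) powr s') \<le> hausdorff_gauge s (U i)"
      proof -
        have "diameter (U i) powr s' \<le> 1"
          using powr_mono2[of s' "diameter (U i)" 1] U(3) diam \<open>0 < s'\<close> by simp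
        moreover have "diameter (U i) powr s' \<le> diameter (U i) powr s"
          using \<open>s \<le> s'\<close> diam U(3) by (intro powr_mono') auto
        ultimately show ?thesis
          by (auto simp: hausdorff_gauge_def diameter_empty intro: ennreal_leI ennreal_le_1[THEN iffD2])
      qed
      finally show ?thesis by (simp add: add_right_mono)
    qed
    have geo: "(\<Sum>i. ennreal (\<epsilon> / 2 * (1 / 2) ^ Suc i)) = ennreal (\<epsilon> / 2)"
    proof (rule suminf_ennreal_eq)
      show "(\<lambda>i. \<epsilon> / 2 * (1 / 2) ^ Suc i) sums (\<epsilon> / 2)"
        using sums_mult[OF power_half_series, of "\<epsilon> / 2"] by simp
    qed (use \<open>0 < \<epsilon>\<close> in simp)
    have "(\<Sum>i. ennreal (l i powr s'))
        \<le> (\<Sum>i. hausdorff_gauge s (U i) + ennreal (\<epsilon> / 2 * (1 / 2) ^ Suc i))"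
      by (intro suminf_le le summableI)
    also have "\<dots> = (\<Sum>i. hausdorff_gauge s (U i)) + (\<Sum>i. ennreal (\<epsilon> / 2 * (1 / 2) ^ Suc i))"
      by (intro suminf_add[symmetric] summableI)
    also have "\<dots> < ennreal (\<epsilon> / 2) + ennreal (\<epsilon> / 2)"
      unfolding geo using U(4) by (subst add.commute, subst (2) add.commute) (rule ennreal_add_left_cancel_less[THEN iffD2], simp)
    also have "\<dots> = ennreal \<epsilon>" using \<open>0 < \<epsilon>\<close> by (simp flip: ennreal_plus)
    finally show ?thesis .
  qed
  ultimately show ?thesis using U(1) by blast
qed

section \<open>Upper bound for the dimension\<close>

lemma hausdorff_premeasure_le_finite_cover:
  fixes \<V> :: "'a::metric_space set set"
  assumes "A \<subseteq> \<Union>\<V>" "finite \<V>" "0 < s"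
    and diam: "\<And>V x y. V \<in> \<V> \<Longrightarrow> x \<in> V \<Longrightarrow> y \<in> V \<Longrightarrow> dist x y \<le> r" and "0 \<le> r" "r \<le> \<delta>"
  shows "hausdorff_premeasure s \<delta> A \<le> ennreal (real (card \<V>) * r powr s)"
proof -
  obtain h where h: "bij_betw h {0..<card \<V>} \<V>" using ex_bij_betw_nat_finite[OF assms(2)] by blast
  \<comment> \<open>Empty sets extend the finite cover to a sequence for free, as their gauge is
    0.\<close>
  define U where "U i = (if i < card \<V> then h i else {})" for i
  have U: "U i = {} \<or> U i \<in> \<V>" for i using bij_betwE[OF h] by (auto simp: U_def)
  have bdd: "bounded V" if "V \<in> \<V>" for V
    unfolding bounded_two_points using diam[OF that] by blast
  have d: "diameter V \<le> r" if "V \<in> \<V>" for V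
    using diam[OF that] \<open>0 \<le> r\<close> by (auto simp: diameter_def intro!: cSUP_least)
  have d0: "0 \<le> diameter V" if "V \<in> \<V>" for V using bdd[OF that] by (rule diameter_ge_0)
  have "(\<Sum>i. hausdorff_gauge s (U i)) = (\<Sum>i\<in>{..<card \<V>}. hausdorff_gauge s (U i))"
    by (rule suminf_finite) (auto simp: U_def hausdorff_gauge_def)
  also have "\<dots> \<le> (\<Sum>i\<in>{..<card \<V>}. ennreal (r powr s))"
  proof (rule sum_mono)
    fix i
    show "hausdorff_gauge s (U i) \<le> ennreal (r powr s)"
      using U[of i] d[of "U i"] d0[of "U i"] \<open>0 < s\<close>
      by (auto simp: hausdorff_gauge_def intro!: ennreal_leI powr_mono2)
  qed
  also have "\<dots> = ennreal (real (card \<V>) * r powr s)"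
    by (simp add: ennreal_mult ennreal_of_nat_eq_real_of_nat)
  finally have le: "(\<Sum>i. hausdorff_gauge s (U i)) \<le> ennreal (real (card \<V>) * r powr s)" .
  have "A \<subseteq> (\<Union>i. U i)"
  proof
    fix x assume "x \<in> A"
    then obtain V where "V \<in> \<V>" "x \<in> V" using assms(1) by blast
    then obtain i where "i < card \<V>" "h i = V"
      using bij_betw_imp_surj_on[OF h] by (metis (no_types, lifting) atLeastLessThan_iff imageE)
    then have "x \<in> U i" using \<open>x \<in> V\<close> by (simp add: U_def)
    then show "x \<in> (\<Union>i. U i)" by blast
  qed
  moreover have "bounded (U i) \<and> diameter (U i) \<le> \<delta>" for i
  proof (cases "U i = {}")
    case True
    then show ?thesis using \<open>0 \<le> r\<close> \<open>r \<le> \<delta>\<close> by (simp add: diameter_empty)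
  next
    case False
    with U[of i] bdd[of "U i"] d[of "U i"] \<open>r \<le> \<delta>\<close> show ?thesis by simp
  qed
  ultimately have "hausdorff_premeasure s \<delta> A \<le> (\<Sum>i. hausdorff_gauge s (U i))"
    unfolding hausdorff_premeasure_def by (intro INF_lower) blast
  with le show ?thesis by (rule order_trans[rotated])
qed

text \<open>Cut the unit cube into M^d cells. Each has diameter at most d / M by the l1 bound, at
  total cost d^s M^(d - s), which tends to 0 as s > d.\<close>

lemma hausdorff_outer_measure_torus_zero:
  fixes A :: "'d::finite torus set"
  assumes "real CARD('d) < s"
  shows "hausdorff_outer_measure s A = 0"
proof -
  let ?d = "real CARD('d)"
  have "?d > 0" by simp
  then have "s > 0" using assms by linarith
  have le: "hausdorff_premeasure s \<delta> A \<le> ennreal (?d powr s * real M powr (?d - s))"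
    if "M > 0" "?d / real M \<le> \<delta>" for M :: nat and \<delta>
  proof -
    define Q where "Q f = torus_proj ` {x :: real ^ 'd. \<forall>i. real (f i) \<le> real M * x $ i \<and> real M * x $ i \<le> real (f i) + 1}"
      for f :: "'d \<Rightarrow> nat"
    let ?\<V> = "Q ` (UNIV \<rightarrow> {..<M})"
    have fin: "finite (UNIV \<rightarrow> {..<M} :: ('d \<Rightarrow> nat) set)"
      by (metis finite finite_PiE finite_lessThan PiE_UNIV_domain)
    have "card ?\<V> \<le> card (UNIV \<rightarrow> {..<M} :: ('d \<Rightarrow> nat) set)" using fin by (rule card_image_le)
    also have "\<dots> = M ^ CARD('d)"
      using card_PiE[of "UNIV :: 'd set" "\<lambda>_. {..<M}"] by (simp add: PiE_UNIV_domain)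
    finally have card: "real (card ?\<V>) \<le> real M powr ?d"
      using \<open>M > 0\<close> by (simp add: powr_realpow flip: of_nat_power)
    have "hausdorff_premeasure s \<delta> A \<le> ennreal (real (card ?\<V>) * (?d / real M) powr s)"
    proof (rule hausdorff_premeasure_le_finite_cover)
      show "A \<subseteq> \<Union>?\<V>"
      proof
        fix z :: "'d torus"
        let ?x = "rep_torus z"
        let ?y = "(\<chi> i. frac (?x $ i)) :: real ^ 'd"
        have "torus_proj ?y = torus_proj ?x"
          unfolding torus.abs_eq_iff by (simp add: int_lattice_def frac_def)
        then have z: "z = torus_proj ?y" using Quotient_abs_rep[OF Quotient_torus, of z] by simp
        let ?f = "\<lambda>i. nat \<lfloor>real M * frac (?x $ i)\<rfloor>"
        have "?f i < M" for i
        proof -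
          have "real M * frac (?x $ i) < real M * 1"
            using \<open>M > 0\<close> frac_lt_1 by (intro mult_strict_left_mono) auto
          then show ?thesis using \<open>M > 0\<close> by (simp add: nat_less_iff floor_less_iff)
        qed
        then have "?f \<in> UNIV \<rightarrow> {..<M}" by simp
        moreover have "z \<in> Q ?f"
          unfolding Q_def
        proof (subst z, rule imageI, intro CollectI allI)
          fix i
          have "0 \<le> real M * frac (?x $ i)" by simp
          then have "real (?f i) = of_int \<lfloor>real M * frac (?x $ i)\<rfloor>" by simp
          then show "real (?f i) \<le> real M * ?y $ i \<and> real M * ?y $ i \<le> real (?f i) + 1"
            using floor_correct[of "real M * frac (?x $ i)"] by simp
        qed
        ultimately show "z \<in> \<Union>?\<V>" by blast
      qed
    next
      fix V z w assume "V \<in> ?\<V>" "z \<in> V" "w \<in> V"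
      then obtain f :: "'d \<Rightarrow> nat" and x y :: "real ^ 'd" where xy: "z = torus_proj x" "w = torus_proj y"
          "\<And>i. real (f i) \<le> real M * x $ i \<and> real M * x $ i \<le> real (f i) + 1"
          "\<And>i. real (f i) \<le> real M * y $ i \<and> real M * y $ i \<le> real (f i) + 1"
        by (auto simp: Q_def)
      have "\<bar>(x - y) $ i\<bar> \<le> 1 / real M" for i
      proof -
        have "\<bar>real M * x $ i - real M * y $ i\<bar> \<le> 1" using xy(3,4)[of i] by linarith
        then have "real M * \<bar>x $ i - y $ i\<bar> \<le> 1"
          by (simp add: abs_mult flip: right_diff_distrib)
        then show ?thesis using \<open>M > 0\<close> by (simp add: field_simps)
      qed
      then have "norm (x - y) \<le> (\<Sum>i\<in>(UNIV :: 'd set). 1 / real M)"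
        using norm_le_l1_cart[of "x - y"] by (meson order_trans sum_mono)
      then show "dist z w \<le> ?d / real M"
        using dist_torus_proj_le[of x y] xy(1,2) by (simp add: dist_norm)
    qed (use fin \<open>s > 0\<close> that in auto)
    also have "\<dots> \<le> ennreal (?d powr s * real M powr (?d - s))"
    proof (rule ennreal_leI)
      have "real (card ?\<V>) * (?d / real M) powr s \<le> real M powr ?d * (?d / real M) powr s"
        using card by (rule mult_right_mono) simp
      also have "\<dots> = ?d powr s * real M powr (?d - s)"
        using \<open>M > 0\<close> by (simp add: powr_divide powr_diff)
      finally show "real (card ?\<V>) * (?d / real M) powr s \<le> ?d powr s * real M powr (?d - s)" .
    qed
    finally show ?thesis .
  qed
  have "hausdorff_premeasure s \<delta> A \<le> 0" if "\<delta> > 0" for \<delta>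
  proof (rule tendsto_lowerbound)
    have "((\<lambda>M. real M powr (?d - s)) \<longlongrightarrow> 0) sequentially"
      using assms by (intro tendsto_neg_powr filterlim_real_sequentially) simp
    then have "((\<lambda>M. ?d powr s * real M powr (?d - s)) \<longlongrightarrow> ?d powr s * 0) sequentially"
      by (rule tendsto_mult_left)
    then have "((\<lambda>M. ennreal (?d powr s * real M powr (?d - s))) \<longlongrightarrow> ennreal (?d powr s * 0)) sequentially"
      by (rule tendsto_ennrealI)
    then show "((\<lambda>M. ennreal (?d powr s * real M powr (?d - s))) \<longlongrightarrow> 0) sequentially" by simp
    have "eventually (\<lambda>M. real M > ?d / \<delta>) sequentially"
      using filterlim_real_sequentially by (rule filterlim_at_top_dense[THEN iffD1, rule_format])
    with eventually_gt_at_top[of 0]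
    show "eventually (\<lambda>M. hausdorff_premeasure s \<delta> A \<le> ennreal (?d powr s * real M powr (?d - s))) sequentially"
    proof eventually_elim
      case (elim M)
      then have "?d / real M \<le> \<delta>" using that by (simp add: field_simps)
      with elim(1) show ?case by (intro le) auto
    qed
  qed simp
  then show ?thesis
    unfolding hausdorff_outer_measure_def by (intro antisym SUP_least) auto
qed

lemma hausdorff_dim_torus_le:
  fixes A :: "'d::finite torus set"
  shows "hausdorff_dim A \<le> of_nat CARD('d)"
proof (rule ennreal_le_epsilon)
  fix e :: real assume "0 < e"
  then have "hausdorff_outer_measure (real CARD('d) + e) A = 0"
    by (intro hausdorff_outer_measure_torus_zero) simp
  then have "hausdorff_dim A \<le> ennreal (real CARD('d) + e)"
    unfolding hausdorff_dim_def using \<open>0 < e\<close> by (intro Inf_lower CollectI exI[of _ "real CARD('d) + e"]) auto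
  then show "hausdorff_dim A \<le> of_nat CARD('d) + ennreal e"
    using \<open>0 < e\<close> by (simp add: ennreal_plus ennreal_of_nat_eq_real_of_nat)
qed

text \<open>A \<open>l\<close>-neighbourhood of a segment is covered by \<open>O(1/l)\<close> balls of radius \<open>2 l\<close>.\<close>

lemma segment_neighbourhood_volume:
  fixes u :: "'a::euclidean_space"
  assumes "norm u = 2"
  shows "\<exists>\<kappa>>0. \<forall>p l. 0 < l \<longrightarrow> l \<le> 1 \<longrightarrow> (\<exists>W\<in>sets borel.
    {x. \<exists>t\<in>{0..1}. norm (x + t *\<^sub>R u - p) \<le> l} \<subseteq> W \<and>
    emeasure lborel W \<le> ennreal (\<kappa> * l powr (real DIM('a) - 1)))"
proof -
  let ?n = "DIM('a)"
  \<comment> \<open>From at most 3 / l balls, each of volume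
    \<open>unit_ball_vol ?n * (2 * l) ^ ?n\<close>.\<close>
  define \<kappa> where "\<kappa> = 3 * (unit_ball_vol ?n * 2 ^ ?n)"
  have ub: "unit_ball_vol (real ?n) > 0" by (intro unit_ball_vol_pos) simp
  then have "\<kappa> > 0" by (simp add: \<kappa>_def)
  moreover have "\<exists>W\<in>sets borel. {x. \<exists>t\<in>{0..1}. norm (x + t *\<^sub>R u - p) \<le> l} \<subseteq> W \<and>
      emeasure lborel W \<le> ennreal (\<kappa> * l powr (real ?n - 1))" if l: "0 < l" "l \<le> 1" for p :: 'a and l
  proof -
    define N where "N = nat \<lfloor>2 / l\<rfloor>"
    \<comment> \<open>Since norm u = 2, parameter steps of l / 2 move the centre by l. Rounding t to
      the grid costs at most l, in addition to the given distance l, whence the radius 2 l.\<close>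
    define c where "c j = p - (real j * l / 2) *\<^sub>R u" for j :: nat
    define W where "W = (\<Union>j\<le>N. cball (c j) (2 * l))"
    have N: "real (Suc N) \<le> 3 / l"
    proof -
      have "real N \<le> 2 / l" using l by (simp add: N_def)
      moreover have "1 \<le> 1 / l" using l by simp
      ultimately have "real (Suc N) \<le> 2 / l + 1 / l" by simp
      then show ?thesis by (simp flip: add_divide_distrib)
    qed
    have "x \<in> W" if t: "t \<in> {0..1}" "norm (x + t *\<^sub>R u - p) \<le> l" for x t
    proof -
      define j where "j = nat \<lfloor>2 * t / l\<rfloor>"
      have "2 * t / l \<le> 2 / l" using t l by (simp add: divide_right_mono)
      then have "j \<le> N" unfolding j_def N_def by (intro nat_mono floor_mono)
      have "real j \<le> 2 * t / l" "2 * t / l \<le> real j + 1"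
        using t l floor_correct[of "2 * t / l"] by (auto simp: j_def)
      then have "real j * l \<le> 2 * t" "2 * t \<le> (real j + 1) * l"
        using l by (simp_all add: pos_le_divide_eq pos_divide_le_eq)
      then have near: "\<bar>t - real j * l / 2\<bar> \<le> l / 2" by (simp add: algebra_simps abs_le_iff)
      have "x - c j = (x + t *\<^sub>R u - p) - (t - real j * l / 2) *\<^sub>R u"
        by (simp add: c_def algebra_simps)
      then have "norm (x - c j) \<le> norm (x + t *\<^sub>R u - p) + norm ((t - real j * l / 2) *\<^sub>R u)"
        by (metis norm_triangle_ineq4)
      also have "\<dots> \<le> l + l" using t(2) near assms by (intro add_mono) simp_all
      finally have "x \<in> cball (c j) (2 * l)" by (simp add: dist_norm norm_minus_commute)
      with \<open>j \<le> N\<close> show ?thesis by (auto simp: W_def)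
    qed
    moreover have "W \<in> sets borel" unfolding W_def by (intro sets.finite_UN) auto
    moreover have "emeasure lborel W \<le> ennreal (\<kappa> * l powr (real ?n - 1))"
    proof -
      have "emeasure lborel W \<le> (\<Sum>j\<le>N. emeasure lborel (cball (c j) (2 * l)))"
        unfolding W_def by (rule emeasure_subadditive_finite) auto
      also have "\<dots> = ennreal (real (Suc N) * (unit_ball_vol ?n * (2 * l) ^ ?n))"
        using l ub by (simp add: emeasure_cball ennreal_mult ennreal_of_nat_eq_real_of_nat)
      also have "\<dots> \<le> ennreal (3 / l * (unit_ball_vol ?n * (2 * l) ^ ?n))"
        using N l ub by (intro ennreal_leI mult_right_mono) auto
      also have "3 / l * (unit_ball_vol ?n * (2 * l) ^ ?n) = \<kappa> * l powr (real ?n - 1)"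
        using l by (simp add: \<kappa>_def powr_diff powr_realpow power_mult_distrib)
      finally show ?thesis .
    qed
    ultimately show ?thesis by blast
  qed
  ultimately show ?thesis by blast
qed


section \<open>Full dimension\<close>

lemma nn_integral_unit_cube_le: "(\<integral>\<^sup>+x. f x \<partial>unit_cube) \<le> (\<integral>\<^sup>+x. f x \<partial>lborel)"
proof -
  have "(\<integral>\<^sup>+x. f x \<partial>unit_cube) = (\<integral>\<^sup>+x. f x * indicator (cbox 0 1) x \<partial>lborel)"
    by (rule nn_integral_restrict_space) simp
  also have "\<dots> \<le> (\<integral>\<^sup>+x. f x \<partial>lborel)"
    by (intro nn_integral_mono) (simp add: indicator_def)
  finally show ?thesis .
qed

text \<open>Fubini: an economical cover of \<open>E\<close> restricts, on the lines in direction \<open>u\<close>, to coverings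
  whose average \<open>\<sigma>\<close>-dimensional size is small.\<close>

lemma hausdorff_outer_measure_pos_of_line_slices:
  fixes E :: "'d::finite torus set" and u :: "real ^ 'd"
  assumes u: "norm u = 2" and "0 < \<sigma>" "0 \<le> s" "s \<le> \<sigma> + (real CARD('d) - 1)"
    and slice: "\<And>F :: (real ^ 'd) set. finite F \<Longrightarrow>
      \<exists>\<eta>>0. AE x in unit_cube. uncoverable \<sigma> F \<eta> {t. torus_proj (x + t *\<^sub>R u) \<in> E}"
  shows "hausdorff_outer_measure s E \<noteq> 0"
proof
  assume zero: "hausdorff_outer_measure s E = 0"
  define s' where "s' = \<sigma> + (real CARD('d) - 1)"
  have "s' > 0" using \<open>0 < \<sigma>\<close> by (simp add: s'_def add_pos_nonneg)
  obtain B where B: "\<And>x. x \<in> cbox 0 (1 :: real ^ 'd) \<Longrightarrow> norm x \<le> B"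
    using bounded_cbox bounded_iff by metis
  \<comment> \<open>The lattice translates that can bring a point of the segment within l i \<le> 1
    of p i, as |x| and |p i| are at most B and |t u| \<le> 2. The bound does not depend on the
    cover, so \<eta> can be fixed before the cover is chosen.\<close>
  define F where "F = {q :: real ^ 'd. q \<in> int_lattice \<and> norm q \<le> 2 * B + 3}"
  have "finite F"
    by (rule finite_int_lattice_bounded) (auto simp: F_def bounded_iff)
  obtain \<kappa> where "\<kappa> > 0" and \<kappa>: "\<And>p l. 0 < l \<Longrightarrow> l \<le> 1 \<Longrightarrow> \<exists>W\<in>sets borel.
      {x. \<exists>t\<in>{0..1}. norm (x + t *\<^sub>R u - p) \<le> l} \<subseteq> W \<and>
      emeasure lborel W \<le> ennreal (\<kappa> * l powr (real CARD('d) - 1))"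
    using segment_neighbourhood_volume[OF u] by auto
  obtain \<eta> where "\<eta> > 0"
    and \<eta>: "AE x in unit_cube. uncoverable \<sigma> F \<eta> {t. torus_proj (x + t *\<^sub>R u) \<in> E}"
    using slice[OF \<open>finite F\<close>] by blast
  \<comment> \<open>Bounds the total tube volume of one member in units of its size to the power d -
    1; adding 1 keeps M positive. A cover of total size below \<eta> / M then leads to a
    contradiction.\<close>
  define M where "M = real (card F) * \<kappa> + 1"
  have "M > 0" using \<open>\<kappa> > 0\<close> by (simp add: M_def add_nonneg_pos)
  obtain U :: "nat \<Rightarrow> 'd torus set" and l where U: "E \<subseteq> (\<Union>i. U i)"
    and l: "\<And>i. 0 < l i" "\<And>i. l i \<le> 1" and diam: "\<And>i x y. x \<in> U i \<Longrightarrow> y \<in> U i \<Longrightarrow> dist x y \<le> l i"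
    and small: "(\<Sum>i. ennreal (l i powr s')) < ennreal (\<eta> / M)"
  proof -
    have "\<eta> / M > 0" "s \<le> s'" using \<open>\<eta> > 0\<close> \<open>M > 0\<close> assms(4) by (simp_all add: s'_def)
    then show ?thesis
      using hausdorff_outer_measure_zero_cover[OF zero \<open>0 \<le> s\<close> _ \<open>s' > 0\<close>] that by meson
  qed
  have "\<exists>p. \<forall>i. U i \<noteq> {} \<longrightarrow> p i \<in> cbox 0 1 \<and> torus_proj (p i) \<in> U i"
  proof (rule choice, rule allI)
    fix i
    show "\<exists>p. U i \<noteq> {} \<longrightarrow> p \<in> cbox 0 1 \<and> torus_proj p \<in> U i"
    proof (cases "U i = {}")
      case False
      then obtain z where "z \<in> U i" by blast
      with torus_proj_cube_surj[of z] show ?thesis by blast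
    qed simp
  qed
  then obtain p where p: "\<And>i. U i \<noteq> {} \<Longrightarrow> p i \<in> cbox 0 1" "\<And>i. U i \<noteq> {} \<Longrightarrow> torus_proj (p i) \<in> U i"
    by blast
  define is_cover where "is_cover i q V \<longleftrightarrow> V \<in> sets borel \<and>
      {x. \<exists>t\<in>{0..1}. norm (x + t *\<^sub>R u - (p i + q)) \<le> l i} \<subseteq> V \<and>
      emeasure lborel V \<le> ennreal (\<kappa> * l i powr (real CARD('d) - 1))" for i q V
  define W where "W i q = (SOME V. is_cover i q V)" for i q
  have "\<exists>V. is_cover i q V" for i q 
    using \<kappa>[OF l(1)[of i] l(2)[of i], of "p i + q"] by (auto simp only: is_cover_def)
  then have "is_cover i q (W i q)" for i q unfolding W_def by (rule someI_ex)
  then have W: "\<And>i q. W i q \<in> sets borel"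
      "\<And>i q. {x. \<exists>t\<in>{0..1}. norm (x + t *\<^sub>R u - (p i + q)) \<le> l i} \<subseteq> W i q"
      "\<And>i q. emeasure lborel (W i q) \<le> ennreal (\<kappa> * l i powr (real CARD('d) - 1))"
    unfolding is_cover_def by simp_all
  \<comment> \<open>An empty member has no centre p i and must contribute nothing. As norm u = 2,
    parameters of points within l i of a common centre differ by at most l i.\<close>
  define G where "G x i q = (if U i = {} then {} else {t. norm (x + t *\<^sub>R u - (p i + q)) \<le> l i})" for x i q
  define J where "J x i = (\<Union>q\<in>F. G x i q)" for x i
  \<comment> \<open>A Borel majorant, in x, of the size of the covering induced on the line through
    x.\<close>
  define S where "S x = (\<Sum>i. ennreal (l i powr \<sigma>) * (\<Sum>q\<in>F. indicator (W i q) x))" for x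
  have "AE x in unit_cube. ennreal \<eta> \<le> S x"
    using \<eta> AE_space
  proof eventually_elim
    case (elim x)
    have x: "x \<in> cbox 0 1" using elim(2) by (simp add: space_restrict_space)
    have small_G: "\<bar>t - t'\<bar> \<le> l i" if "t \<in> G x i q" "t' \<in> G x i q" for i q t t'
    proof -
      have "norm (x + t *\<^sub>R u - (p i + q)) \<le> l i" "norm (x + t' *\<^sub>R u - (p i + q)) \<le> l i"
        using that by (auto simp: G_def split: if_splits)
      then have "norm ((x + t *\<^sub>R u - (p i + q)) - (x + t' *\<^sub>R u - (p i + q))) \<le> l i + l i"
        by (rule norm_triangle_le_diff[OF add_mono])
      moreover have "(x + t *\<^sub>R u - (p i + q)) - (x + t' *\<^sub>R u - (p i + q)) = (t - t') *\<^sub>R u"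
        by (simp add: algebra_simps)
      ultimately show ?thesis using u by simp
    qed
    \<comment> \<open>Otherwise a point of E on the segment would escape every
      \<open>G x i q\<close>. But it lies in some U i, and the lattice vector attaining its distance
      to the centre belongs to F.\<close>
    have "\<not> (\<Sum>i. ennreal (l i powr \<sigma>) * indicator {i. J x i \<inter> {0..1} \<noteq> {}} i) < ennreal \<eta>"
    proof
      assume *: "(\<Sum>i. ennreal (l i powr \<sigma>) * indicator {i. J x i \<inter> {0..1} \<noteq> {}} i) < ennreal \<eta>"
      have "\<exists>t\<in>{0..1} \<inter> {t. torus_proj (x + t *\<^sub>R u) \<in> E}. \<forall>i. t \<notin> (\<Union>p\<in>F. G x i p)"
        by (rule elim(1)[unfolded uncoverable_def, rule_format, of l "G x"])
          (use l(1) small_G * in \<open>simp_all add: J_def\<close>)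
      then obtain t where t: "t \<in> {0..1}" "\<And>i. t \<notin> J x i" "torus_proj (x + t *\<^sub>R u) \<in> E"
        unfolding J_def by blast
      then obtain i where i: "torus_proj (x + t *\<^sub>R u) \<in> U i" using U by blast
      then have "U i \<noteq> {}" by blast
      obtain q where q: "q \<in> int_lattice"
        "dist (torus_proj (x + t *\<^sub>R u)) (torus_proj (p i)) = norm (x + t *\<^sub>R u - p i - q)"
        by (rule dist_torus_proj_attained)
      have le: "norm (x + t *\<^sub>R u - p i - q) \<le> l i"
        using diam[OF i p(2)[OF \<open>U i \<noteq> {}\<close>]] q(2) by simp
      have "norm q \<le> 2 * B + 3"
      proof -
        have "q = (x + t *\<^sub>R u - p i) - (x + t *\<^sub>R u - p i - q)" by simp
        then have "norm q \<le> norm (x + t *\<^sub>R u - p i) + norm (x + t *\<^sub>R u - p i - q)"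
          by (metis norm_triangle_ineq4)
        moreover have "norm (x + t *\<^sub>R u - p i) \<le> norm x + norm (t *\<^sub>R u) + norm (p i)"
          using norm_triangle_ineq4[of "x + t *\<^sub>R u" "p i"] norm_triangle_ineq[of x "t *\<^sub>R u"] by linarith
        moreover have "norm (t *\<^sub>R u) \<le> 2" using t(1) u by simp
        ultimately show ?thesis
          using le l(2)[of i] B[OF x] B[OF p(1)[OF \<open>U i \<noteq> {}\<close>]] by linarith
      qed
      then have "q \<in> F" using q(1) by (simp add: F_def)
      moreover have "t \<in> G x i q" using le \<open>U i \<noteq> {}\<close> by (simp add: G_def diff_diff_eq)
      ultimately show False using t(2) by (auto simp: J_def)
    qed
    then have "ennreal \<eta> \<le> (\<Sum>i. ennreal (l i powr \<sigma>) * indicator {i. J x i \<inter> {0..1} \<noteq> {}} i)"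
      by (simp add: not_less)
    also have "\<dots> \<le> S x"
      unfolding S_def
    proof (rule suminf_le)
      fix i
      have "indicator {i. J x i \<inter> {0..1} \<noteq> {}} i \<le> (\<Sum>q\<in>F. indicator (W i q) x :: ennreal)"
      proof (cases "J x i \<inter> {0..1} = {}")
        case False
        then obtain t q where "t \<in> {0..1}" "q \<in> F" "t \<in> G x i q" unfolding J_def by blast
        have "norm (x + t *\<^sub>R u - (p i + q)) \<le> l i"
          using \<open>t \<in> G x i q\<close> by (simp add: G_def split: if_splits)
        then have "x \<in> {x. \<exists>t\<in>{0..1}. norm (x + t *\<^sub>R u - (p i + q)) \<le> l i}"
          using \<open>t \<in> {0..1}\<close> by blast
        with W(2) have "x \<in> W i q" by (rule subsetD)
        then have "1 \<le> (indicator (W i q) x :: ennreal)" by simp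
        also have "\<dots> \<le> (\<Sum>q\<in>F. indicator (W i q) x)"
          using \<open>q \<in> F\<close> \<open>finite F\<close> by (intro member_le_sum) auto
        finally show ?thesis using False by simp
      qed simp
      then show "ennreal (l i powr \<sigma>) * indicator {i. J x i \<inter> {0..1} \<noteq> {}} i
          \<le> ennreal (l i powr \<sigma>) * (\<Sum>q\<in>F. indicator (W i q) x)"
        by (rule mult_left_mono) simp
    qed (auto intro: summableI)
    finally show ?case .
  qed
  \<comment> \<open>Integration over x: a tube volume of order l^(d-1), weighted by l^\<sigma>,
    gives l^s'. A cover that is cheap for s' therefore cannot make S at least \<eta> almost
    everywhere.\<close>
  then have "(\<integral>\<^sup>+x. ennreal \<eta> \<partial>(unit_cube :: (real ^ 'd) measure)) \<le> (\<integral>\<^sup>+x. S x \<partial>unit_cube)"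
    by (rule nn_integral_mono_AE)
  also have "(\<integral>\<^sup>+x. ennreal \<eta> \<partial>(unit_cube :: (real ^ 'd) measure)) = ennreal \<eta>"
    by (subst nn_integral_const, subst emeasure_unit_cube) simp
  also have "(\<integral>\<^sup>+x. S x \<partial>unit_cube) \<le> (\<integral>\<^sup>+x. S x \<partial>lborel)" by (rule nn_integral_unit_cube_le)
  also have "\<dots> = (\<Sum>i. ennreal (l i powr \<sigma>) * (\<Sum>q\<in>F. emeasure lborel (W i q)))"
    unfolding S_def using W(1)
    by (simp add: nn_integral_suminf nn_integral_cmult nn_integral_sum)
  also have "\<dots> \<le> (\<Sum>i. ennreal M * ennreal (l i powr s'))"
  proof (rule suminf_le)
    fix i
    have "(\<Sum>q\<in>F. emeasure lborel (W i q)) \<le> (\<Sum>q\<in>F. ennreal (\<kappa> * l i powr (real CARD('d) - 1)))"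
      by (intro sum_mono W(3))
    also have "\<dots> = ennreal (real (card F) * (\<kappa> * l i powr (real CARD('d) - 1)))"
      using \<open>\<kappa> > 0\<close> by (simp add: ennreal_mult ennreal_of_nat_eq_real_of_nat)
    also have "\<dots> \<le> ennreal (M * l i powr (real CARD('d) - 1))"
      by (intro ennreal_leI) (simp add: M_def distrib_right)
    finally have "ennreal (l i powr \<sigma>) * (\<Sum>q\<in>F. emeasure lborel (W i q))
        \<le> ennreal (l i powr \<sigma>) * ennreal (M * l i powr (real CARD('d) - 1))"
      by (rule mult_left_mono) simp
    also have "\<dots> = ennreal (l i powr \<sigma> * (M * l i powr (real CARD('d) - 1)))"
      using \<open>M > 0\<close> by (intro ennreal_mult[symmetric]) auto
    also have "l i powr \<sigma> * (M * l i powr (real CARD('d) - 1)) = M * l i powr s'"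
      using l(1)[of i] by (simp add: s'_def powr_add)
    also have "ennreal (M * l i powr s') = ennreal M * ennreal (l i powr s')"
      using \<open>M > 0\<close> by (intro ennreal_mult) auto
    finally show "ennreal (l i powr \<sigma>) * (\<Sum>q\<in>F. emeasure lborel (W i q))
        \<le> ennreal M * ennreal (l i powr s')" .
  qed (auto intro: summableI)
  also have "\<dots> = ennreal M * (\<Sum>i. ennreal (l i powr s'))" by (rule ennreal_suminf_cmult)
  also have "\<dots> < ennreal M * ennreal (\<eta> / M)"
    using small \<open>M > 0\<close> by (intro ennreal_mult_strict_left_mono) auto
  also have "\<dots> = ennreal \<eta>" using \<open>M > 0\<close> \<open>\<eta> > 0\<close> by (simp flip: ennreal_mult)
  finally show False by simp
qed

text \<open>A visit close to 0 would bring the character near integers at all of the next m times,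
  because the m covectors B^i k have bounded norm. A gap in every window thus keeps the whole orbit
  away from 0.\<close>

lemma nondense_orbit_of_character_gap:
  fixes T :: "int ^ 'd ^ 'd" and k :: "real ^ 'd"
  assumes k: "k \<in> int_lattice" and "r > 0"
    and gap: "\<And>n. \<exists>i<m. \<forall>z\<in>\<int>. r \<le> \<bar>k \<bullet> (((*v) (real_mat T)) ^^ (n + i)) x - z\<bar>"
  shows "torus_proj x \<in> nondense_orbit_points (torus_map T)"
proof -
  let ?T = "\<lambda>n. ((*v) (real_mat T)) ^^ n" and ?B = "\<lambda>n. ((*v) (real_mat (transpose T))) ^^ n"
  define D where "D = 1 + (\<Sum>i<m. norm (?B i k))"
  have "D > 0" unfolding D_def by (intro add_pos_nonneg sum_nonneg) auto
  define \<delta> where "\<delta> = r / D"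
  have "\<delta> > 0" using \<open>r > 0\<close> \<open>D > 0\<close> by (simp add: \<delta>_def)
  have far: "\<delta> \<le> dist ((torus_map T ^^ n) (torus_proj x)) (torus_proj 0)" for n
  proof (rule ccontr)
    assume "\<not> ?thesis"
    then have less: "dist (torus_proj (?T n x)) (torus_proj 0) < \<delta>" by (simp add: torus_map_funpow)
    obtain q where q: "q \<in> int_lattice" "dist (torus_proj (?T n x)) (torus_proj 0) = norm (?T n x - 0 - q)"
      by (rule dist_torus_proj_attained)
    obtain i where i: "i < m" "\<And>z. z \<in> \<int> \<Longrightarrow> r \<le> \<bar>k \<bullet> ?T (n + i) x - z\<bar>" using gap by blast
    have "?T (n + i) x = ?T i (?T n x)" by (metis add.commute comp_apply funpow_add)
    then have eq: "k \<bullet> ?T (n + i) x - ?B i k \<bullet> q = ?B i k \<bullet> (?T n x - q)"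
      by (simp add: inner_funpow_adjoint inner_diff_right)
    have "?B i k \<bullet> q \<in> \<int>" by (intro inner_int_lattice int_lattice_funpow k q)
    then have "r \<le> \<bar>?B i k \<bullet> (?T n x - q)\<bar>" using i(2) by (simp flip: eq)
    also have "\<dots> \<le> norm (?B i k) * norm (?T n x - q)" by (rule Cauchy_Schwarz_ineq2)
    also have "\<dots> \<le> D * norm (?T n x - q)"
    proof (rule mult_right_mono)
      have "norm (?B i k) \<le> (\<Sum>i<m. norm (?B i k))" using i(1) by (intro member_le_sum) auto
      then show "norm (?B i k) \<le> D" by (simp add: D_def)
    qed simp
    also have "\<dots> < D * \<delta>" using less q(2) \<open>D > 0\<close> by simp
    also have "\<dots> = r" using \<open>D > 0\<close> by (simp add: \<delta>_def)
    finally show False by simp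
  qed
  have "torus_proj 0 \<notin> closure (range (\<lambda>n. (torus_map T ^^ n) (torus_proj x)))"
    unfolding closure_approachable using far \<open>\<delta> > 0\<close> by (auto simp: not_less)
  then show ?thesis by (auto simp: nondense_orbit_points_def dense_orbit_points_def)
qed

lemma exists_transversal_direction:
  fixes S T :: "int ^ 'd ^ 'd"
  assumes "toral_automorphism T" "quasihyperbolic T"
    and span: "(contracted_space S + unimodular_eigenspace S)
         + (contracted_space T + unimodular_eigenspace T) = UNIV"
    and k: "k \<in> int_lattice" "k \<noteq> 0"
  shows "\<exists>u. norm u = 2 \<and> bounded_orbit (real_mat S) u \<and>
    \<not> bounded (range (\<lambda>n. k \<bullet> (((*v) (real_mat T)) ^^ n) u))"
proof -
  let ?c = "\<lambda>x n. k \<bullet> (((*v) (real_mat T)) ^^ n) x"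
  obtain x where x: "\<not> bounded (range (?c x))"
    using exists_unbounded_coordinate[OF assms(1,2) k] by blast
  have "x \<in> (contracted_space S + unimodular_eigenspace S)
         + (contracted_space T + unimodular_eigenspace T)" using span by simp
  then obtain s1 s0 t1 t0 where st: "s1 \<in> contracted_space S" "s0 \<in> unimodular_eigenspace S"
      "t1 \<in> contracted_space T" "t0 \<in> unimodular_eigenspace T" "x = (s1 + s0) + (t1 + t0)"
    by (auto elim!: set_plus_elim)
  define s where "s = s1 + s0"
  have s: "bounded_orbit (real_mat S) s" unfolding s_def
    by (intro bounded_orbit_add bounded_orbit_contracted_space bounded_orbit_unimodular_eigenspace st)
  have "bounded_orbit (real_mat T) (t1 + t0)"
    by (intro bounded_orbit_add bounded_orbit_contracted_space bounded_orbit_unimodular_eigenspace st)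
  then obtain C where C: "\<And>n. norm ((((*v) (real_mat T)) ^^ n) (t1 + t0)) \<le> C"
    using bounded_orbitD by blast
  have unb: "\<not> bounded (range (?c s))"
  proof
    assume "bounded (range (?c s))"
    then obtain C' where C': "\<And>n. \<bar>?c s n\<bar> \<le> C'" by (auto simp: bounded_iff)
    have "\<bar>?c x n\<bar> \<le> C' + norm k * C" for n
    proof -
      have "?c x n = ?c s n + ?c (t1 + t0) n"
        unfolding st(5) s_def[symmetric] by (simp only: funpow_matrix_add inner_add_right)
      moreover have "\<bar>?c (t1 + t0) n\<bar> \<le> norm k * C"
        using Cauchy_Schwarz_ineq2 mult_left_mono[OF C norm_ge_zero] by (rule order_trans)
      ultimately show ?thesis using C'[of n] by linarith
    qed
    then have "bounded (range (?c x))" by (auto simp: bounded_iff)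
    with x show False by simp
  qed
  have "s \<noteq> 0"
  proof
    assume "s = 0"
    then have "range (?c s) = {0}" by auto
    with unb show False by simp
  qed
  \<comment> \<open>Length 2 is the normalisation under which points of a line lying in a common
    ball of radius l have parameters within l of one another.\<close>
  define a where "a = 2 / norm s"
  have "a > 0" using \<open>s \<noteq> 0\<close> by (simp add: a_def)
  have ca: "?c (a *\<^sub>R s) n = a * ?c s n" for n
    by (simp add: funpow_matrix_scale flip: scalar_mult_eq_scaleR) (simp add: scalar_mult_eq_scaleR)
  have "\<not> bounded (range (?c (a *\<^sub>R s)))"
  proof
    assume "bounded (range (?c (a *\<^sub>R s)))"
    then obtain C' where "\<And>n. \<bar>a * ?c s n\<bar> \<le> C'" by (auto simp: bounded_iff ca)
    then have "\<bar>?c s n\<bar> \<le> C' / a" for n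
      using \<open>a > 0\<close> by (simp add: abs_mult pos_le_divide_eq mult.commute)
    then have "bounded (range (?c s))" by (auto simp: bounded_iff)
    with unb show False by simp
  qed
  moreover have "norm (a *\<^sub>R s) = 2" using \<open>s \<noteq> 0\<close> by (simp add: a_def)
  ultimately show ?thesis using bounded_orbit_scaleR[OF s] by blast
qed

theorem theorem1p1:
  fixes S T :: "int ^ 'd ^ 'd"
  assumes "toral_automorphism S" and "toral_automorphism T"
    and "quasihyperbolic S" and "quasihyperbolic T"
    and "(contracted_space S + unimodular_eigenspace S)
         + (contracted_space T + unimodular_eigenspace T) = UNIV"
  shows "hausdorff_dim (equidistributed_points (torus_map S) \<inter> nondense_orbit_points (torus_map T))
         = of_nat CARD('d)"
proof (rule antisym[OF hausdorff_dim_torus_le])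
  let ?E = "equidistributed_points (torus_map S) \<inter> nondense_orbit_points (torus_map T)"
  let ?T = "\<lambda>n. ((*v) (real_mat T)) ^^ n"
  obtain k Z w where k: "k \<in> int_lattice" "k \<noteq> 0" and Z: "finite Z"
      "\<forall>z\<in>Z. complex_mat (transpose T) *v w z = z *s w z" "complex_vec k = (\<Sum>z\<in>Z. w z)"
    using exists_diagonalizable_character[of T] by blast
  obtain u where u: "norm u = 2" "bounded_orbit (real_mat S) u"
      "\<not> bounded (range (\<lambda>n. k \<bullet> ?T n u))"
    using exists_transversal_direction[OF assms(2,4,5) k] by blast
  define c where "c n = k \<bullet> ?T n u" for n
  obtain m \<rho> a b where growth: "\<rho> > 1" "a > 0" "b > 0" "\<forall>n. \<bar>c n\<bar> \<le> b * \<rho> ^ n"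
      "\<forall>n. \<exists>i<m. a * \<rho> ^ n \<le> \<bar>c (n + i)\<bar>"
    using character_growth[OF Z c_def] u(3) by (auto simp: c_def)
  have nonzero: "hausdorff_outer_measure s ?E \<noteq> 0" if s: "0 \<le> s" "s < real CARD('d)" for s
  proof -
    \<comment> \<open>Volume supplies the d - 1 transversal dimensions, so the line must supply s -
      (d - 1), which is below 1; the value 1 / 2 keeps \<sigma> positive.\<close>
    define \<sigma> where "\<sigma> = max (1 / 2) (s - (real CARD('d) - 1))"
    have \<sigma>: "0 < \<sigma>" "\<sigma> < 1" "s \<le> \<sigma> + (real CARD('d) - 1)" using s by (auto simp: \<sigma>_def)
    show ?thesis
    proof (rule hausdorff_outer_measure_pos_of_line_slices[OF u(1) \<sigma>(1) s(1) \<sigma>(3)])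
      fix F :: "(real ^ 'd) set" assume "finite F"
      then obtain r \<eta> where "r > 0" "\<eta> > 0"
        and gap: "\<And>\<alpha> :: nat \<Rightarrow> real. uncoverable \<sigma> F \<eta>
          {t. \<forall>n. \<exists>i<m. \<forall>z\<in>\<int>. r \<le> \<bar>\<alpha> (n + i) + t * c (n + i) - z\<bar>}"
        using uncoverable_gap_set[OF growth(1-3) growth(4,5)[rule_format] \<sigma>(1,2)] by blast
      \<comment> \<open>The base point enters only through the phases \<alpha> n = k . T^n x. As
        \<open>gap\<close> holds for every \<alpha>, the constants r and \<eta> do not depend on
        x.\<close>
      have "AE x in unit_cube. uncoverable \<sigma> F \<eta> {t. torus_proj (x + t *\<^sub>R u) \<in> ?E}"
        using AE_line_equidistributed[OF assms(1,3) u(2)]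
      proof eventually_elim
        case (elim x)
        have affine: "k \<bullet> ?T n x + t * c n = k \<bullet> ?T n (x + t *\<^sub>R u)" for n t
        proof -
          have "?T n (t *\<^sub>R u) = t *\<^sub>R ?T n u"
            unfolding scalar_mult_eq_scaleR[symmetric] by (rule funpow_matrix_scale)
          then show ?thesis by (simp add: c_def funpow_matrix_add inner_add_right)
        qed
        have "torus_proj (x + t *\<^sub>R u) \<in> ?E"
          if "\<forall>n. \<exists>i<m. \<forall>z\<in>\<int>. r \<le> \<bar>k \<bullet> ?T (n + i) x + t * c (n + i) - z\<bar>" for t
          using nondense_orbit_of_character_gap[OF k(1) \<open>r > 0\<close>, of m T "x + t *\<^sub>R u"] that elim
          by (simp add: affine)
        then show ?case
          by (intro uncoverable_mono[OF gap[of "\<lambda>n. k \<bullet> ?T n x"]]) blast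
      qed
      with \<open>\<eta> > 0\<close> show "\<exists>\<eta>>0. AE x in unit_cube.
          uncoverable \<sigma> F \<eta> {t. torus_proj (x + t *\<^sub>R u) \<in> ?E}" by blast
    qed
  qed
  show "of_nat CARD('d) \<le> hausdorff_dim ?E"
    unfolding hausdorff_dim_def
  proof (rule Inf_greatest)
    fix x assume "x \<in> {ennreal s |s. s \<ge> 0 \<and> hausdorff_outer_measure s ?E = 0}"
    then obtain s where s: "x = ennreal s" "s \<ge> 0" "hausdorff_outer_measure s ?E = 0" by blast
    with nonzero[of s] have "real CARD('d) \<le> s" by (meson not_le)
    then show "of_nat CARD('d) \<le> x"
      by (simp add: s(1) ennreal_of_nat_eq_real_of_nat ennreal_leI del: of_nat_le_iff)
  qed
qed

end
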